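(* Let $p$ be a prime, let $G$ be a totally disconnected locally compact group containing a compact open pro-$p$ subgroup, and let $k$ be an algebraically closed field of characteristic $\ell\neq p$ ($\ell=0$ allowed). Let $R(G)$ be the category of smooth $k$-representations of $G$ and $Z(G)=\operatorname{End}(\operatorname{Id}_{R(G)})$ its Bernstein center. Suppose that $U\subset G$ is a compact open pro-$p$ subgroup and that $R(G)=R(G)^{\heartsuit}\oplus R(G)^{\spadesuit}$ is a decomposition such that every $(\pi,V_\pi)\in R(G)^{\heartsuit}$ is generated, as a $G$-representation, by its $U$-fixed vectors $(V_\pi)^U$. Let $Z(G)^{\heartsuit}=\{z\in Z(G) : z|_{R(G)^{\spadesuit}}=0\}$. Then for every $z\in Z(G)^{\heartsuit}$ the corresponding invariant distribution $f_z$ on $G$ is $U$-admissible.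
   Context: $H(G)$ is the $k$-algebra, under convolution $*$, of locally constant compactly supported $k$-valued measures on $G$. It acts on every smooth representation $(\pi,V_\pi)$ by $\pi(f)v=\int_G f(g)\pi(g)v$; smooth representations of $G$ are the same as non-degenerate $H(G)$-modules, and $H(G)$ is itself such a module by left convolution. $D(G)$ is the space of $k$-valued distributions on $G$ (linear functionals on locally constant compactly supported $k$-valued functions), and $D(G)^G$ is the subspace of those invariant under conjugation by $G$. For $f\in D(G)$ and $h\in H(G)$, $f*h$ is the convolution, $(f*h)(\varphi)=f\big(g\mapsto\int_G\varphi(gx)h(x)\big)$. For $z\in Z(G)$, $f_z\in D(G)^G$ is the invariant distribution determined by $f_z*h=z(h)$ for all $h\in H(G)$, where $z(h)$ is the action of $z$ on the $H(G)$-module $H(G)$. Equivalently, identifying functions with measures by a left Haar measure, $f_z(h)=z(h^* )(\mathrm{id})$, the value at the identity, with $h^*(g)=h(g^{-1})$. The map $z\mapsto f_z$ identifies $Z(G)$ with the space of $f\in D(G)^G$ such that $f*h\in H(G)$ for all $h\in H(G)$. A decomposition $R(G)=R(G)^{\heartsuit}\oplus R(G)^{\spadesuit}$ means a decomposition of categories: both are full subcategories, every $\pi\in R(G)$ is functorially a direct sum $\pi^\heartsuit\oplus\pi^\spadesuit$ with $\pi^\heartsuit\in R(G)^\heartsuit$ and $\pi^\spadesuit\in R(G)^\spadesuit$, and there are no non-zero morphisms between objects of the two subcategories. For a compact open pro-$p$ subgroup $K\subset G$, $\operatorname{Irr}(K)$ is the set of irreducible smooth $k$-representations of $K$. For $\rho\in\operatorname{Irr}(K)$,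 $\Theta_\rho\in H(G)$ is the distribution character of $\rho$ (supported on $K$), normalized as a measure so that for every $\pi\in R(G)$ the operator $\pi(\Theta_\rho)$ is the projection onto the $\check\rho$-isotypic component, where $\check\rho$ is the dual of $\rho$. Explicitly, $\Theta_\rho=\dim(\rho)\operatorname{tr}\rho(u)\,du$ with $du$ the Haar measure on $K$ of total mass $1$. An invariant distribution $f\in D(G)^G$ is called $U$-admissible, for a compact open pro-$p$ subgroup $U\subset G$, if for every compact open subgroup $U'\subset U$ and every $(\rho,V_\rho)\in\operatorname{Irr}(U')$: if $f*\Theta_\rho\neq0$, then there exists $g\in G$ such that $(V_\rho)^{U'\cap gUg^{-1}}\neq0$. *)

theory Defs
  imports
    "HOL-Analysis.Abstract_Topological_Spaces"
    "HOL-Computational_Algebra.Computational_Algebra"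
    "HOL-Algebra.Coset"
begin

section \<open>Topological groups\<close>

locale topological_group = group G for G :: "('g, 'm) monoid_scheme" (structure) +
  fixes T :: "'g topology"
  assumes topspace_eq: "topspace T = carrier G"
    and continuous_mult: "continuous_map (prod_topology T T) T (\<lambda>(x, y). x \<otimes> y)"
    and continuous_inv: "continuous_map T T (\<lambda>x. inv x)"

definition totally_disconnected_top :: "'g topology \<Rightarrow> bool" where
  "totally_disconnected_top T \<longleftrightarrow> (\<forall>S. connectedin T S \<longrightarrow> (\<exists>a. S \<subseteq> {a}))"

definition tdlc_group :: "('g, 'm) monoid_scheme \<Rightarrow> 'g topology \<Rightarrow> bool" where
  "tdlc_group G T \<longleftrightarrow>
     topological_group G T \<and> Hausdorff_space T \<and> locally_compact_space T \<and>
     totally_disconnected_top T"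

definition pro_p_group :: "nat \<Rightarrow> ('g, 'm) monoid_scheme \<Rightarrow> 'g topology \<Rightarrow> bool" where
  "pro_p_group p G T \<longleftrightarrow>
     topological_group G T \<and> compact_space T \<and> Hausdorff_space T \<and>
     totally_disconnected_top T \<and>
     (\<forall>N. N \<lhd> G \<and> openin T N \<longrightarrow> (\<exists>n. Coset.order (G Mod N) = p ^ n))"

definition compact_open_subgroup ::
    "('g, 'm) monoid_scheme \<Rightarrow> 'g topology \<Rightarrow> 'g set \<Rightarrow> bool" where
  "compact_open_subgroup G T K \<longleftrightarrow> subgroup K G \<and> compactin T K \<and> openin T K"

definition compact_open_pro_p_subgroup ::
    "nat \<Rightarrow> ('g, 'm) monoid_scheme \<Rightarrow> 'g topology \<Rightarrow> 'g set \<Rightarrow> bool" where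
  "compact_open_pro_p_subgroup p G T K \<longleftrightarrow>
     compact_open_subgroup G T K \<and> pro_p_group p (G\<lparr>carrier := K\<rparr>) (subtopology T K)"


section \<open>Test functions, distributions, Haar measures\<close>

text \<open>
  Functions on the group are extended by \<open>0\<close> outside \<open>topspace T\<close>, and functionals by \<open>0\<close>
  outside the space of test functions, so that equality in HOL is equality of the
  mathematical objects.
\<close>

definition extend0 :: "'a set \<Rightarrow> ('a \<Rightarrow> 'b::zero) \<Rightarrow> 'a \<Rightarrow> 'b" where
  "extend0 A f = (\<lambda>x. if x \<in> A then f x else 0)"

definition test_functions :: "'g topology \<Rightarrow> ('g \<Rightarrow> 'k::field) set" where
  "test_functions T = {\<phi>.
     (\<forall>x\<in>topspace T. \<exists>N. openin T N \<and> x \<in> N \<and> (\<forall>y\<in>N. \<phi> y = \<phi> x)) \<and>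
     compactin T (T closure_of {x \<in> topspace T. \<phi> x \<noteq> 0}) \<and>
     (\<forall>x. x \<notin> topspace T \<longrightarrow> \<phi> x = 0)}"

type_synonym ('g, 'k) distribution = "('g \<Rightarrow> 'k) \<Rightarrow> 'k"

definition distributions :: "'g topology \<Rightarrow> ('g, 'k::field) distribution set" where
  "distributions T = {f.
     (\<forall>\<phi>\<in>test_functions T. \<forall>\<psi>\<in>test_functions T. f (\<lambda>x. \<phi> x + \<psi> x) = f \<phi> + f \<psi>) \<and>
     (\<forall>c. \<forall>\<phi>\<in>test_functions T. f (\<lambda>x. c * \<phi> x) = c * f \<phi>) \<and>
     (\<forall>\<phi>. \<phi> \<notin> test_functions T \<longrightarrow> f \<phi> = 0)}"

definition invariant_distributions ::
    "('g, 'm) monoid_scheme \<Rightarrow> 'g topology \<Rightarrow> ('g, 'k::field) distribution set" where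
  "invariant_distributions G T = {f \<in> distributions T.
     \<forall>g\<in>carrier G. \<forall>\<phi>\<in>test_functions T.
       f (extend0 (carrier G) (\<lambda>x. \<phi> (g \<otimes>\<^bsub>G\<^esub> x \<otimes>\<^bsub>G\<^esub> inv\<^bsub>G\<^esub> g))) = f \<phi>}"

text \<open>The left-invariant \<open>k\<close>-valued measures, i.e. the left Haar measures together with \<open>0\<close>.\<close>

definition left_invariant_measures ::
    "('g, 'm) monoid_scheme \<Rightarrow> 'g topology \<Rightarrow> ('g, 'k::field) distribution set" where
  "left_invariant_measures G T = {\<nu> \<in> distributions T.
     \<forall>g\<in>carrier G. \<forall>\<phi>\<in>test_functions T.
       \<nu> (extend0 (carrier G) (\<lambda>x. \<phi> (g \<otimes>\<^bsub>G\<^esub> x))) = \<nu> \<phi>}"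

text \<open>The Haar measure of total mass \<open>1\<close> on a compact group; it exists and is unique for a
  pro-\<open>p\<close> group when \<open>p\<close> is invertible in \<open>k\<close>.\<close>

definition normalized_haar ::
    "('g, 'm) monoid_scheme \<Rightarrow> 'g topology \<Rightarrow> ('g, 'k::field) distribution" where
  "normalized_haar G T =
     (THE \<nu>. \<nu> \<in> left_invariant_measures G T \<and> \<nu> (extend0 (carrier G) (\<lambda>_. 1)) = 1)"


section \<open>The Hecke algebra\<close>

text \<open>The locally constant compactly supported measures: products \<open>\<theta>(x) dx\<close> of a locally
  constant compactly supported function with a left Haar measure, seen as distributions.\<close>

definition hecke ::
    "('g, 'm) monoid_scheme \<Rightarrow> 'g topology \<Rightarrow> ('g, 'k::field) distribution set" where
  "hecke G T = {extend0 (test_functions T) (\<lambda>\<phi>. \<nu> (\<lambda>x. \<theta> x * \<phi> x)) | \<nu> \<theta>.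
     \<nu> \<in> left_invariant_measures G T \<and> \<theta> \<in> test_functions T}"

text \<open>\<open>(f * h)(\<phi>) = f (g \<mapsto> \<integral> \<phi>(g x) h(x))\<close>; the inner integral is the value of the
  measure \<open>h\<close> on the function \<open>x \<mapsto> \<phi>(g x)\<close>.\<close>

definition convolution ::
    "('g, 'm) monoid_scheme \<Rightarrow> 'g topology \<Rightarrow> ('g, 'k::field) distribution \<Rightarrow>
     ('g, 'k) distribution \<Rightarrow> ('g, 'k) distribution" where
  "convolution G T f h = extend0 (test_functions T) (\<lambda>\<phi>.
     f (extend0 (carrier G) (\<lambda>g. h (extend0 (carrier G) (\<lambda>x. \<phi> (g \<otimes>\<^bsub>G\<^esub> x))))))"

text \<open>The action of \<open>g\<close> on \<open>H(G)\<close> that belongs to left convolution, \<open>h \<mapsto> \<delta>\<^sub>g * h\<close>.\<close>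

definition left_translate ::
    "('g, 'm) monoid_scheme \<Rightarrow> 'g topology \<Rightarrow> 'g \<Rightarrow> ('g, 'k::field) distribution \<Rightarrow>
     ('g, 'k) distribution" where
  "left_translate G T g h = extend0 (test_functions T) (\<lambda>\<phi>.
     h (extend0 (carrier G) (\<lambda>x. \<phi> (g \<otimes>\<^bsub>G\<^esub> x))))"


section \<open>Smooth representations\<close>

text \<open>
  Representations live on subspaces of a fixed \<open>k\<close>-vector space, a type \<open>'v\<close> with scalar
  multiplication \<open>scl\<close>, which plays the role of the universe in which the category
  \<open>R(G)\<close> is formed. The values of \<open>action\<close> outside the group and the space are irrelevant.
\<close>

record ('g, 'v) group_rep =
  vectors :: "'v set"
  action :: "'g \<Rightarrow> 'v \<Rightarrow> 'v"

definition linear_between ::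
    "('k \<Rightarrow> 'v \<Rightarrow> 'v) \<Rightarrow> 'v::ab_group_add set \<Rightarrow> 'v set \<Rightarrow> ('v \<Rightarrow> 'v) \<Rightarrow> bool" where
  "linear_between scl V W f \<longleftrightarrow>
     (\<forall>v\<in>V. f v \<in> W) \<and> (\<forall>v\<in>V. \<forall>w\<in>V. f (v + w) = f v + f w) \<and>
     (\<forall>c. \<forall>v\<in>V. f (scl c v) = scl c (f v))"

definition smooth_reps ::
    "('g, 'm) monoid_scheme \<Rightarrow> 'g topology \<Rightarrow> ('k::field \<Rightarrow> 'v \<Rightarrow> 'v::ab_group_add) \<Rightarrow>
     ('g, 'v) group_rep set" where
  "smooth_reps G T scl = {\<pi>.
     module.subspace scl (vectors \<pi>) \<and>
     (\<forall>g\<in>carrier G. linear_between scl (vectors \<pi>) (vectors \<pi>) (action \<pi> g)) \<and>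
     (\<forall>v\<in>vectors \<pi>. action \<pi> \<one>\<^bsub>G\<^esub> v = v) \<and>
     (\<forall>g\<in>carrier G. \<forall>h\<in>carrier G. \<forall>v\<in>vectors \<pi>.
        action \<pi> (g \<otimes>\<^bsub>G\<^esub> h) v = action \<pi> g (action \<pi> h v)) \<and>
     (\<forall>v\<in>vectors \<pi>. openin T {g \<in> carrier G. action \<pi> g v = v})}"

definition rep_hom ::
    "('g, 'm) monoid_scheme \<Rightarrow> ('k \<Rightarrow> 'v \<Rightarrow> 'v::ab_group_add) \<Rightarrow>
     ('g, 'v) group_rep \<Rightarrow> ('g, 'v) group_rep \<Rightarrow> ('v \<Rightarrow> 'v) set" where
  "rep_hom G scl \<pi> \<sigma> = {f.
     linear_between scl (vectors \<pi>) (vectors \<sigma>) f \<and>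
     (\<forall>g\<in>carrier G. \<forall>v\<in>vectors \<pi>. f (action \<pi> g v) = action \<sigma> g (f v))}"

definition rep_isomorphic ::
    "('g, 'm) monoid_scheme \<Rightarrow> ('k \<Rightarrow> 'v \<Rightarrow> 'v::ab_group_add) \<Rightarrow>
     ('g, 'v) group_rep \<Rightarrow> ('g, 'v) group_rep \<Rightarrow> bool" where
  "rep_isomorphic G scl \<pi> \<sigma> \<longleftrightarrow>
     (\<exists>f\<in>rep_hom G scl \<pi> \<sigma>. bij_betw f (vectors \<pi>) (vectors \<sigma>))"

definition invariant_subspace ::
    "('g, 'm) monoid_scheme \<Rightarrow> ('k::field \<Rightarrow> 'v \<Rightarrow> 'v::ab_group_add) \<Rightarrow>
     ('g, 'v) group_rep \<Rightarrow> 'v set \<Rightarrow> bool" where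
  "invariant_subspace G scl \<pi> W \<longleftrightarrow>
     module.subspace scl W \<and> W \<subseteq> vectors \<pi> \<and>
     (\<forall>g\<in>carrier G. \<forall>w\<in>W. action \<pi> g w \<in> W)"

definition fixed_vectors :: "('g, 'v) group_rep \<Rightarrow> 'g set \<Rightarrow> 'v set" where
  "fixed_vectors \<pi> K = {v \<in> vectors \<pi>. \<forall>g\<in>K. action \<pi> g v = v}"

definition generated_by_fixed_vectors ::
    "('g, 'm) monoid_scheme \<Rightarrow> ('k::field \<Rightarrow> 'v \<Rightarrow> 'v::ab_group_add) \<Rightarrow>
     'g set \<Rightarrow> ('g, 'v) group_rep \<Rightarrow> bool" where
  "generated_by_fixed_vectors G scl U \<pi> \<longleftrightarrow>
     module.span scl {action \<pi> g v | g v. g \<in> carrier G \<and> v \<in> fixed_vectors \<pi> U}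
       = vectors \<pi>"

definition irreducible_reps ::
    "('g, 'm) monoid_scheme \<Rightarrow> 'g topology \<Rightarrow> ('k::field \<Rightarrow> 'v \<Rightarrow> 'v::ab_group_add) \<Rightarrow>
     ('g, 'v) group_rep set" where
  "irreducible_reps G T scl = {\<rho> \<in> smooth_reps G T scl.
     vectors \<rho> \<noteq> {0} \<and>
     (\<forall>W. invariant_subspace G scl \<rho> W \<longrightarrow> W = {0} \<or> W = vectors \<rho>)}"

text \<open>A decomposition of \<open>R(G)\<close> into two full subcategories, given by their classes of objects
  \<open>A\<close> and \<open>B\<close>. The functorial direct sum is expressed by subrepresentations \<open>a \<pi>\<close> and \<open>b \<pi>\<close>
  that are preserved by all morphisms. Since \<open>A\<close> and \<open>B\<close> are not required to be closed under
  isomorphism, the summands are only required to be isomorphic to objects of \<open>A\<close> and \<open>B\<close>.\<close>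

definition category_decomposition ::
    "('g, 'm) monoid_scheme \<Rightarrow> 'g topology \<Rightarrow> ('k::field \<Rightarrow> 'v \<Rightarrow> 'v::ab_group_add) \<Rightarrow>
     ('g, 'v) group_rep set \<Rightarrow> ('g, 'v) group_rep set \<Rightarrow> bool" where
  "category_decomposition G T scl A B \<longleftrightarrow>
     A \<subseteq> smooth_reps G T scl \<and> B \<subseteq> smooth_reps G T scl \<and>
     (\<exists>a b.
       (\<forall>\<pi>\<in>smooth_reps G T scl.
          invariant_subspace G scl \<pi> (a \<pi>) \<and> invariant_subspace G scl \<pi> (b \<pi>) \<and>
          (\<exists>\<sigma>\<in>A. rep_isomorphic G scl (\<pi>\<lparr>vectors := a \<pi>\<rparr>) \<sigma>) \<and>
          (\<exists>\<sigma>\<in>B. rep_isomorphic G scl (\<pi>\<lparr>vectors := b \<pi>\<rparr>) \<sigma>) \<and>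
          vectors \<pi> = {v + w | v w. v \<in> a \<pi> \<and> w \<in> b \<pi>} \<and> a \<pi> \<inter> b \<pi> = {0}) \<and>
       (\<forall>\<pi>\<in>smooth_reps G T scl. \<forall>\<sigma>\<in>smooth_reps G T scl. \<forall>f\<in>rep_hom G scl \<pi> \<sigma>.
          f ` a \<pi> \<subseteq> a \<sigma> \<and> f ` b \<pi> \<subseteq> b \<sigma>)) \<and>
     (\<forall>\<pi>\<in>A. \<forall>\<sigma>\<in>B.
        (\<forall>f\<in>rep_hom G scl \<pi> \<sigma>. \<forall>v\<in>vectors \<pi>. f v = 0) \<and>
        (\<forall>f\<in>rep_hom G scl \<sigma> \<pi>. \<forall>v\<in>vectors \<sigma>. f v = 0))"


section \<open>The Bernstein center\<close>

text \<open>The natural endomorphisms of the identity functor of \<open>R(G)\<close>; the values of \<open>z \<pi>\<close>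
  outside the space of \<open>\<pi>\<close> are irrelevant.\<close>

definition bernstein_center ::
    "('g, 'm) monoid_scheme \<Rightarrow> 'g topology \<Rightarrow> ('k::field \<Rightarrow> 'v \<Rightarrow> 'v::ab_group_add) \<Rightarrow>
     (('g, 'v) group_rep \<Rightarrow> 'v \<Rightarrow> 'v) set" where
  "bernstein_center G T scl = {z.
     (\<forall>\<pi>\<in>smooth_reps G T scl. z \<pi> \<in> rep_hom G scl \<pi> \<pi>) \<and>
     (\<forall>\<pi>\<in>smooth_reps G T scl. \<forall>\<sigma>\<in>smooth_reps G T scl. \<forall>f\<in>rep_hom G scl \<pi> \<sigma>.
        \<forall>v\<in>vectors \<pi>. f (z \<pi> v) = z \<sigma> (f v))}"

definition center_vanishing_on ::
    "('g, 'm) monoid_scheme \<Rightarrow> 'g topology \<Rightarrow> ('k::field \<Rightarrow> 'v \<Rightarrow> 'v::ab_group_add) \<Rightarrow>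
     ('g, 'v) group_rep set \<Rightarrow> (('g, 'v) group_rep \<Rightarrow> 'v \<Rightarrow> 'v) set" where
  "center_vanishing_on G T scl B =
     {z \<in> bernstein_center G T scl. \<forall>\<pi>\<in>B. \<forall>v\<in>vectors \<pi>. z \<pi> v = 0}"

text \<open>The universe is large enough for \<open>H(G)\<close> to be an object of \<open>R(G)\<close>: a linear embedding
  of \<open>H(G)\<close> into it. This is a size condition only (\<open>H(G)\<close> is itself contained in the vector
  space of all functionals); without it \<open>z\<close> would have no value on \<open>H(G)\<close>.\<close>

definition hecke_embedding ::
    "('g, 'm) monoid_scheme \<Rightarrow> 'g topology \<Rightarrow> ('k::field \<Rightarrow> 'v \<Rightarrow> 'v::ab_group_add) \<Rightarrow>
     (('g, 'k) distribution \<Rightarrow> 'v) \<Rightarrow> bool" where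
  "hecke_embedding G T scl \<iota> \<longleftrightarrow>
     inj_on \<iota> (hecke G T) \<and>
     (\<forall>h\<in>hecke G T. \<forall>h'\<in>hecke G T. \<iota> (\<lambda>\<phi>. h \<phi> + h' \<phi>) = \<iota> h + \<iota> h') \<and>
     (\<forall>c. \<forall>h\<in>hecke G T. \<iota> (\<lambda>\<phi>. c * h \<phi>) = scl c (\<iota> h))"

definition hecke_rep ::
    "('g, 'm) monoid_scheme \<Rightarrow> 'g topology \<Rightarrow> (('g, 'k::field) distribution \<Rightarrow> 'v) \<Rightarrow>
     ('g, 'v) group_rep" where
  "hecke_rep G T \<iota> = \<lparr>vectors = \<iota> ` hecke G T,
     action = (\<lambda>g v. \<iota> (left_translate G T g (the_inv_into (hecke G T) \<iota> v)))\<rparr>"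

definition center_on_hecke ::
    "('g, 'm) monoid_scheme \<Rightarrow> 'g topology \<Rightarrow> (('g, 'k::field) distribution \<Rightarrow> 'v) \<Rightarrow>
     (('g, 'v) group_rep \<Rightarrow> 'v \<Rightarrow> 'v) \<Rightarrow> ('g, 'k) distribution \<Rightarrow> ('g, 'k) distribution" where
  "center_on_hecke G T \<iota> z h = the_inv_into (hecke G T) \<iota> (z (hecke_rep G T \<iota>) (\<iota> h))"

definition center_distribution ::
    "('g, 'm) monoid_scheme \<Rightarrow> 'g topology \<Rightarrow> (('g, 'k::field) distribution \<Rightarrow> 'v) \<Rightarrow>
     (('g, 'v) group_rep \<Rightarrow> 'v \<Rightarrow> 'v) \<Rightarrow> ('g, 'k) distribution" where
  "center_distribution G T \<iota> z =
     (THE f. f \<in> invariant_distributions G T \<and>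
        (\<forall>h\<in>hecke G T. convolution G T f h = center_on_hecke G T \<iota> z h))"


section \<open>Characters and admissibility\<close>

text \<open>The trace of an endomorphism of a finite-dimensional subspace, computed in an arbitrary
  basis.\<close>

definition trace_on ::
    "('k::field \<Rightarrow> 'v \<Rightarrow> 'v::ab_group_add) \<Rightarrow> 'v set \<Rightarrow> ('v \<Rightarrow> 'v) \<Rightarrow> 'k" where
  "trace_on scl V f =
     (let B = (SOME B. \<not> module.dependent scl B \<and> module.span scl B = V)
      in \<Sum>b\<in>B. module.representation scl B (f b) b)"

definition character_measure ::
    "('g, 'm) monoid_scheme \<Rightarrow> 'g topology \<Rightarrow> ('k::field \<Rightarrow> 'v \<Rightarrow> 'v::ab_group_add) \<Rightarrow>
     'g set \<Rightarrow> ('g, 'v) group_rep \<Rightarrow> ('g, 'k) distribution" where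
  "character_measure G T scl K \<rho> = extend0 (test_functions T) (\<lambda>\<phi>.
     normalized_haar (G\<lparr>carrier := K\<rparr>) (subtopology T K)
       (extend0 K (\<lambda>u. of_nat (vector_space.dim scl (vectors \<rho>)) *
                       trace_on scl (vectors \<rho>) (action \<rho> u) * \<phi> u)))"

text \<open>\<open>U\<close>-admissibility, with the irreducible representations taken on subspaces of a vector
  space that need not be the universe in which \<open>R(G)\<close> is formed.\<close>

definition admissible_distribution ::
    "('g, 'm) monoid_scheme \<Rightarrow> 'g topology \<Rightarrow> ('k::field \<Rightarrow> 'w \<Rightarrow> 'w::ab_group_add) \<Rightarrow>
     'g set \<Rightarrow> ('g, 'k) distribution \<Rightarrow> bool" where
  "admissible_distribution G T scl U f \<longleftrightarrow>
     f \<in> invariant_distributions G T \<and>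
     (\<forall>U'. compact_open_subgroup G T U' \<and> U' \<subseteq> U \<longrightarrow>
       (\<forall>\<rho>\<in>irreducible_reps (G\<lparr>carrier := U'\<rparr>) (subtopology T U') scl.
          convolution G T f (character_measure G T scl U' \<rho>) \<noteq> (\<lambda>_. 0) \<longrightarrow>
          (\<exists>g\<in>carrier G.
             fixed_vectors \<rho> (U' \<inter> ((g <#\<^bsub>G\<^esub> U) #>\<^bsub>G\<^esub> inv\<^bsub>G\<^esub> g)) \<noteq> {0})))"

end

theory Submission imports Defs begin

text \<open>
  The distribution \<open>f\<close> of \<open>z\<close> is given by \<open>f \<phi> = z(e) \<phi>\<close>, where \<open>e\<close> is the normalized Haar measure of
  an open subgroup that fixes \<open>\<phi>\<close> on the right; this does not depend on the subgroup because \<open>z\<close>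
  commutes with right translations.

  Now let \<open>\<Theta>\<close> be the character measure of an irreducible \<open>\<rho>\<close> of \<open>U'\<close>, and let \<open>w\<close> be the component of
  \<open>\<Theta> \<in> H(G)\<close> in the first summand of the decomposition. As \<open>z\<close> kills the other component,
  \<open>f * \<Theta> = z(\<Theta>) = z(w)\<close>, so it suffices to show \<open>w = 0\<close> if \<open>\<rho>\<close> has no nonzero vector fixed by a
  group \<open>L = U' \<inter> gUg\<inverse>\<close>. The average of \<open>\<rho>\<close> over \<open>L\<close> projects onto the \<open>L\<close>-fixed vectors, so it
  vanishes; taking traces, the average over \<open>L\<close> of every \<open>U'\<close>-translate of \<open>\<Theta>\<close> vanishes, hence the same
  holds for \<open>w\<close>, by equivariance of the decomposition. On the other hand \<open>w\<close> is a sum of vectors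
  \<open>g v\<close> with \<open>v\<close> fixed by \<open>U\<close>, which are fixed by such groups \<open>L\<close>. Since the index of open subgroups
  of \<open>U'\<close> is invertible in \<open>k\<close>, Maschke's averaging argument yields a \<open>U'\<close>-equivariant projection
  onto the span of the orbit of \<open>w\<close>. It fixes \<open>w\<close> but maps each summand to an \<open>L\<close>-fixed vector
  of that span, that is, to \<open>0\<close>.
\<close>


section \<open>Left cosets\<close>

text \<open>\<open>k\<close> carries no topology, so every integral here is a finite sum over cosets
  divided by an index, and the dependence on the chosen subgroup has to be removed each time;
  invertibility of these indices is where \<open>CHAR('k) \<noteq> p\<close> enters.
  \<open>center_distribution\<close> is a definite description, so existence and uniqueness of the
  invariant distribution with \<open>f * h = z(h)\<close> must be in hand before anything can be
  said about it. Its conjugation invariance involves the modulus, since \<open>G\<close> need not be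
  unimodular. In the second half, \<open>\<rho>\<close> and \<open>H(G)\<close> live in different
  vector types, so no intertwining map between them can be formed; the absence of
  \<open>L\<close>-fixed vectors in \<open>\<rho>\<close> is passed on through the scalar function
  \<open>tr\<close>. The groups \<open>L\<close> vary with the summands of \<open>w\<close>: each
  average kills \<open>w\<close> as a whole but says nothing about a single summand, and the
  equivariant projection is what moves every summand into the span of the orbit of \<open>w\<close>,
  where its own average vanishes.\<close>

definition lcosets_in :: "('g, 'm) monoid_scheme \<Rightarrow> 'g set \<Rightarrow> 'g set \<Rightarrow> 'g set set" where
  "lcosets_in G A N = (\<lambda>x. x <#\<^bsub>G\<^esub> N) ` A"

definition coset_rep :: "'g set \<Rightarrow> 'g" where
  "coset_rep C = (SOME x. x \<in> C)"

context group
begin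

lemma mem_lcoset_iff:
  assumes "subgroup N G" "x \<in> carrier G" "y \<in> carrier G"
  shows "y \<in> x <# N \<longleftrightarrow> inv x \<otimes> y \<in> N"
proof
  assume "y \<in> x <# N"
  then obtain n where n: "n \<in> N" "y = x \<otimes> n" by (auto simp: l_coset_def)
  with assms show "inv x \<otimes> y \<in> N"
    by (metis inv_closed l_inv l_one m_assoc subgroup.mem_carrier)
next
  assume "inv x \<otimes> y \<in> N"
  moreover have "y = x \<otimes> (inv x \<otimes> y)"
    using assms by (metis inv_closed l_one m_assoc r_inv)
  ultimately show "y \<in> x <# N" by (auto simp: l_coset_def)
qed

lemma lcoset_eq_iff:
  assumes N: "subgroup N G" and x: "x \<in> carrier G" and y: "y \<in> carrier G"
  shows "x <# N = y <# N \<longleftrightarrow> inv x \<otimes> y \<in> N"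
proof
  assume "x <# N = y <# N"
  moreover have "y \<in> y <# N" using N y by (simp add: mem_lcoset_iff subgroup.one_closed)
  ultimately show "inv x \<otimes> y \<in> N" using assms mem_lcoset_iff by blast
next
  assume *: "inv x \<otimes> y \<in> N"
  then have "y \<in> x <# N" using assms by (simp add: mem_lcoset_iff)
  then show "x <# N = y <# N" using N x l_repr_independence by blast
qed

lemma coset_rep_in:
  assumes "subgroup N G" "x \<in> carrier G"
  shows "coset_rep (x <# N) \<in> x <# N"
  unfolding coset_rep_def
  by (rule someI[of _ x]) (use assms in \<open>simp add: mem_lcoset_iff subgroup.one_closed\<close>)

lemma coset_rep_closed:
  assumes "subgroup N G" "x \<in> carrier G"
  shows "coset_rep (x <# N) \<in> carrier G"
  using coset_rep_in[OF assms] assms by (auto simp: l_coset_def subgroup.mem_carrier)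

lemma coset_rep_lcoset:
  assumes "subgroup N G" "x \<in> carrier G"
  shows "coset_rep (x <# N) <# N = x <# N"
  using coset_rep_in[OF assms] assms l_repr_independence by metis

text \<open>This is what makes sums over chosen representatives independent of the choice.\<close>

lemma right_invariant_coset_rep:
  assumes "subgroup N G" "x \<in> carrier G" "\<And>n. n \<in> N \<Longrightarrow> F (x \<otimes> n) = F x"
  shows "F (coset_rep (x <# N)) = F x"
  using coset_rep_in[OF assms(1,2)] assms(3) by (auto simp: l_coset_def)

lemma coset_rep_lcosets_in:
  assumes "subgroup N G" "subgroup K G" "N \<subseteq> K" "C \<in> lcosets_in G K N"
  shows "coset_rep C \<in> K"
proof -
  obtain x where "x \<in> K" "C = x <# N" using assms(4) by (auto simp: lcosets_in_def)
  then show ?thesis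
    using coset_rep_in[of N x] assms(1-3)
    by (auto simp: l_coset_def subgroup.mem_carrier subset_iff subgroup.m_closed)
qed

lemma lcosets_in_self:
  assumes "subgroup K G"
  shows "lcosets_in G K K = {K}"
proof -
  have "x <# K = K" if "x \<in> K" for x
    using coset_join3[OF subgroup.mem_carrier[OF assms that] assms that] .
  then show ?thesis using subgroup.one_closed[OF assms] unfolding lcosets_in_def by blast
qed

lemma left_mult_image_subgroup:
  assumes "subgroup K G" "k \<in> K"
  shows "(\<lambda>x. k \<otimes> x) ` K = K"
proof -
  have "(\<lambda>x. k \<otimes> x) ` K = k <# K" by (auto simp: l_coset_def)
  then show ?thesis using coset_join3[OF subgroup.mem_carrier[OF assms] assms] by simp
qed

text \<open>Every element of \<open>A\<close> lies in \<open>r <# M\<close> for exactly one chosen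
  representative \<open>r\<close>, and \<open>r <# M\<close> splits into the translates by
  \<open>r\<close> of the \<open>N\<close>-cosets of \<open>M\<close>. Stability of \<open>A\<close>
  under \<open>M\<close> keeps these translates among the cosets of elements of
  \<open>A\<close>.\<close>

lemma lcosets_in_refine_bij:
  assumes M: "subgroup M G" and N: "subgroup N G" and NM: "N \<subseteq> M" and A: "A \<subseteq> carrier G"
    and AM: "\<And>x m. x \<in> A \<Longrightarrow> m \<in> M \<Longrightarrow> x \<otimes> m \<in> A"
  shows "bij_betw (\<lambda>(C, D). coset_rep C <# D) (lcosets_in G A M \<times> lcosets_in G M N) (lcosets_in G A N)"
proof -
  have NG: "N \<subseteq> carrier G" and MG: "M \<subseteq> carrier G"
    using M N by (auto dest: subgroup.subset)
  have inj: "x <# M = y <# M \<and> m <# N = n <# N"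
    if x: "x \<in> A" "y \<in> A" "m \<in> M" "n \<in> M"
      and eq: "coset_rep (x <# M) <# (m <# N) = coset_rep (y <# M) <# (n <# N)" for x y m n
  proof -
    define a b where "a = coset_rep (x <# M)" and "b = coset_rep (y <# M)"
    have ab: "a \<in> carrier G" "b \<in> carrier G" "a <# M = x <# M" "b <# M = y <# M"
      using x A coset_rep_closed[OF M] coset_rep_lcoset[OF M] by (auto simp: a_def b_def)
    have mn: "m \<in> carrier G" "n \<in> carrier G" using x MG by auto
    have "(a \<otimes> m) <# N = (b \<otimes> n) <# N"
      using eq ab mn NG by (simp add: lcos_m_assoc a_def b_def)
    then have *: "inv (a \<otimes> m) \<otimes> (b \<otimes> n) \<in> N"
      using ab mn N by (subst (asm) lcoset_eq_iff) auto
    \<comment> \<open>Undoing \<open>m\<close> on the left and \<open>n\<close> on the right leaves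
      \<open>inv a \<otimes> b\<close>, so \<open>a\<close> and \<open>b\<close> agree modulo
      \<open>M\<close>.\<close>
    have "m \<otimes> (inv (a \<otimes> m) \<otimes> (b \<otimes> n)) \<otimes> inv n \<in> M"
      using * NM x M by (meson subgroup.m_closed subgroup.m_inv_closed subsetD)
    also have "m \<otimes> (inv (a \<otimes> m) \<otimes> (b \<otimes> n)) \<otimes> inv n = inv a \<otimes> b"
      using ab mn by (simp add: inv_mult_group m_assoc inv_solve_left inv_solve_right r_inv m_closed)
         (metis inv_closed l_one m_assoc m_closed r_inv)
    finally have "a <# M = b <# M" using lcoset_eq_iff[OF M ab(1,2)] by blast
    then have xy: "x <# M = y <# M" using ab by simp
    \<comment> \<open>Both are picked from the same set by the same choice function.\<close>
    then have "a = b" by (simp add: a_def b_def)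
    with * have "inv m \<otimes> n \<in> N"
      using ab mn by (simp add: inv_mult_group m_assoc) (metis inv_closed l_one m_assoc l_inv m_closed)
    with xy show ?thesis using mn N by (simp add: lcoset_eq_iff)
  qed
  show ?thesis
    unfolding bij_betw_def
  proof
    show "inj_on (\<lambda>(C, D). coset_rep C <# D) (lcosets_in G A M \<times> lcosets_in G M N)"
      using inj by (force simp: inj_on_def lcosets_in_def)
    have "coset_rep (x <# M) <# (m <# N) \<in> lcosets_in G A N" if "x \<in> A" "m \<in> M" for x m
    proof -
      have "coset_rep (x <# M) \<in> x <# M" using that A M coset_rep_in by auto
      then obtain m' where m': "m' \<in> M" "coset_rep (x <# M) = x \<otimes> m'" by (auto simp: l_coset_def)
      then have "coset_rep (x <# M) <# (m <# N) = (x \<otimes> (m' \<otimes> m)) <# N"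
        using that A MG NG by (simp add: lcos_m_assoc m_assoc subset_iff)
      then show ?thesis
        using that m' AM M by (auto simp: lcosets_in_def subgroup.m_closed)
    qed
    moreover have "\<exists>C\<in>lcosets_in G A M. \<exists>D\<in>lcosets_in G M N. x <# N = coset_rep C <# D" if "x \<in> A" for x
    proof -
      define a where "a = coset_rep (x <# M)"
      have a: "a \<in> carrier G" "x \<in> carrier G" "a <# M = x <# M"
        using that A coset_rep_closed[OF M] coset_rep_lcoset[OF M] by (auto simp: a_def)
      then have "inv a \<otimes> x \<in> M" using M by (simp add: lcoset_eq_iff)
      moreover have "a <# ((inv a \<otimes> x) <# N) = x <# N"
        using a NG by (simp add: lcos_m_assoc m_assoc[symmetric])
      ultimately show ?thesis using that unfolding lcosets_in_def a_def by (metis imageI)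
    qed
    ultimately show "(\<lambda>(C, D). coset_rep C <# D) ` (lcosets_in G A M \<times> lcosets_in G M N) = lcosets_in G A N"
      by (force simp: lcosets_in_def image_iff)
  qed
qed

lemma card_lcosets_in_refine:
  assumes "subgroup M G" "subgroup N G" "N \<subseteq> M" "A \<subseteq> carrier G"
    and "\<And>x m. x \<in> A \<Longrightarrow> m \<in> M \<Longrightarrow> x \<otimes> m \<in> A"
  shows "card (lcosets_in G A N) = card (lcosets_in G A M) * card (lcosets_in G M N)"
  using bij_betw_same_card[OF lcosets_in_refine_bij[OF assms]] by (simp add: card_cartesian_product)

text \<open>Each coset of \<open>M\<close> breaks into equally many cosets of \<open>N\<close>, on
  which \<open>F\<close> keeps its value. The division by an index in \<open>haar\<close> cancels
  exactly this factor.\<close>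

lemma sum_lcosets_in_refine:
  fixes F :: "'a \<Rightarrow> 'r::semiring_1"
  assumes M: "subgroup M G" and N: "subgroup N G" and NM: "N \<subseteq> M" and A: "A \<subseteq> carrier G"
    and AM: "\<And>x m. x \<in> A \<Longrightarrow> m \<in> M \<Longrightarrow> x \<otimes> m \<in> A"
    and F: "\<And>x m. x \<in> A \<Longrightarrow> m \<in> M \<Longrightarrow> F (x \<otimes> m) = F x"
  shows "(\<Sum>D\<in>lcosets_in G A N. F (coset_rep D))
       = of_nat (card (lcosets_in G M N)) * (\<Sum>C\<in>lcosets_in G A M. F (coset_rep C))"
proof -
  have "F (coset_rep (coset_rep C <# D)) = F (coset_rep C)"
    if "C \<in> lcosets_in G A M" "D \<in> lcosets_in G M N" for C D
  proof -
    obtain x m where xm: "x \<in> A" "C = x <# M" "m \<in> M" "D = m <# N"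
      using \<open>C \<in> _\<close> \<open>D \<in> _\<close> by (auto simp: lcosets_in_def)
    have "coset_rep C \<in> x <# M" using coset_rep_in M xm A by blast
    then obtain m' where m': "m' \<in> M" "coset_rep C = x \<otimes> m'" by (auto simp: l_coset_def)
    have cA: "coset_rep C \<in> A" using m' xm AM by simp
    have eq: "coset_rep C <# D = (coset_rep C \<otimes> m) <# N"
      using xm cA A M N by (simp add: lcos_m_assoc subgroup.subset subgroup.mem_carrier subset_iff)
    have "F (coset_rep ((coset_rep C \<otimes> m) <# N)) = F (coset_rep C \<otimes> m)"
      using cA A AM xm NM F by (intro right_invariant_coset_rep[OF N]) (auto intro: subsetD)
    with eq F cA xm show ?thesis by simp
  qed
  then have "(\<Sum>D\<in>lcosets_in G A N. F (coset_rep D))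
     = (\<Sum>(C, D)\<in>lcosets_in G A M \<times> lcosets_in G M N. F (coset_rep C))"
    by (subst sum.reindex_bij_betw[OF lcosets_in_refine_bij[OF M N NM A AM], symmetric])
       (auto intro!: sum.cong)
  also have "\<dots> = (\<Sum>C\<in>lcosets_in G A M. \<Sum>D\<in>lcosets_in G M N. F (coset_rep C))"
    by (rule sum.cartesian_product[symmetric])
  finally show ?thesis by (simp add: sum_distrib_left)
qed

text \<open>Left multiplication by \<open>g\<close> carries \<open>N\<close>-cosets bijectively to
  \<open>N\<close>-cosets. With \<open>A\<close> a support this yields left invariance of the Haar
  measure; with \<open>A\<close> a subgroup containing \<open>g\<close> it shows that sums over that
  subgroup are fixed by \<open>g\<close>.\<close>

lemma sum_lcosets_in_left_translate:
  assumes N: "subgroup N G" and g: "g \<in> carrier G" and A: "A \<subseteq> carrier G"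
    and F: "\<And>x n. x \<in> A \<Longrightarrow> n \<in> N \<Longrightarrow> F (g \<otimes> (x \<otimes> n)) = F (g \<otimes> x)"
  shows "(\<Sum>C\<in>lcosets_in G A N. F (g \<otimes> coset_rep C))
       = (\<Sum>C\<in>lcosets_in G ((\<lambda>x. g \<otimes> x) ` A) N. F (coset_rep C))"
proof -
  have NG: "N \<subseteq> carrier G" using N subgroup.subset by blast
  have "bij_betw (\<lambda>C. g <# C) (lcosets_in G A N) (lcosets_in G ((\<lambda>x. g \<otimes> x) ` A) N)"
    unfolding bij_betw_def
  proof
    have "\<And>C. C \<in> lcosets_in G A N \<Longrightarrow> C \<subseteq> carrier G"
      using A NG by (auto simp: lcosets_in_def l_coset_def)
    then have "\<And>C. C \<in> lcosets_in G A N \<Longrightarrow> inv g <# (g <# C) = C"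
      using g by (simp add: lcos_m_assoc lcos_mult_one)
    then show "inj_on (\<lambda>C. g <# C) (lcosets_in G A N)" by (rule inj_on_inverseI)
    show "(\<lambda>C. g <# C) ` lcosets_in G A N = lcosets_in G ((\<lambda>x. g \<otimes> x) ` A) N"
      unfolding lcosets_in_def image_image
      using A g NG by (intro image_cong) (auto simp: lcos_m_assoc)
  qed
  then have "(\<Sum>C\<in>lcosets_in G ((\<lambda>x. g \<otimes> x) ` A) N. F (coset_rep C))
      = (\<Sum>C\<in>lcosets_in G A N. F (coset_rep (g <# C)))"
    by (rule sum.reindex_bij_betw[symmetric])
  also have "\<dots> = (\<Sum>C\<in>lcosets_in G A N. F (g \<otimes> coset_rep C))"
  proof (rule sum.cong)
    fix C assume "C \<in> lcosets_in G A N"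
    then obtain x where x: "x \<in> A" "C = x <# N" by (auto simp: lcosets_in_def)
    have xG: "x \<in> carrier G" using x A by auto
    have "F (coset_rep (g <# C)) = F (coset_rep ((g \<otimes> x) <# N))"
      using xG x g NG by (simp add: lcos_m_assoc)
    also have "\<dots> = F (g \<otimes> x)"
      using F x xG g NG by (intro right_invariant_coset_rep[OF N]) (auto simp: m_assoc subset_iff)
    also have "\<dots> = F (g \<otimes> coset_rep C)"
      using coset_rep_in[OF N xG] F x by (auto simp: l_coset_def)
    finally show "F (coset_rep (g <# C)) = F (g \<otimes> coset_rep C)" .
  qed auto
  finally show ?thesis by simp
qed

text \<open>Inversion sends left cosets to right cosets; it descends to \<open>K / N\<close> because
  \<open>K\<close> normalizes \<open>N\<close>. It is needed because translating a character moves
  the inverse of the representative into the argument.\<close>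

lemma sum_lcosets_in_inverse:
  assumes N: "subgroup N G" and K: "subgroup K G" and NK: "N \<subseteq> K"
    and nrm: "\<And>x n. x \<in> K \<Longrightarrow> n \<in> N \<Longrightarrow> x \<otimes> n \<otimes> inv x \<in> N"
    and F: "\<And>x n. x \<in> K \<Longrightarrow> n \<in> N \<Longrightarrow> F (x \<otimes> n) = F x"
  shows "(\<Sum>C\<in>lcosets_in G K N. F (inv (coset_rep C))) = (\<Sum>C\<in>lcosets_in G K N. F (coset_rep C))"
proof -
  have KG: "K \<subseteq> carrier G" using K subgroup.subset by blast
  have rep: "coset_rep C \<in> K" "coset_rep C <# N = C" if "C \<in> lcosets_in G K N" for C
    using that coset_rep_lcosets_in[OF N K NK] coset_rep_lcoset[OF N] KG
    by (auto simp: lcosets_in_def)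
  have Kinv: "inv x \<in> K" if "x \<in> K" for x using K that by (simp add: subgroup.m_inv_closed)
  have inv_eq: "inv y <# N = inv x <# N" if "x \<in> K" "y \<in> K" "y <# N = x <# N" for x y
  proof -
    have xy: "x \<in> carrier G" "y \<in> carrier G" using that KG by auto
    have "inv y \<otimes> x \<in> N" using that xy N by (simp add: lcoset_eq_iff)
    then have "y \<otimes> (inv y \<otimes> x) \<otimes> inv y \<in> N" using nrm that by blast
    moreover have "y \<otimes> (inv y \<otimes> x) \<otimes> inv y = x \<otimes> inv y" using xy by (simp add: m_assoc[symmetric])
    ultimately have *: "x \<otimes> inv y \<in> N" by simp
    then have "inv (x \<otimes> inv y) \<in> N" using N by (simp add: subgroup.m_inv_closed)
    then show ?thesis using xy N by (simp add: lcoset_eq_iff inv_mult_group)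
  qed
  \<comment> \<open>The involution that inversion induces on the cosets.\<close>
  define h where "h C = inv (coset_rep C) <# N" for C
  have hh: "h (h C) = C" "h C \<in> lcosets_in G K N" if "C \<in> lcosets_in G K N" for C
  proof -
    have c: "coset_rep C \<in> K" using rep that by simp
    show "h C \<in> lcosets_in G K N" using c Kinv by (auto simp: lcosets_in_def h_def)
    then have "inv (coset_rep (h C)) <# N = inv (inv (coset_rep C)) <# N"
      using rep[of "h C"] c Kinv by (intro inv_eq) (auto simp: h_def)
    moreover have "inv (inv (coset_rep C)) = coset_rep C" using c KG by auto
    ultimately show "h (h C) = C" using rep that by (simp add: h_def)
  qed
  have "bij_betw h (lcosets_in G K N) (lcosets_in G K N)"
    by (rule bij_betw_byWitness[where f' = h]) (use hh in auto)
  then have "(\<Sum>C\<in>lcosets_in G K N. F (coset_rep C)) = (\<Sum>C\<in>lcosets_in G K N. F (coset_rep (h C)))"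
    by (rule sum.reindex_bij_betw[symmetric])
  also have "\<dots> = (\<Sum>C\<in>lcosets_in G K N. F (inv (coset_rep C)))"
  proof (rule sum.cong)
    fix C assume "C \<in> lcosets_in G K N"
    then have "inv (coset_rep C) \<in> K" using rep Kinv by simp
    then show "F (coset_rep (h C)) = F (inv (coset_rep C))"
      unfolding h_def using F KG by (intro right_invariant_coset_rep[OF N]) auto
  qed auto
  finally show ?thesis by simp
qed

end

section \<open>Open subgroups\<close>

context topological_group
begin

lemma continuous_left_mult: "g \<in> carrier G \<Longrightarrow> continuous_map T T (\<lambda>x. g \<otimes> x)"
  using continuous_map_compose[of T "prod_topology T T" "\<lambda>x. (g, x)" T "\<lambda>(x, y). x \<otimes> y"]
    continuous_mult by (simp add: o_def continuous_map_pairedI topspace_eq)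

lemma continuous_right_mult: "g \<in> carrier G \<Longrightarrow> continuous_map T T (\<lambda>x. x \<otimes> g)"
  using continuous_map_compose[of T "prod_topology T T" "\<lambda>x. (x, g)" T "\<lambda>(x, y). x \<otimes> y"]
    continuous_mult by (simp add: o_def continuous_map_pairedI topspace_eq)

lemma openin_left_preimage:
  "g \<in> carrier G \<Longrightarrow> openin T W \<Longrightarrow> openin T {x \<in> carrier G. g \<otimes> x \<in> W}"
  using openin_continuous_map_preimage[OF continuous_left_mult] by (simp add: topspace_eq)

lemma openin_conj_preimage:
  assumes "g \<in> carrier G" "openin T W"
  shows "openin T {x \<in> carrier G. g \<otimes> x \<otimes> inv g \<in> W}"
proof -
  have "continuous_map T T ((\<lambda>x. x \<otimes> inv g) \<circ> (\<lambda>x. g \<otimes> x))"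
    using assms by (intro continuous_map_compose[of T T] continuous_left_mult continuous_right_mult) auto
  from openin_continuous_map_preimage[OF this assms(2)] show ?thesis
    by (simp add: topspace_eq o_def)
qed

lemma lcoset_eq_preimage:
  assumes "g \<in> carrier G" "W \<subseteq> carrier G"
  shows "g <# W = {x \<in> carrier G. inv g \<otimes> x \<in> W}"
proof
  show "g <# W \<subseteq> {x \<in> carrier G. inv g \<otimes> x \<in> W}"
    using assms by (auto simp: l_coset_def m_assoc[symmetric] subset_iff)
  show "{x \<in> carrier G. inv g \<otimes> x \<in> W} \<subseteq> g <# W"
  proof
    fix x assume "x \<in> {x \<in> carrier G. inv g \<otimes> x \<in> W}"
    then have "x = g \<otimes> (inv g \<otimes> x)" "inv g \<otimes> x \<in> W"
      using assms by (auto simp: m_assoc[symmetric])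
    then show "x \<in> g <# W" by (auto simp: l_coset_def)
  qed
qed

lemma openin_lcoset: "g \<in> carrier G \<Longrightarrow> openin T W \<Longrightarrow> openin T (g <# W)"
  using openin_subset[of T W] by (simp add: lcoset_eq_preimage openin_left_preimage topspace_eq)

lemma compactin_lcoset: "g \<in> carrier G \<Longrightarrow> compactin T S \<Longrightarrow> compactin T (g <# S)"
  using image_compactin[OF _ continuous_left_mult, of S g] by (simp add: l_coset_def UNION_singleton_eq_range)

lemma subgroup_openI:
  assumes N: "subgroup N G" and W: "openin T W" "\<one> \<in> W" "W \<subseteq> N"
  shows "openin T N"
proof (subst openin_subopen, intro ballI)
  fix n assume "n \<in> N"
  then have n: "n \<in> carrier G" using N by (simp add: subgroup.mem_carrier)
  have "n <# W \<subseteq> N" using W \<open>n \<in> N\<close> N by (auto simp: l_coset_def subgroup.m_closed subset_iff)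
  moreover have "n \<in> n <# W" using W n by (force simp: l_coset_def)
  ultimately show "\<exists>V. openin T V \<and> n \<in> V \<and> V \<subseteq> N" using openin_lcoset[OF n W(1)] by blast
qed

lemma open_subgroup_closed:
  assumes N: "subgroup N G" "openin T N"
  shows "closedin T N"
proof -
  have NG: "N \<subseteq> carrier G" using N subgroup.subset by blast
  have "openin T (carrier G - N)"
  proof (subst openin_subopen, intro ballI)
    fix x assume x: "x \<in> carrier G - N"
    have "x <# N \<subseteq> carrier G - N"
    proof
      fix y assume "y \<in> x <# N"
      then obtain n where n: "n \<in> N" "y = x \<otimes> n" by (auto simp: l_coset_def)
      then have "y \<otimes> inv n = x" using x NG by (auto simp: m_assoc subset_iff)
      moreover have "y \<in> N \<Longrightarrow> y \<otimes> inv n \<in> N"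
        using n N by (simp add: subgroup.m_closed subgroup.m_inv_closed)
      ultimately have "y \<in> N \<Longrightarrow> x \<in> N" by simp
      then show "y \<in> carrier G - N" using n x NG by auto
    qed
    moreover have "x \<in> x <# N" using x N by (simp add: mem_lcoset_iff subgroup.one_closed)
    ultimately show "\<exists>V. openin T V \<and> x \<in> V \<and> V \<subseteq> carrier G - N"
      using openin_lcoset[of x N] x N by blast
  qed
  then show ?thesis using NG by (simp add: closedin_def topspace_eq)
qed

text \<open>Cosets are open and pairwise equal or disjoint, so a finite subfamily covering
  \<open>S\<close> already contains every coset that meets \<open>S\<close>.\<close>

lemma finite_lcosets_compact:
  assumes S: "compactin T S" and N: "subgroup N G" "openin T N"
  shows "finite (lcosets_in G S N)"
proof -
  have SG: "S \<subseteq> carrier G" using S compactin_subset_topspace topspace_eq by blast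
  have mem: "x \<in> x <# N" if "x \<in> S" for x
    using that SG N by (auto simp: mem_lcoset_iff subgroup.one_closed)
  have "openin T (x <# N)" if "x \<in> S" for x
    using that SG by (intro openin_lcoset N) blast
  then have "\<exists>\<D>. finite \<D> \<and> \<D> \<subseteq> lcosets_in G S N \<and> S \<subseteq> \<Union>\<D>"
    using mem by (intro compactinD[OF S]) (auto simp: lcosets_in_def)
  then obtain \<D> where D: "finite \<D>" "\<D> \<subseteq> lcosets_in G S N" "S \<subseteq> \<Union>\<D>" by blast
  have "lcosets_in G S N \<subseteq> \<D>"
  proof
    fix C assume "C \<in> lcosets_in G S N"
    then obtain x where x: "x \<in> S" "C = x <# N" by (auto simp: lcosets_in_def)
    then obtain E where E: "E \<in> \<D>" "x \<in> E" using D by blast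
    then obtain y where y: "y \<in> S" "E = y <# N" using D by (auto simp: lcosets_in_def)
    then have "C = E" using x E SG N l_repr_independence[of x y N] by auto
    then show "C \<in> \<D>" using E by simp
  qed
  then show ?thesis using D finite_subset by blast
qed

text \<open>\<open>M\<close> is the intersection of all conjugates of \<open>N\<close> under
  \<open>K\<close>. A conjugate depends only on the coset of the conjugating element, so finitely
  many suffice and \<open>M\<close> is open.\<close>

lemma open_core:
  assumes K: "subgroup K G" and N: "subgroup N G" "openin T N" and NK: "N \<subseteq> K"
    and fin: "finite (lcosets_in G K N)"
  obtains M where "subgroup M G" "openin T M" "M \<subseteq> N" "\<And>x m. x \<in> K \<Longrightarrow> m \<in> M \<Longrightarrow> x \<otimes> m \<otimes> inv x \<in> M"
proof -
  have KG: "K \<subseteq> carrier G" and oneK: "\<one> \<in> K" using K by (auto dest: subgroup.subset subgroup.one_closed)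
  have NG: "N \<subseteq> carrier G" using N subgroup.subset by blast
  have reps: "coset_rep C \<in> carrier G" if "C \<in> lcosets_in G K N" for C
    using coset_rep_lcosets_in[OF N(1) K NK that] KG by blast
  define M where "M = {m \<in> carrier G. \<forall>x\<in>K. inv x \<otimes> m \<otimes> x \<in> N}"
  have M: "subgroup M G"
  proof (rule subgroupI)
    show "M \<subseteq> carrier G" by (auto simp: M_def)
    show "M \<noteq> {}" using KG N by (auto intro!: exI[of _ \<one>] simp: M_def subset_iff subgroup.one_closed)
  next
    fix a assume a: "a \<in> M"
    have "inv x \<otimes> inv a \<otimes> x = inv (inv x \<otimes> a \<otimes> x)" if "x \<in> K" for x
      using that KG a by (simp add: M_def inv_mult_group m_assoc subset_iff)
    then show "inv a \<in> M" using a N by (simp add: M_def subgroup.m_inv_closed)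
  next
    fix a b assume ab: "a \<in> M" "b \<in> M"
    have "inv x \<otimes> (a \<otimes> b) \<otimes> x = (inv x \<otimes> a \<otimes> x) \<otimes> (inv x \<otimes> b \<otimes> x)" if "x \<in> K" for x
    proof -
      have xab: "x \<in> carrier G" "a \<in> carrier G" "b \<in> carrier G" using that KG ab by (auto simp: M_def)
      then have "x \<otimes> (inv x \<otimes> (b \<otimes> x)) = b \<otimes> x" by (simp add: m_assoc[symmetric])
      with xab show ?thesis by (simp add: m_assoc)
    qed
    then show "a \<otimes> b \<in> M" using ab N by (simp add: M_def subgroup.m_closed)
  qed
  \<comment> \<open>The intersection over representatives only. The double inverse matches the form
    \<open>g \<otimes> x \<otimes> inv g\<close> of \<open>openin_conj_preimage\<close>.\<close>
  define W where "W = (\<Inter>C\<in>lcosets_in G K N. {m \<in> carrier G. inv (coset_rep C) \<otimes> m \<otimes> inv (inv (coset_rep C)) \<in> N}) \<inter> topspace T"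
  have "openin T W"
    unfolding W_def using reps N(2) by (intro openin_INT fin openin_conj_preimage) auto
  moreover have "\<one> \<in> W" using reps N by (auto simp: W_def topspace_eq subgroup.one_closed)
  moreover have "W \<subseteq> M"
  proof
    fix m assume m: "m \<in> W"
    then have mG: "m \<in> carrier G" by (simp add: W_def topspace_eq)
    have "inv x \<otimes> m \<otimes> x \<in> N" if "x \<in> K" for x
    proof -
      define r where "r = coset_rep (x <# N)"
      have x: "x \<in> carrier G" using that KG by auto
      have C: "x <# N \<in> lcosets_in G K N" using that by (simp add: lcosets_in_def)
      have "r \<in> x <# N" using coset_rep_in N x by (simp add: r_def)
      then obtain n where n: "n \<in> N" "r = x \<otimes> n" by (auto simp: l_coset_def)
      then have r: "r \<in> carrier G" "n \<in> carrier G" using x NG by auto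
      have rm: "inv r \<otimes> m \<otimes> r \<in> N" using m C r by (auto simp: W_def r_def)
      have xr: "x = r \<otimes> inv n" using n x NG by (auto simp: m_assoc subset_iff)
      have "inv x \<otimes> m \<otimes> x = n \<otimes> (inv r \<otimes> m \<otimes> r) \<otimes> inv n"
        using r x mG by (simp add: xr inv_mult_group m_assoc)
      then show ?thesis using rm n N by (simp add: subgroup.m_closed subgroup.m_inv_closed)
    qed
    then show "m \<in> M" using mG by (auto simp: M_def)
  qed
  ultimately have "openin T M" using subgroup_openI[OF M] by blast
  moreover have "M \<subseteq> N"
  proof
    fix m assume "m \<in> M"
    then have "m \<in> carrier G" "inv \<one> \<otimes> m \<otimes> \<one> \<in> N" using oneK by (auto simp: M_def)
    then show "m \<in> N" by simp
  qed
  moreover have "x \<otimes> m \<otimes> inv x \<in> M" if "x \<in> K" "m \<in> M" for x m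
  proof -
    have xm: "x \<in> carrier G" "m \<in> carrier G" using that KG by (auto simp: M_def)
    have "inv y \<otimes> (x \<otimes> m \<otimes> inv x) \<otimes> y \<in> N" if y: "y \<in> K" for y
    proof -
      have "y \<in> carrier G" using y KG by blast
      then have "inv y \<otimes> (x \<otimes> m \<otimes> inv x) \<otimes> y = inv (inv x \<otimes> y) \<otimes> m \<otimes> (inv x \<otimes> y)"
        using xm by (simp add: inv_mult_group m_assoc)
      moreover have "inv x \<otimes> y \<in> K"
        using y \<open>x \<in> K\<close> K by (simp add: subgroup.m_closed subgroup.m_inv_closed)
      ultimately show ?thesis using \<open>m \<in> M\<close> by (simp add: M_def)
    qed
    then show ?thesis using xm by (simp add: M_def)
  qed
  ultimately show ?thesis using M that by blast
qed

text \<open>Van Dantzig's theorem. A compact open neighbourhood \<open>B\<close> of the identity inside \<open>W\<close> comes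
  from the fact that components and quasi-components agree in compact Hausdorff spaces; the
  right stabilizer of \<open>B\<close> is then an open subgroup contained in \<open>B\<close>.\<close>

lemma van_dantzig:
  assumes haus: "Hausdorff_space T" and td: "totally_disconnected_top T"
    and U: "subgroup U G" "compactin T U" "openin T U"
    and W: "openin T W" "\<one> \<in> W"
  obtains N where "subgroup N G" "openin T N" "N \<subseteq> W"
proof -
  define X where "X = subtopology T U"
  have UG: "U \<subseteq> carrier G" and oneU: "\<one> \<in> U" using U by (auto dest: subgroup.subset subgroup.one_closed)
  have topX: "topspace X = U" using UG by (auto simp: X_def topspace_eq)
  have compX: "compact_space X" using U by (simp add: X_def compact_space_subtopology)
  have hX: "Hausdorff_space X" using haus by (simp add: X_def Hausdorff_space_subtopology)
  have "connected_component_of_set X \<one> = {\<one>}"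
  proof -
    have "connectedin T (connected_component_of_set X \<one>)"
      using connectedin_connected_component_of[of X \<one>] by (simp add: X_def connectedin_subtopology)
    moreover have "\<one> \<in> connected_component_of_set X \<one>"
      using oneU topX by (simp add: connected_component_of_refl)
    ultimately show ?thesis using td unfolding totally_disconnected_top_def by blast
  qed
  then have "{\<one>} \<in> connected_components_of X"
    using oneU topX by (auto simp: connected_components_of_def)
  then have "{\<one>} \<in> quasi_components_of X"
    using compact_quasi_eq_connected_components_of[OF compact_imp_locally_compact_space[OF compX] hX, of "{\<one>}"]
      oneU topX by simp
  moreover have "compactin X (U - W)"
  proof -
    have "openin X (U \<inter> W)" using W by (auto simp: X_def openin_subtopology)
    then have "closedin X (topspace X - (U \<inter> W))" by (intro closedin_diff closedin_topspace)
    moreover have "topspace X - (U \<inter> W) = U - W" using topX by blast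
    ultimately show ?thesis using closedin_compact_space[OF compX] by simp
  qed
  ultimately have "separated_between X (U - W) {\<one>}"
    using W by (simp add: separated_between_compact_quasi_component)
  then obtain A B where AB: "openin X A" "openin X B" "A \<union> B = U" "disjnt A B" "U - W \<subseteq> A" "\<one> \<in> B"
    by (auto simp: separated_between_def topX)
  have BW: "B \<subseteq> W" "B \<subseteq> U" using AB by (auto simp: disjnt_iff)
  have "openin T B" using AB U by (simp add: X_def openin_open_subtopology)
  have "closedin X B"
  proof -
    have "B = topspace X - A" using AB by (auto simp: topX disjnt_iff)
    then show ?thesis using AB by blast
  qed
  then have "compactin X B" using compX closedin_compact_space by blast
  then have compB: "compactin T B" by (simp add: X_def compactin_subtopology)
  have BG: "B \<subseteq> carrier G" using BW UG by blast
  \<comment> \<open>The tube lemma: multiplication maps \<open>B \<times> {\<one>}\<close> into the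
    open set \<open>B\<close>, and compactness of \<open>B\<close> provides one neighbourhood
    \<open>Q\<close> of \<open>\<one>\<close> that works for all of \<open>B\<close>.\<close>
  have "openin (prod_topology T T) {z \<in> topspace (prod_topology T T). (case z of (x, y) \<Rightarrow> x \<otimes> y) \<in> B}"
    by (rule openin_continuous_map_preimage[OF continuous_mult \<open>openin T B\<close>])
  moreover have "B \<times> {\<one>} \<subseteq> {z \<in> topspace (prod_topology T T). (case z of (x, y) \<Rightarrow> x \<otimes> y) \<in> B}"
    using BG by (auto simp: topspace_eq subset_iff)
  ultimately have "\<exists>P Q. openin T P \<and> openin T Q \<and> B \<subseteq> P \<and> \<one> \<in> Q \<and>
      P \<times> Q \<subseteq> {z \<in> topspace (prod_topology T T). (case z of (x, y) \<Rightarrow> x \<otimes> y) \<in> B}"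
    by (intro tube_lemma_left compB) (auto simp: topspace_eq)
  then obtain P Q where PQ: "openin T P" "openin T Q" "B \<subseteq> P" "\<one> \<in> Q"
    "P \<times> Q \<subseteq> {z \<in> topspace (prod_topology T T). (case z of (x, y) \<Rightarrow> x \<otimes> y) \<in> B}"
    by blast
  \<comment> \<open>Asking for \<open>inv g\<close> as well makes \<open>N\<close> closed under
    inverses by definition; \<open>\<one> \<in> B\<close> forces
    \<open>N \<subseteq> B\<close>.\<close>
  define N where "N = {g \<in> carrier G. \<forall>b\<in>B. b \<otimes> g \<in> B \<and> b \<otimes> inv g \<in> B}"
  have N: "subgroup N G"
  proof (rule subgroupI)
    show "N \<subseteq> carrier G" by (auto simp: N_def)
    show "N \<noteq> {}" using BG by (auto simp: N_def intro!: exI[of _ \<one>])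
    show "inv a \<in> N" if "a \<in> N" for a using that by (auto simp: N_def)
    show "a \<otimes> b \<in> N" if ab: "a \<in> N" "b \<in> N" for a b
    proof -
      have "x \<otimes> (a \<otimes> b) \<in> B \<and> x \<otimes> inv (a \<otimes> b) \<in> B" if "x \<in> B" for x
      proof -
        have "x \<otimes> (a \<otimes> b) = (x \<otimes> a) \<otimes> b" "x \<otimes> inv (a \<otimes> b) = (x \<otimes> inv b) \<otimes> inv a"
          using that ab BG by (auto simp: N_def inv_mult_group m_assoc subset_iff)
        then show ?thesis using that ab by (simp add: N_def)
      qed
      then show ?thesis using ab by (simp add: N_def)
    qed
  qed
  moreover have "openin T N"
  proof (rule subgroup_openI[OF N])
    show "openin T (Q \<inter> {x \<in> topspace T. inv x \<in> Q})"
      using PQ openin_continuous_map_preimage[OF continuous_inv] by blast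
    show "\<one> \<in> Q \<inter> {x \<in> topspace T. inv x \<in> Q}" using PQ by (simp add: topspace_eq)
    have "b \<otimes> x \<in> B" if "b \<in> B" "x \<in> Q" for b x
    proof -
      have "(b, x) \<in> P \<times> Q" using PQ(3) that by blast
      then have "(b, x) \<in> {z \<in> topspace (prod_topology T T). (case z of (x, y) \<Rightarrow> x \<otimes> y) \<in> B}"
        using PQ(5) by (rule rev_subsetD)
      then show ?thesis by simp
    qed
    then show "Q \<inter> {x \<in> topspace T. inv x \<in> Q} \<subseteq> N" by (auto simp: N_def topspace_eq)
  qed
  moreover have "N \<subseteq> W"
  proof
    fix n assume "n \<in> N"
    then have "\<one> \<otimes> n \<in> B" "n \<in> carrier G" using AB(6) unfolding N_def by blast+
    then show "n \<in> W" using BW by auto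
  qed
  ultimately show ?thesis using that by blast
qed

end

text \<open>The type \<open>'k\<close> of coefficients enters through the condition that the indices of the open
  subgroups of \<open>U\<close> are invertible in it; this makes all Haar measures below available.\<close>

locale hecke_setup = topological_group G T
  for G :: "('g, 'm) monoid_scheme" (structure) and T :: "'g topology" +
  fixes U :: "'g set" and coeff :: "'k::field itself"
  assumes hausdorff: "Hausdorff_space T"
    and subgroup_U: "subgroup U G" and compact_U: "compactin T U" and open_U: "openin T U"
    and small_subgroups: "\<And>W. openin T W \<Longrightarrow> \<one> \<in> W \<Longrightarrow> \<exists>N. subgroup N G \<and> openin T N \<and> N \<subseteq> W"
    and index_invertible: "\<And>N. subgroup N G \<Longrightarrow> openin T N \<Longrightarrow> N \<subseteq> U \<Longrightarrow>
        of_nat (card (lcosets_in G U N)) \<noteq> (0::'k)"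
begin

text \<open>Staying inside \<open>U\<close> makes these subgroups compact, and their indices in one
  another divide indices in \<open>U\<close>, hence are invertible in \<open>'k\<close>.\<close>

definition small :: "'g set \<Rightarrow> bool" where
  "small N \<longleftrightarrow> subgroup N G \<and> openin T N \<and> N \<subseteq> U"

lemma small_U: "small U"
  using subgroup_U open_U by (simp add: small_def)

lemma smallD: "small N \<Longrightarrow> subgroup N G" "small N \<Longrightarrow> openin T N" "small N \<Longrightarrow> N \<subseteq> U"
  "small N \<Longrightarrow> N \<subseteq> carrier G" "small N \<Longrightarrow> \<one> \<in> N"
  by (auto simp: small_def subgroup.one_closed dest: subgroup.subset)

lemma small_mem_carrier: "small N \<Longrightarrow> n \<in> N \<Longrightarrow> n \<in> carrier G"
  using smallD by blast

lemma small_compact: "small N \<Longrightarrow> compactin T N"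
  by (rule closed_compactin[OF compact_U smallD(3) open_subgroup_closed]) (auto simp: smallD)

lemma small_Int: "small N \<Longrightarrow> small M \<Longrightarrow> small (N \<inter> M)"
  by (auto simp: small_def subgroups_Inter_pair)

lemma small_exists:
  assumes "openin T W" "\<one> \<in> W"
  obtains N where "small N" "N \<subseteq> W"
proof -
  obtain N where N: "subgroup N G" "openin T N" "N \<subseteq> W" using small_subgroups assms by blast
  have "small (N \<inter> U)" using N subgroup_U open_U by (auto simp: small_def subgroups_Inter_pair)
  then show ?thesis using that N by blast
qed

lemma small_coset_rep:
  "small K \<Longrightarrow> small N \<Longrightarrow> N \<subseteq> K \<Longrightarrow> C \<in> lcosets_in G K N \<Longrightarrow> coset_rep C \<in> K"
  using coset_rep_lcosets_in smallD(1) by blast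

lemma small_Inter:
  assumes "finite I" "\<And>i. i \<in> I \<Longrightarrow> small (N i)"
  obtains M where "small M" "\<And>i. i \<in> I \<Longrightarrow> M \<subseteq> N i"
  using assms
proof (induction I arbitrary: thesis)
  case empty
  then show ?case using small_U by blast
next
  case (insert i I)
  then obtain M where "small M" "\<And>i. i \<in> I \<Longrightarrow> M \<subseteq> N i" by blast
  with insert.prems show ?case using small_Int[of M "N i"] by (metis Int_lower1 Int_lower2 insertE insertI1 subset_trans)
qed

text \<open>A conjugate of a small subgroup may leave \<open>U\<close>, so only its part inside
  \<open>U\<close> is taken.\<close>

lemma small_conj:
  assumes g: "g \<in> carrier G" and N: "small N"
  shows "small {x \<in> U. g \<otimes> x \<otimes> inv g \<in> N}"
  unfolding small_def
proof (intro conjI)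
  have UG: "U \<subseteq> carrier G" using subgroup_U subgroup.subset by blast
  show "subgroup {x \<in> U. g \<otimes> x \<otimes> inv g \<in> N} G"
  proof (rule subgroupI)
    show "{x \<in> U. g \<otimes> x \<otimes> inv g \<in> N} \<subseteq> carrier G" using UG by blast
    show "{x \<in> U. g \<otimes> x \<otimes> inv g \<in> N} \<noteq> {}"
      using g N subgroup.one_closed[OF subgroup_U] by (auto intro!: exI[of _ \<one>] simp: smallD)
  next
    fix a assume a: "a \<in> {x \<in> U. g \<otimes> x \<otimes> inv g \<in> N}"
    then have aG: "a \<in> carrier G" using UG by blast
    have "g \<otimes> inv a \<otimes> inv g = inv (g \<otimes> a \<otimes> inv g)"
      using aG g by (simp add: inv_mult_group m_assoc)
    then show "inv a \<in> {x \<in> U. g \<otimes> x \<otimes> inv g \<in> N}"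
      using a N subgroup_U by (auto simp: subgroup.m_inv_closed smallD)
  next
    fix a b assume ab: "a \<in> {x \<in> U. g \<otimes> x \<otimes> inv g \<in> N}" "b \<in> {x \<in> U. g \<otimes> x \<otimes> inv g \<in> N}"
    then have abG: "a \<in> carrier G" "b \<in> carrier G" using UG by auto
    have "inv g \<otimes> (g \<otimes> (b \<otimes> inv g)) = b \<otimes> inv g"
      using abG g by (simp add: m_assoc[symmetric])
    then have "g \<otimes> (a \<otimes> b) \<otimes> inv g = (g \<otimes> a \<otimes> inv g) \<otimes> (g \<otimes> b \<otimes> inv g)"
      using abG g by (simp add: m_assoc)
    then show "a \<otimes> b \<in> {x \<in> U. g \<otimes> x \<otimes> inv g \<in> N}"
      using ab N subgroup_U by (auto simp: subgroup.m_closed smallD)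
  qed
  have "{x \<in> U. g \<otimes> x \<otimes> inv g \<in> N} = U \<inter> {x \<in> carrier G. g \<otimes> x \<otimes> inv g \<in> N}"
    using UG by blast
  then show "openin T {x \<in> U. g \<otimes> x \<otimes> inv g \<in> N}"
    using openin_conj_preimage[OF g] N open_U by (auto simp: smallD)
qed auto

lemma index_nonzero:
  assumes "small K" "small N" "N \<subseteq> K"
  shows "of_nat (card (lcosets_in G K N)) \<noteq> (0::'k)"
proof -
  have "card (lcosets_in G U N) = card (lcosets_in G U K) * card (lcosets_in G K N)"
    using assms subgroup_U smallD
    by (intro card_lcosets_in_refine) (auto simp: subset_iff subgroup.m_closed subgroup.mem_carrier)
  moreover have "of_nat (card (lcosets_in G U N)) \<noteq> (0::'k)" using assms index_invertible by (simp add: smallD)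
  ultimately show ?thesis by (metis mult_zero_right of_nat_mult)
qed

text \<open>\<open>card\<close> of an infinite set is 0, so a nonzero index already rules out
  infinitely many cosets.\<close>

lemma finite_lcosets:
  assumes "small K" "small N" "N \<subseteq> K"
  shows "finite (lcosets_in G K N)"
  using index_nonzero[OF assms] by (metis card.infinite of_nat_0)

lemma small_core:
  assumes K: "small K" and N: "small N" and NK: "N \<subseteq> K"
  obtains M where "small M" "M \<subseteq> N" "\<And>x m. x \<in> K \<Longrightarrow> m \<in> M \<Longrightarrow> x \<otimes> m \<otimes> inv x \<in> M"
proof -
  obtain M where M: "subgroup M G" "openin T M" "M \<subseteq> N" "\<And>x m. x \<in> K \<Longrightarrow> m \<in> M \<Longrightarrow> x \<otimes> m \<otimes> inv x \<in> M"
    using open_core[OF smallD(1)[OF K] smallD(1)[OF N] smallD(2)[OF N] NK finite_lcosets[OF K N NK]]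
    by blast
  then have "small M" using smallD(3)[OF N] by (auto simp: small_def)
  then show ?thesis using M that by blast
qed

end

section \<open>Test functions\<close>

definition const_on :: "'g set \<Rightarrow> 'k::zero \<Rightarrow> 'g \<Rightarrow> 'k" where
  "const_on A c = (\<lambda>x. if x \<in> A then c else 0)"

definition left_shift :: "('g, 'm) monoid_scheme \<Rightarrow> 'g \<Rightarrow> ('g \<Rightarrow> 'k::zero) \<Rightarrow> 'g \<Rightarrow> 'k" where
  "left_shift G g \<phi> = extend0 (carrier G) (\<lambda>x. \<phi> (g \<otimes>\<^bsub>G\<^esub> x))"

definition right_shift :: "('g, 'm) monoid_scheme \<Rightarrow> 'g \<Rightarrow> ('g \<Rightarrow> 'k::zero) \<Rightarrow> 'g \<Rightarrow> 'k" where
  "right_shift G g \<phi> = extend0 (carrier G) (\<lambda>x. \<phi> (x \<otimes>\<^bsub>G\<^esub> g))"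

definition right_invariant :: "('g, 'm) monoid_scheme \<Rightarrow> 'g set \<Rightarrow> ('g \<Rightarrow> 'k) \<Rightarrow> bool" where
  "right_invariant G N \<phi> \<longleftrightarrow> (\<forall>x\<in>carrier G. \<forall>n\<in>N. \<phi> (x \<otimes>\<^bsub>G\<^esub> n) = \<phi> x)"

definition supp_on :: "'g set \<Rightarrow> ('g \<Rightarrow> 'k::zero) \<Rightarrow> 'g set" where
  "supp_on A \<phi> = {x \<in> A. \<phi> x \<noteq> 0}"

lemma distributionsD:
  assumes "f \<in> distributions T"
  shows "\<phi> \<in> test_functions T \<Longrightarrow> \<psi> \<in> test_functions T \<Longrightarrow> f (\<lambda>x. \<phi> x + \<psi> x) = f \<phi> + f \<psi>"
    and "\<phi> \<in> test_functions T \<Longrightarrow> f (\<lambda>x. c * \<phi> x) = c * f \<phi>"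
    and "\<phi> \<notin> test_functions T \<Longrightarrow> f \<phi> = 0"
  using assms by (auto simp: distributions_def)

context hecke_setup
begin

abbreviation tests :: "('g \<Rightarrow> 'k) set" where "tests \<equiv> test_functions T"

lemma supp_subset_carrier: "supp_on (carrier G) \<phi> \<subseteq> carrier G"
  by (auto simp: supp_on_def)

text \<open>A working criterion: uniform right invariance replaces local constancy, and any compact
  set containing the nonzero locus replaces the closure, since compact sets are closed in a
  Hausdorff space.\<close>

lemma testI:
  assumes out: "\<And>x. x \<notin> carrier G \<Longrightarrow> \<phi> x = 0" and N: "small N" and inv: "right_invariant G N \<phi>"
    and S: "compactin T S" "supp_on (carrier G) \<phi> \<subseteq> S"
  shows "\<phi> \<in> tests"
proof -
  have "\<exists>W. openin T W \<and> x \<in> W \<and> (\<forall>y\<in>W. \<phi> y = \<phi> x)" if "x \<in> carrier G" for x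
    using openin_lcoset[OF that smallD(2)[OF N]] that N inv
    by (intro exI[of _ "x <# N"]) (auto simp: mem_lcoset_iff smallD, auto simp: l_coset_def right_invariant_def)
  moreover have "compactin T (T closure_of {x \<in> topspace T. \<phi> x \<noteq> 0})"
  proof (rule closed_compactin[OF S(1)])
    show "T closure_of {x \<in> topspace T. \<phi> x \<noteq> 0} \<subseteq> S"
      using S compactin_imp_closedin[OF hausdorff S(1)]
      by (intro closure_of_minimal) (auto simp: supp_on_def topspace_eq)
  qed auto
  ultimately show ?thesis using out by (simp add: test_functions_def topspace_eq)
qed

lemma test_zero_outside: "\<phi> \<in> tests \<Longrightarrow> x \<notin> carrier G \<Longrightarrow> \<phi> x = 0"
  by (simp add: test_functions_def topspace_eq)

lemma test_compact_support:
  assumes "\<phi> \<in> tests"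
  obtains S where "compactin T S" "supp_on (carrier G) \<phi> \<subseteq> S"
proof
  show "compactin T (T closure_of {x \<in> topspace T. \<phi> x \<noteq> 0})"
    using assms by (simp add: test_functions_def)
  show "supp_on (carrier G) \<phi> \<subseteq> T closure_of {x \<in> topspace T. \<phi> x \<noteq> 0}"
    unfolding supp_on_def topspace_eq[symmetric] by (rule closure_of_subset) auto
qed

lemma small_coset_subset:
  assumes "x \<in> carrier G" "openin T W" "x \<in> W"
  obtains N where "small N" "x <# N \<subseteq> W"
proof -
  obtain N where "small N" "N \<subseteq> {y \<in> carrier G. x \<otimes> y \<in> W}"
    using small_exists[OF openin_left_preimage[OF assms(1,2)]] assms by auto
  then show ?thesis using that by (auto simp: l_coset_def)
qed

text \<open>Uniformity comes from compactness of the support \<open>S\<close>: finitely many cosets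
  \<open>x <# N x\<close> on which \<open>\<phi>\<close> is constant cover \<open>S\<close>, and the
  intersection of the corresponding \<open>N x\<close> preserves each of them.\<close>

lemma test_right_invariant:
  assumes "\<phi> \<in> tests"
  obtains N where "small N" "right_invariant G N \<phi>"
proof -
  define S where "S = T closure_of {x \<in> topspace T. \<phi> x \<noteq> 0}"
  have S: "compactin T S" "supp_on (carrier G) \<phi> \<subseteq> S"
    using assms closure_of_subset[of "{x \<in> topspace T. \<phi> x \<noteq> 0}" T]
    by (auto simp: test_functions_def S_def supp_on_def topspace_eq)
  have SG: "S \<subseteq> carrier G" using S compactin_subset_topspace topspace_eq by blast
  have "\<exists>N. small N \<and> (\<forall>y\<in>x <# N. \<phi> y = \<phi> x)" if "x \<in> carrier G" for x
  proof -
    have "\<forall>x\<in>carrier G. \<exists>W. openin T W \<and> x \<in> W \<and> (\<forall>y\<in>W. \<phi> y = \<phi> x)"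
      using assms by (simp add: test_functions_def topspace_eq)
    then obtain W where W: "openin T W" "x \<in> W" "\<forall>y\<in>W. \<phi> y = \<phi> x"
      using \<open>x \<in> carrier G\<close> by blast
    obtain N where "small N" "x <# N \<subseteq> W" by (rule small_coset_subset[OF \<open>x \<in> carrier G\<close> W(1,2)])
    with W show ?thesis by blast
  qed
  then have "\<exists>N. \<forall>x\<in>carrier G. small (N x) \<and> (\<forall>y\<in>x <# N x. \<phi> y = \<phi> x)"
    by (intro bchoice) blast
  then obtain N where N: "\<And>x. x \<in> carrier G \<Longrightarrow> small (N x)" "\<And>x y. x \<in> carrier G \<Longrightarrow> y \<in> x <# N x \<Longrightarrow> \<phi> y = \<phi> x"
    by blast
  have mem: "x \<in> x <# N x" if "x \<in> S" for x
    using that SG N by (auto simp: mem_lcoset_iff smallD)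
  have op: "openin T (x <# N x)" if "x \<in> S" for x
    using that SG by (intro openin_lcoset smallD(2) N(1)) blast+
  have "\<exists>\<D>. finite \<D> \<and> \<D> \<subseteq> (\<lambda>x. x <# N x) ` S \<and> S \<subseteq> \<Union>\<D>"
  proof (rule compactinD[OF S(1)])
    show "S \<subseteq> \<Union> ((\<lambda>x. x <# N x) ` S)" using mem by blast
  qed (use op in \<open>elim imageE, simp\<close>)
  then obtain \<D> where D: "finite \<D>" "\<D> \<subseteq> (\<lambda>x. x <# N x) ` S" "S \<subseteq> \<Union>\<D>" by blast
  obtain I where I: "I \<subseteq> S" "finite I" "\<D> = (\<lambda>x. x <# N x) ` I"
    using finite_subset_image[OF D(1,2)] by blast
  obtain M where M: "small M" "\<And>x. x \<in> I \<Longrightarrow> M \<subseteq> N x"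
  proof (rule small_Inter[OF I(2), of N])
    show "\<And>i. i \<in> I \<Longrightarrow> small (N i)" using N(1) I(1) SG by blast
  qed (rule that)
  have onS: "\<phi> (y \<otimes> n) = \<phi> y" if y: "y \<in> S" "n \<in> M" for y n
  proof -
    obtain x where x: "x \<in> I" "y \<in> x <# N x" using I D y by blast
    then obtain m where m: "m \<in> N x" "y = x \<otimes> m" by (auto simp: l_coset_def)
    have xG: "x \<in> carrier G" using x I SG by blast
    then have sm: "small (N x)" by (rule N(1))
    have "n \<in> N x" using M(2) x y by blast
    then have "m \<otimes> n \<in> N x" using m sm by (simp add: smallD subgroup.m_closed)
    moreover have "y \<otimes> n = x \<otimes> (m \<otimes> n)"
      using m xG y small_mem_carrier[OF sm] small_mem_carrier[OF M(1)] by (simp add: m_assoc)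
    ultimately have "y \<otimes> n \<in> x <# N x" by (auto simp: l_coset_def)
    then show ?thesis using N(2)[OF xG] x by simp
  qed
  have "\<phi> (y \<otimes> n) = \<phi> y" if y: "y \<in> carrier G" "n \<in> M" for y n
  \<comment> \<open>Invariance is known at points of \<open>S\<close>. If only
    \<open>y \<otimes> n\<close> lies in \<open>S\<close>, it is applied there with
    \<open>inv n\<close>; if neither point does, both values are 0.\<close>
  proof (cases "y \<in> S \<or> y \<otimes> n \<in> S")
    case True
    have n: "n \<in> carrier G" "inv n \<in> M" using y M by (auto simp: smallD subgroup.m_inv_closed small_mem_carrier)
    show ?thesis
      using True onS[of y n] onS[of "y \<otimes> n" "inv n"] y n by (auto simp: m_assoc)
  next
    case False
    have "y \<otimes> n \<in> carrier G" using y M small_mem_carrier by simp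
    have "z \<in> carrier G \<Longrightarrow> z \<notin> S \<Longrightarrow> \<phi> z = 0" for z using S(2) by (auto simp: supp_on_def)
    then show ?thesis using False \<open>y \<otimes> n \<in> carrier G\<close> y by simp
  qed
  then show ?thesis using that M by (auto simp: right_invariant_def)
qed

lemma right_invariant_mono: "right_invariant G N \<phi> \<Longrightarrow> M \<subseteq> N \<Longrightarrow> right_invariant G M \<phi>"
  by (auto simp: right_invariant_def)

lemma test_finite_cosets:
  assumes "\<phi> \<in> tests" "small N"
  shows "finite (lcosets_in G (supp_on (carrier G) \<phi>) N)"
proof -
  obtain S where "compactin T S" "supp_on (carrier G) \<phi> \<subseteq> S" using test_compact_support assms by blast
  then show ?thesis
    using finite_lcosets_compact[of S N] smallD(1,2)[OF assms(2)] unfolding lcosets_in_def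
    by (meson finite_subset image_mono)
qed

lemma test_add:
  assumes "\<phi> \<in> tests" "\<psi> \<in> tests"
  shows "(\<lambda>x. \<phi> x + \<psi> x) \<in> tests"
proof -
  obtain N where N: "small N" "right_invariant G N \<phi>" using test_right_invariant assms by blast
  obtain M where M: "small M" "right_invariant G M \<psi>" using test_right_invariant assms by blast
  obtain S where S: "compactin T S" "supp_on (carrier G) \<phi> \<subseteq> S" using test_compact_support assms by blast
  obtain R where R: "compactin T R" "supp_on (carrier G) \<psi> \<subseteq> R" using test_compact_support assms by blast
  show ?thesis
  proof (rule testI)
    show "small (N \<inter> M)" using N M small_Int by blast
    show "compactin T (S \<union> R)" using S R by (simp add: compactin_Un)
    show "supp_on (carrier G) (\<lambda>x. \<phi> x + \<psi> x) \<subseteq> S \<union> R"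
    proof
      fix x assume "x \<in> supp_on (carrier G) (\<lambda>x. \<phi> x + \<psi> x)"
      then have "x \<in> supp_on (carrier G) \<phi> \<or> x \<in> supp_on (carrier G) \<psi>"
        by (auto simp: supp_on_def)
      then show "x \<in> S \<union> R" using S R by blast
    qed
  qed (use assms N M in \<open>auto simp: test_zero_outside right_invariant_def\<close>)
qed

lemma test_restrict_support:
  assumes "\<phi> \<in> tests" "small N" "right_invariant G N \<psi>" "\<And>x. \<phi> x = 0 \<Longrightarrow> \<psi> x = 0"
  shows "\<psi> \<in> tests"
proof -
  obtain S where "compactin T S" "supp_on (carrier G) \<phi> \<subseteq> S" using test_compact_support assms by blast
  then show ?thesis using assms
    by (intro testI[of \<psi> N S]) (auto simp: supp_on_def test_zero_outside)
qed

lemma test_scale: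
  assumes "\<phi> \<in> tests"
  shows "(\<lambda>x. c * \<phi> x) \<in> tests"
proof -
  obtain N where "small N" "right_invariant G N \<phi>" using test_right_invariant assms by blast
  then show ?thesis using assms by - (rule test_restrict_support[of \<phi> N], auto simp: right_invariant_def)
qed

lemma test_mult:
  assumes "\<phi> \<in> tests" "\<psi> \<in> tests"
  shows "(\<lambda>x. \<phi> x * \<psi> x) \<in> tests"
proof -
  obtain N where "small N" "right_invariant G N \<phi>" using test_right_invariant assms by blast
  moreover obtain M where "small M" "right_invariant G M \<psi>" using test_right_invariant assms by blast
  ultimately show ?thesis using assms
    by - (rule test_restrict_support[of \<phi> "N \<inter> M"], auto simp: right_invariant_def small_Int)
qed

lemma test_zero: "(\<lambda>x. 0) \<in> tests"
  using small_U by (intro testI[of _ U "{}"]) (auto simp: right_invariant_def supp_on_def)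

lemma test_sum:
  assumes "finite I" "\<And>i. i \<in> I \<Longrightarrow> \<phi> i \<in> tests"
  shows "(\<lambda>x. \<Sum>i\<in>I. \<phi> i x) \<in> tests"
  using assms by (induction I) (auto simp: test_zero test_add)

lemma right_invariant_const_on_coset:
  assumes x: "x \<in> carrier G" and N: "small N"
  shows "right_invariant G N (const_on (x <# N) c)"
proof -
  have "y \<otimes> n \<in> x <# N \<longleftrightarrow> y \<in> x <# N" if "y \<in> carrier G" "n \<in> N" for y n
  proof -
    have n: "n \<in> carrier G" using that N small_mem_carrier by blast
    have "(y \<otimes> n) <# N = y <# N"
      using that n x N by (simp add: lcoset_eq_iff smallD inv_mult_group m_assoc subgroup.m_inv_closed)
    moreover have "z \<in> x <# N \<longleftrightarrow> x <# N = z <# N" if "z \<in> carrier G" for z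
      using that x smallD(1)[OF N] by (simp add: mem_lcoset_iff lcoset_eq_iff)
    ultimately show ?thesis using that n by simp
  qed
  then show ?thesis by (auto simp: right_invariant_def const_on_def)
qed

lemma test_const_on_coset:
  assumes x: "x \<in> carrier G" and N: "small N"
  shows "const_on (x <# N) c \<in> tests"
proof (rule testI[OF _ N right_invariant_const_on_coset[OF x N]])
  show "compactin T (x <# N)" using x N compactin_lcoset small_compact by blast
  show "supp_on (carrier G) (const_on (x <# N) c) \<subseteq> x <# N" by (auto simp: supp_on_def const_on_def)
  show "const_on (x <# N) c y = 0" if "y \<notin> carrier G" for y
    using that x N small_mem_carrier by (auto simp: const_on_def l_coset_def)
qed

lemma small_one_lcoset: "small N \<Longrightarrow> \<one> <# N = N"
  using smallD(4) lcos_mult_one by blast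

lemma test_const_on: "small N \<Longrightarrow> const_on N c \<in> tests"
  using test_const_on_coset[of \<one> N c] small_one_lcoset by simp

lemma test_left_shift:
  assumes g: "g \<in> carrier G" and phi: "\<phi> \<in> tests"
  shows "left_shift G g \<phi> \<in> tests"
proof -
  obtain N where N: "small N" "right_invariant G N \<phi>" using test_right_invariant phi by blast
  obtain S where S: "compactin T S" "supp_on (carrier G) \<phi> \<subseteq> S" using test_compact_support phi by blast
  show ?thesis
  proof (rule testI[OF _ N(1)])
    show "compactin T (inv g <# S)" using g S compactin_lcoset by simp
    have "x \<in> inv g <# S" if "x \<in> carrier G" "g \<otimes> x \<in> S" for x
      using that g lcoset_eq_preimage[of "inv g" S] compactin_subset_topspace[OF S(1)]
      by (auto simp: topspace_eq)
    then show "supp_on (carrier G) (left_shift G g \<phi>) \<subseteq> inv g <# S"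
      using S g by (auto simp: supp_on_def left_shift_def extend0_def)
    show "right_invariant G N (left_shift G g \<phi>)"
      using N g small_mem_carrier
      by (auto simp: right_invariant_def left_shift_def extend0_def m_assoc[symmetric])
  qed (auto simp: left_shift_def extend0_def)
qed

lemma test_right_shift:
  assumes g: "g \<in> carrier G" and phi: "\<phi> \<in> tests"
  shows "right_shift G g \<phi> \<in> tests"
proof -
  obtain N where N: "small N" "right_invariant G N \<phi>" using test_right_invariant phi by blast
  obtain S where S: "compactin T S" "supp_on (carrier G) \<phi> \<subseteq> S" using test_compact_support phi by blast
  show ?thesis
  proof (rule testI)
    show "compactin T ((\<lambda>x. x \<otimes> inv g) ` S)"
      using g S by (intro image_compactin[OF _ continuous_right_mult]) auto
    have "x \<in> (\<lambda>x. x \<otimes> inv g) ` S" if "x \<in> carrier G" "x \<otimes> g \<in> S" for x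
      using that g by (intro image_eqI[of _ _ "x \<otimes> g"]) (auto simp: m_assoc)
    then show "supp_on (carrier G) (right_shift G g \<phi>) \<subseteq> (\<lambda>x. x \<otimes> inv g) ` S"
      using S g by (auto simp: supp_on_def right_shift_def extend0_def)
    \<comment> \<open>The right shift by \<open>g\<close> is invariant under the conjugate of
      \<open>N\<close> by \<open>g\<close>, here cut down to \<open>U\<close>.\<close>
    show "small {x \<in> U. inv g \<otimes> x \<otimes> inv (inv g) \<in> N}" using small_conj[of "inv g" N] g N by simp
    have "\<phi> (x \<otimes> n \<otimes> g) = \<phi> (x \<otimes> g)" if x: "x \<in> carrier G" "n \<in> U" "inv g \<otimes> n \<otimes> g \<in> N" for x n
    proof -
      have n: "n \<in> carrier G" using x small_mem_carrier small_U by blast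
      have "g \<otimes> (inv g \<otimes> (n \<otimes> g)) = n \<otimes> g" using x n g by (simp add: m_assoc[symmetric])
      then have "x \<otimes> n \<otimes> g = x \<otimes> g \<otimes> (inv g \<otimes> n \<otimes> g)" using x n g by (simp add: m_assoc)
      then show ?thesis using N x g by (simp add: right_invariant_def)
    qed
    then show "right_invariant G {x \<in> U. inv g \<otimes> x \<otimes> inv (inv g) \<in> N} (right_shift G g \<phi>)"
      using g small_mem_carrier[OF small_U]
      by (auto simp: right_invariant_def right_shift_def extend0_def)
  qed (auto simp: right_shift_def extend0_def)
qed

text \<open>Inversion exchanges left and right invariance, so \<open>testI\<close> does not apply
  and local constancy is read off the continuity of the inverse. The purpose is
  \<open>test_left_invariant\<close>.\<close>

lemma test_inverse:
  assumes phi: "\<phi> \<in> tests"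
  shows "extend0 (carrier G) (\<lambda>x. \<phi> (inv x)) \<in> tests"
proof -
  obtain S where S: "compactin T S" "supp_on (carrier G) \<phi> \<subseteq> S" using test_compact_support phi by blast
  let ?\<psi> = "extend0 (carrier G) (\<lambda>x. \<phi> (inv x))"
  have im: "compactin T ((\<lambda>x. inv x) ` S)" by (rule image_compactin[OF S(1) continuous_inv])
  have "\<exists>W. openin T W \<and> x \<in> W \<and> (\<forall>y\<in>W. ?\<psi> y = ?\<psi> x)" if x: "x \<in> carrier G" for x
  proof -
    have "\<forall>x\<in>carrier G. \<exists>W. openin T W \<and> x \<in> W \<and> (\<forall>y\<in>W. \<phi> y = \<phi> x)"
      using phi by (simp add: test_functions_def topspace_eq)
    then obtain W where W: "openin T W" "inv x \<in> W" "\<forall>y\<in>W. \<phi> y = \<phi> (inv x)"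
      using x inv_closed by blast
    have "\<forall>y\<in>{y \<in> topspace T. inv y \<in> W}. ?\<psi> y = ?\<psi> x"
    proof
      fix y assume "y \<in> {y \<in> topspace T. inv y \<in> W}"
      then show "?\<psi> y = ?\<psi> x" using bspec[OF W(3), of "inv y"] x by (simp add: extend0_def topspace_eq)
    qed
    moreover have "x \<in> {y \<in> topspace T. inv y \<in> W}" using W(2) x by (simp add: topspace_eq)
    ultimately show ?thesis
      using openin_continuous_map_preimage[OF continuous_inv W(1)] by blast
  qed
  moreover have "compactin T (T closure_of {x \<in> topspace T. ?\<psi> x \<noteq> 0})"
  proof (rule closed_compactin[OF im])
    have "x \<in> (\<lambda>x. inv x) ` S" if "x \<in> carrier G" "\<phi> (inv x) \<noteq> 0" for x
      using that S by (intro image_eqI[of _ _ "inv x"]) (auto simp: supp_on_def)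
    then show "T closure_of {x \<in> topspace T. ?\<psi> x \<noteq> 0} \<subseteq> (\<lambda>x. inv x) ` S"
      using compactin_imp_closedin[OF hausdorff im]
      by (intro closure_of_minimal) (auto simp: topspace_eq extend0_def)
  qed auto
  ultimately show ?thesis by (simp add: test_functions_def topspace_eq extend0_def)
qed

lemma test_left_invariant:
  assumes phi: "\<phi> \<in> tests"
  obtains N where "small N" "\<And>n x. n \<in> N \<Longrightarrow> x \<in> carrier G \<Longrightarrow> \<phi> (n \<otimes> x) = \<phi> x"
proof -
  obtain N where N: "small N" "right_invariant G N (extend0 (carrier G) (\<lambda>x. \<phi> (inv x)))"
    using test_right_invariant test_inverse phi by blast
  have "\<phi> (n \<otimes> x) = \<phi> x" if nx: "n \<in> N" "x \<in> carrier G" for n x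
  proof -
    have n: "n \<in> carrier G" "inv n \<in> N" using nx N by (auto simp: smallD subgroup.m_inv_closed small_mem_carrier)
    then have "extend0 (carrier G) (\<lambda>x. \<phi> (inv x)) (inv x \<otimes> inv n) = extend0 (carrier G) (\<lambda>x. \<phi> (inv x)) (inv x)"
      using N(2) nx unfolding right_invariant_def by blast
    then have "\<phi> (inv (inv x \<otimes> inv n)) = \<phi> (inv (inv x))"
      using nx n by (simp add: extend0_def)
    then show ?thesis using nx n by (simp add: inv_mult_group)
  qed
  then show ?thesis using that N by blast
qed

text \<open>At \<open>y\<close> only the coset of \<open>y\<close> contributes. \<open>S\<close> may
  exceed the support, for instance consist of all cosets of a subgroup.\<close>

lemma right_invariant_decomp:
  assumes N: "small N" and phi: "right_invariant G N \<phi>" and y: "y \<in> carrier G"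
    and S: "finite S" "S \<subseteq> lcosets_in G (carrier G) N" "\<phi> y \<noteq> 0 \<Longrightarrow> y <# N \<in> S"
  shows "\<phi> y = (\<Sum>C\<in>S. const_on C (\<phi> (coset_rep C)) y)"
proof -
  have uniq: "C = y <# N" if "C \<in> S" "y \<in> C" for C
    using that S N y l_repr_independence[of y _ N] by (auto simp: lcosets_in_def smallD)
  have mem: "y \<in> y <# N" using y N by (simp add: mem_lcoset_iff smallD)
  have val: "\<phi> (coset_rep (y <# N)) = \<phi> y"
    using phi y N by (intro right_invariant_coset_rep) (auto simp: smallD right_invariant_def)
  have "(\<Sum>C\<in>S. const_on C (\<phi> (coset_rep C)) y) = (\<Sum>C\<in>S. if C = y <# N then \<phi> y else 0)"
  proof (rule sum.cong)
    fix C assume "C \<in> S"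
    then have "y \<in> C \<longleftrightarrow> C = y <# N" using uniq mem by blast
    then show "const_on C (\<phi> (coset_rep C)) y = (if C = y <# N then \<phi> y else 0)"
      using val by (simp add: const_on_def)
  qed simp
  also have "\<dots> = \<phi> y" using S by (auto simp: sum.delta)
  finally show ?thesis by simp
qed

text \<open>Test functions are finite sums of multiples of indicators of cosets, so an identity
  linear in \<open>\<phi>\<close> needs checking only on one coset.\<close>

lemma test_induct [consumes 1, case_names zero add coset]:
  assumes phi: "\<phi> \<in> tests"
    and zero: "P (\<lambda>_. 0)"
    and add: "\<And>\<phi> \<psi>. \<phi> \<in> tests \<Longrightarrow> \<psi> \<in> tests \<Longrightarrow> P \<phi> \<Longrightarrow> P \<psi> \<Longrightarrow> P (\<lambda>x. \<phi> x + \<psi> x)"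
    and coset: "\<And>c x N. x \<in> carrier G \<Longrightarrow> small N \<Longrightarrow> P (const_on (x <# N) c)"
  shows "P \<phi>"
proof -
  obtain N where N: "small N" "right_invariant G N \<phi>" using test_right_invariant phi by blast
  define S where "S = lcosets_in G (supp_on (carrier G) \<phi>) N"
  have S: "finite S" "S \<subseteq> lcosets_in G (carrier G) N"
    using test_finite_cosets[OF phi N(1)] by (auto simp: S_def lcosets_in_def supp_on_def)
  have "P (\<lambda>y. \<Sum>C\<in>S'. const_on C (\<phi> (coset_rep C)) y)" if "finite S'" "S' \<subseteq> lcosets_in G (carrier G) N" for S'
    using that
  proof (induction S')
    case (insert C S')
    then obtain x where x: "x \<in> carrier G" "C = x <# N" by (auto simp: lcosets_in_def)
    have "(\<lambda>y. \<Sum>C\<in>S'. const_on C (\<phi> (coset_rep C)) y) \<in> tests"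
      using insert N by (intro test_sum) (auto simp: lcosets_in_def test_const_on_coset)
    then show ?case using insert x N by (simp add: add coset test_const_on_coset)
  qed (simp add: zero)
  from this[OF S] have P: "P (\<lambda>y. \<Sum>C\<in>S. const_on C (\<phi> (coset_rep C)) y)" .
  have "\<phi> y = (\<Sum>C\<in>S. const_on C (\<phi> (coset_rep C)) y)" for y
  proof (cases "y \<in> carrier G")
    case True
    then show ?thesis
      by - (rule right_invariant_decomp[OF N True S], auto simp: S_def lcosets_in_def supp_on_def)
  next
    case False
    then have "y \<notin> C" if "C \<in> S" for C
      using that S N small_mem_carrier by (auto simp: lcosets_in_def l_coset_def)
    then show ?thesis using False phi by (simp add: const_on_def test_zero_outside)
  qed
  then have "\<phi> = (\<lambda>y. \<Sum>C\<in>S. const_on C (\<phi> (coset_rep C)) y)" by (rule ext)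
  with P show ?thesis by simp
qed

end

section \<open>Haar measure and the Hecke algebra\<close>

text \<open>Convolution on the right with the point mass at \<open>g\<close>. It commutes with left
  translations and so gives endomorphisms of \<open>H(G)\<close> as an object of
  \<open>R(G)\<close>.\<close>

definition right_translate ::
    "('g, 'm) monoid_scheme \<Rightarrow> 'g topology \<Rightarrow> 'g \<Rightarrow> ('g, 'k::field) distribution \<Rightarrow>
     ('g, 'k) distribution" where
  "right_translate G T g h = extend0 (test_functions T) (\<lambda>\<phi>. h (right_shift G g \<phi>))"

context group
begin

lemma left_shift_left_shift:
  "x \<in> carrier G \<Longrightarrow> g \<in> carrier G \<Longrightarrow> left_shift G x (left_shift G g \<phi>) = left_shift G (g \<otimes> x) \<phi>"
  by (auto simp: left_shift_def extend0_def fun_eq_iff m_assoc)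

lemma right_shift_right_shift:
  "x \<in> carrier G \<Longrightarrow> g \<in> carrier G \<Longrightarrow> right_shift G x (right_shift G g \<phi>) = right_shift G (x \<otimes> g) \<phi>"
  by (auto simp: right_shift_def extend0_def fun_eq_iff m_assoc)

lemma left_shift_right_shift:
  "x \<in> carrier G \<Longrightarrow> g \<in> carrier G \<Longrightarrow> left_shift G x (right_shift G g \<phi>) = right_shift G g (left_shift G x \<phi>)"
  by (auto simp: left_shift_def right_shift_def extend0_def fun_eq_iff m_assoc)

end

lemma left_translate_shift:
  "left_translate G T g h = extend0 (test_functions T) (\<lambda>\<phi>. h (left_shift G g \<phi>))"
  by (simp add: left_translate_def left_shift_def)

context hecke_setup
begin

lemma left_shift_one: "\<phi> \<in> tests \<Longrightarrow> left_shift G \<one> \<phi> = \<phi>"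
  by (auto simp: left_shift_def extend0_def fun_eq_iff test_zero_outside)

lemma right_shift_one: "\<phi> \<in> tests \<Longrightarrow> right_shift G \<one> \<phi> = \<phi>"
  by (auto simp: right_shift_def extend0_def fun_eq_iff test_zero_outside)

lemma right_shift_invariant:
  assumes "\<phi> \<in> tests" "right_invariant G K \<phi>" "k \<in> K"
  shows "right_shift G k \<phi> = \<phi>"
  using assms by (auto simp: right_shift_def extend0_def fun_eq_iff test_zero_outside right_invariant_def)

lemma right_invariant_const_on:
  "small N \<Longrightarrow> right_invariant G N (const_on N c)"
  using right_invariant_const_on_coset[of \<one> N c] small_one_lcoset by simp

section \<open>Existence, uniqueness and modulus of the Haar measure\<close>

abbreviation index :: "'g set \<Rightarrow> 'k" where
  "index N \<equiv> of_nat (card (lcosets_in G U N))"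

text \<open>The left Haar measure giving \<open>U\<close> mass 1: each coset of \<open>N\<close> has
  mass \<open>1 / index N\<close>, and \<open>\<phi>\<close> is constant on such cosets.
  \<open>haar_sum_refine\<close> shows that the chosen \<open>N\<close> does not matter.\<close>

definition haar :: "('g \<Rightarrow> 'k) \<Rightarrow> 'k" where
  "haar \<phi> = (let N = SOME N. small N \<and> right_invariant G N \<phi>
     in (\<Sum>C\<in>lcosets_in G (supp_on (carrier G) \<phi>) N. \<phi> (coset_rep C)) / index N)"

lemma index_refine:
  assumes "small M" "small N" "N \<subseteq> M"
  shows "index N = index M * of_nat (card (lcosets_in G M N))"
proof -
  have "card (lcosets_in G U N) = card (lcosets_in G U M) * card (lcosets_in G M N)"
  proof (rule card_lcosets_in_refine)
    show "x \<otimes> m \<in> U" if "x \<in> U" "m \<in> M" for x m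
      using that smallD(3)[OF assms(1)] subgroup_U by (auto simp: subgroup.m_closed)
  qed (use assms smallD small_U in auto)
  then show ?thesis by simp
qed

lemma index_neq_0: "small N \<Longrightarrow> index N \<noteq> 0"
  using index_nonzero[OF small_U] smallD(3) by blast

text \<open>Numerator and denominator both grow by the factor
  \<open>card (lcosets_in G M N)\<close>, which is invertible.\<close>

lemma haar_sum_refine:
  assumes M: "small M" "small N" "N \<subseteq> M" "right_invariant G M \<phi>"
  shows "(\<Sum>C\<in>lcosets_in G (supp_on (carrier G) \<phi>) N. \<phi> (coset_rep C)) / index N
       = (\<Sum>C\<in>lcosets_in G (supp_on (carrier G) \<phi>) M. \<phi> (coset_rep C)) / (index M :: 'k)"
proof -
  have "(\<Sum>C\<in>lcosets_in G (supp_on (carrier G) \<phi>) N. \<phi> (coset_rep C))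
     = of_nat (card (lcosets_in G M N)) * (\<Sum>C\<in>lcosets_in G (supp_on (carrier G) \<phi>) M. \<phi> (coset_rep C))"
    using M small_mem_carrier[OF M(1)]
    by (intro sum_lcosets_in_refine) (auto simp: smallD supp_on_def right_invariant_def)
  then show ?thesis
    using index_refine[OF M(1-3)] index_neq_0[OF M(1)] index_nonzero[OF M(1-3)] by simp
qed

lemma haar_eq_supp:
  assumes N: "small N" "right_invariant G N \<phi>"
  shows "haar \<phi> = (\<Sum>C\<in>lcosets_in G (supp_on (carrier G) \<phi>) N. \<phi> (coset_rep C)) / index N"
proof -
  define M where "M = (SOME M. small M \<and> right_invariant G M \<phi>)"
  have M: "small M" "right_invariant G M \<phi>"
    using someI[of "\<lambda>M. small M \<and> right_invariant G M \<phi>" N] N by (auto simp: M_def)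
  have NM: "small (N \<inter> M)" using N M small_Int by blast
  show ?thesis
    using haar_sum_refine[OF N(1) NM _ N(2)] haar_sum_refine[OF M(1) NM _ M(2)]
    by (simp add: haar_def M_def[symmetric])
qed

lemma haar_eq:
  assumes N: "small N" "right_invariant G N \<phi>"
    and S: "finite S" "S \<subseteq> lcosets_in G (carrier G) N"
    and sub: "\<And>x. x \<in> carrier G \<Longrightarrow> \<phi> x \<noteq> 0 \<Longrightarrow> x <# N \<in> S"
  shows "haar \<phi> = (\<Sum>C\<in>S. \<phi> (coset_rep C)) / index N"
proof -
  have "(\<Sum>C\<in>lcosets_in G (supp_on (carrier G) \<phi>) N. \<phi> (coset_rep C)) = (\<Sum>C\<in>S. \<phi> (coset_rep C))"
  proof (rule sum.mono_neutral_left[OF S(1)])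
    show "lcosets_in G (supp_on (carrier G) \<phi>) N \<subseteq> S" using sub by (auto simp: lcosets_in_def supp_on_def)
    show "\<forall>C\<in>S - lcosets_in G (supp_on (carrier G) \<phi>) N. \<phi> (coset_rep C) = 0"
    proof
      fix C assume C: "C \<in> S - lcosets_in G (supp_on (carrier G) \<phi>) N"
      then obtain x where x: "x \<in> carrier G" "C = x <# N" using S by (auto simp: lcosets_in_def)
      then have "coset_rep C \<in> carrier G" "coset_rep C <# N = C"
        using coset_rep_closed coset_rep_lcoset N smallD(1) by auto
      then show "\<phi> (coset_rep C) = 0" using C by (force simp: lcosets_in_def supp_on_def)
    qed
  qed
  then show ?thesis using haar_eq_supp[OF N] by simp
qed

lemma haar_add:
  assumes "\<phi> \<in> tests" "\<psi> \<in> tests"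
  shows "haar (\<lambda>x. \<phi> x + \<psi> x) = haar \<phi> + haar \<psi>"
proof -
  obtain N1 where N1: "small N1" "right_invariant G N1 \<phi>" using test_right_invariant assms by blast
  obtain N2 where N2: "small N2" "right_invariant G N2 \<psi>" using test_right_invariant assms by blast
  define N where "N = N1 \<inter> N2"
  have N: "small N" "right_invariant G N \<phi>" "right_invariant G N \<psi>" "right_invariant G N (\<lambda>x. \<phi> x + \<psi> x)"
    using N1 N2 small_Int by (auto simp: N_def right_invariant_def)
  define S where "S = lcosets_in G (supp_on (carrier G) \<phi>) N \<union> lcosets_in G (supp_on (carrier G) \<psi>) N"
  have S: "finite S" "S \<subseteq> lcosets_in G (carrier G) N"
    using test_finite_cosets[OF assms(1) N(1)] test_finite_cosets[OF assms(2) N(1)]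
    by (auto simp: S_def lcosets_in_def supp_on_def)
  have sub: "x <# N \<in> S" if "x \<in> carrier G" "\<phi> x \<noteq> 0 \<or> \<psi> x \<noteq> 0" for x
    using that by (auto simp: S_def lcosets_in_def supp_on_def)
  have "haar (\<lambda>x. \<phi> x + \<psi> x) = (\<Sum>C\<in>S. \<phi> (coset_rep C) + \<psi> (coset_rep C)) / index N"
    by (rule haar_eq[OF N(1,4) S], rule sub) auto
  moreover have "haar \<phi> = (\<Sum>C\<in>S. \<phi> (coset_rep C)) / index N"
    by (rule haar_eq[OF N(1,2) S], rule sub) auto
  moreover have "haar \<psi> = (\<Sum>C\<in>S. \<psi> (coset_rep C)) / index N"
    by (rule haar_eq[OF N(1,3) S], rule sub) auto
  ultimately show ?thesis by (simp add: sum.distrib add_divide_distrib)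
qed

lemma haar_scale:
  assumes "\<phi> \<in> tests"
  shows "haar (\<lambda>x. c * \<phi> x) = c * haar \<phi>"
proof -
  obtain N where N: "small N" "right_invariant G N \<phi>" using test_right_invariant assms by blast
  then have N': "right_invariant G N (\<lambda>x. c * \<phi> x)" by (auto simp: right_invariant_def)
  define S where "S = lcosets_in G (supp_on (carrier G) \<phi>) N"
  have S: "finite S" "S \<subseteq> lcosets_in G (carrier G) N"
    using test_finite_cosets[OF assms N(1)] by (auto simp: S_def lcosets_in_def supp_on_def)
  have "haar (\<lambda>x. c * \<phi> x) = (\<Sum>C\<in>S. c * \<phi> (coset_rep C)) / index N"
    by (rule haar_eq[OF N(1) N' S]) (auto simp: S_def lcosets_in_def supp_on_def)
  moreover have "haar \<phi> = (\<Sum>C\<in>S. \<phi> (coset_rep C)) / index N"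
    by (rule haar_eq[OF N S]) (auto simp: S_def lcosets_in_def supp_on_def)
  ultimately show ?thesis by (simp add: sum_distrib_left)
qed

lemma haar_left_shift:
  assumes g: "g \<in> carrier G" and phi: "\<phi> \<in> tests"
  shows "haar (left_shift G g \<phi>) = haar \<phi>"
proof -
  obtain N where N: "small N" "right_invariant G N \<phi>" using test_right_invariant phi by blast
  have N': "right_invariant G N (left_shift G g \<phi>)"
    using N g small_mem_carrier
    by (auto simp: right_invariant_def left_shift_def extend0_def m_assoc[symmetric])
  let ?A = "supp_on (carrier G) (left_shift G g \<phi>)"
  have A: "(\<lambda>x. g \<otimes> x) ` ?A = supp_on (carrier G) \<phi>"
  proof
    show "(\<lambda>x. g \<otimes> x) ` ?A \<subseteq> supp_on (carrier G) \<phi>"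
      using g by (auto simp: supp_on_def left_shift_def extend0_def)
    show "supp_on (carrier G) \<phi> \<subseteq> (\<lambda>x. g \<otimes> x) ` ?A"
    proof
      fix x assume "x \<in> supp_on (carrier G) \<phi>"
      then show "x \<in> (\<lambda>x. g \<otimes> x) ` ?A"
        using g by (intro image_eqI[of _ _ "inv g \<otimes> x"])
          (auto simp: supp_on_def left_shift_def extend0_def m_assoc[symmetric])
    qed
  qed
  have AG: "?A \<subseteq> carrier G" by (rule supp_subset_carrier)
  have "(\<Sum>C\<in>lcosets_in G ?A N. left_shift G g \<phi> (coset_rep C)) = (\<Sum>C\<in>lcosets_in G ?A N. \<phi> (g \<otimes> coset_rep C))"
  proof (rule sum.cong)
    fix C assume "C \<in> lcosets_in G ?A N"
    then have "coset_rep C \<in> carrier G"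
      using AG coset_rep_closed[OF smallD(1)[OF N(1)]] by (auto simp: lcosets_in_def)
    then show "left_shift G g \<phi> (coset_rep C) = \<phi> (g \<otimes> coset_rep C)"
      by (simp add: left_shift_def extend0_def)
  qed simp
  also have "\<dots> = (\<Sum>C\<in>lcosets_in G (supp_on (carrier G) \<phi>) N. \<phi> (coset_rep C))"
    unfolding A[symmetric]
  proof (rule sum_lcosets_in_left_translate)
    fix x n assume "x \<in> ?A" "n \<in> N"
    then show "\<phi> (g \<otimes> (x \<otimes> n)) = \<phi> (g \<otimes> x)"
      using N g small_mem_carrier[OF N(1)]
      by (auto simp: supp_on_def right_invariant_def m_assoc[symmetric])
  qed (use N g AG smallD in auto)
  finally show ?thesis using haar_eq_supp[OF N] haar_eq_supp[OF N(1) N'] by simp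
qed

lemma haar_const_on_coset:
  assumes x: "x \<in> carrier G" and N: "small N"
  shows "haar (const_on (x <# N) c) = c / index N"
proof -
  have "haar (const_on (x <# N) c) = (\<Sum>C\<in>{x <# N}. const_on (x <# N) c (coset_rep C)) / index N"
  proof (rule haar_eq[OF N right_invariant_const_on_coset[OF x N]])
    show "y <# N \<in> {x <# N}" if "y \<in> carrier G" "const_on (x <# N) c y \<noteq> 0" for y
      using that x N l_repr_independence[of y x N] by (auto simp: const_on_def smallD split: if_splits)
  qed (use x in \<open>auto simp: lcosets_in_def\<close>)
  then show ?thesis using coset_rep_in[OF smallD(1)[OF N] x] by (simp add: const_on_def)
qed

lemma haar_const_on: "small N \<Longrightarrow> haar (const_on N c) = c / index N"
  using haar_const_on_coset[of \<one> N c] small_one_lcoset by simp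

lemma index_U: "index U = 1"
  using lcosets_in_self[OF subgroup_U] by simp

lemma left_invariant_measuresD:
  assumes "\<nu> \<in> left_invariant_measures G T"
  shows "\<nu> \<in> distributions T"
    and "g \<in> carrier G \<Longrightarrow> \<phi> \<in> test_functions T \<Longrightarrow> \<nu> (left_shift G g \<phi>) = \<nu> \<phi>"
  using assms by (auto simp: left_invariant_measures_def left_shift_def)

lemma haar_measure: "extend0 tests haar \<in> left_invariant_measures G T"
  using haar_left_shift test_left_shift
  by (auto simp: left_invariant_measures_def distributions_def extend0_def test_add test_scale
      haar_add haar_scale left_shift_def)

lemma distribution_zero: "f \<in> distributions T \<Longrightarrow> f (\<lambda>_. 0) = (0::'k)"
  using distributionsD(2)[of f T "\<lambda>_. 0" 0] test_zero by simp

lemma distribution_sum: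
  assumes "f \<in> distributions T" "finite I" "\<And>i. i \<in> I \<Longrightarrow> \<phi> i \<in> tests"
  shows "f (\<lambda>x. \<Sum>i\<in>I. \<phi> i x) = (\<Sum>i\<in>I. f (\<phi> i))"
  using assms(2,3)
proof (induction I)
  case empty
  then show ?case using distribution_zero assms(1) by simp
next
  case (insert i I)
  then show ?case by (simp add: distributionsD(1)[OF assms(1)] test_sum)
qed

lemma const_on_partition:
  assumes K: "small K" and N: "small N" and NK: "N \<subseteq> K"
  shows "const_on K c = (\<lambda>y. \<Sum>C\<in>lcosets_in G K N. const_on C c y)"
proof
  fix y
  have KG: "K \<subseteq> carrier G" using K smallD by blast
  have sub: "C \<subseteq> K" if "C \<in> lcosets_in G K N" for C
    using that K NK by (auto simp: lcosets_in_def l_coset_def smallD subgroup.m_closed subset_iff)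
  show "const_on K c y = (\<Sum>C\<in>lcosets_in G K N. const_on C c y)"
  proof (cases "y \<in> K")
    case True
    have "const_on K c y = (\<Sum>C\<in>lcosets_in G K N. const_on C (const_on K c (coset_rep C)) y)"
      using True KG NK right_invariant_mono[OF right_invariant_const_on[OF K]]
      by (intro right_invariant_decomp[OF N] finite_lcosets K N) (auto simp: lcosets_in_def)
    also have "\<dots> = (\<Sum>C\<in>lcosets_in G K N. const_on C c y)"
    proof (rule sum.cong)
      fix C assume "C \<in> lcosets_in G K N"
      then have "coset_rep C \<in> K" by (rule small_coset_rep[OF K N NK])
      then show "const_on C (const_on K c (coset_rep C)) y = const_on C c y" by (simp add: const_on_def)
    qed simp
    finally show ?thesis .
  next
    case False
    then have "const_on C c y = 0" if "C \<in> lcosets_in G K N" for C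
      using sub[OF that] by (auto simp: const_on_def)
    then show ?thesis using False by (simp add: const_on_def)
  qed
qed

lemma left_shift_const_on_coset:
  assumes "x \<in> carrier G" "small N"
  shows "left_shift G x (const_on (x <# N) c) = const_on N c"
proof
  fix y
  show "left_shift G x (const_on (x <# N) c) y = const_on N c y"
    using assms small_mem_carrier[OF assms(2), of y]
    by (cases "y \<in> carrier G")
       (auto simp: left_shift_def extend0_def const_on_def mem_lcoset_iff smallD m_assoc[symmetric])
qed

lemma left_invariant_const_on_coset:
  assumes nu: "\<nu> \<in> left_invariant_measures G T" and x: "x \<in> carrier G" and N: "small N"
  shows "\<nu> (const_on (x <# N) c) = c * (\<nu> (const_on N 1) :: 'k)"
proof -
  have "\<nu> (const_on (x <# N) c) = \<nu> (const_on N c)"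
    using left_invariant_measuresD(2)[OF nu x test_const_on_coset[OF x N]]
      left_shift_const_on_coset[OF x N] by metis
  also have "const_on N c = (\<lambda>y. c * const_on N 1 y)" by (auto simp: const_on_def)
  finally show ?thesis
    using distributionsD(2)[OF left_invariant_measuresD(1)[OF nu] test_const_on[OF N]] by simp
qed

text \<open>By \<open>test_induct\<close> only cosets matter: invariance makes all cosets of
  \<open>N\<close> equally heavy, and \<open>index N\<close> of them fill \<open>U\<close>, so the
  mass of \<open>U\<close> determines everything.\<close>

lemma left_invariant_unique:
  assumes nu: "\<nu> \<in> left_invariant_measures G T" and phi: "\<phi> \<in> tests"
  shows "\<nu> \<phi> = \<nu> (const_on U 1) * haar \<phi>"
  using phi
proof (induction \<phi> rule: test_induct)
  case zero
  then show ?case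
    using distribution_zero[OF left_invariant_measuresD(1)[OF nu]] haar_scale[OF test_zero, of 0] by simp
next
  case (add \<phi> \<psi>)
  then show ?case
    using distributionsD(1)[OF left_invariant_measuresD(1)[OF nu]] by (simp add: haar_add distrib_left)
next
  case (coset c x N)
  have fin: "finite (lcosets_in G U N)" using coset finite_lcosets small_U smallD(3) by blast
  have U: "C \<in> lcosets_in G U N \<Longrightarrow> \<exists>x\<in>carrier G. C = x <# N" for C
    using small_mem_carrier[OF small_U] by (auto simp: lcosets_in_def)
  have "\<nu> (const_on U 1) = (\<Sum>C\<in>lcosets_in G U N. \<nu> (const_on C 1))"
    unfolding const_on_partition[OF small_U \<open>small N\<close> smallD(3)[OF \<open>small N\<close>]]
    using U test_const_on_coset \<open>small N\<close>
    by (intro distribution_sum left_invariant_measuresD(1)[OF nu] fin) blast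
  also have "\<dots> = (\<Sum>C\<in>lcosets_in G U N. \<nu> (const_on N 1))"
    using U left_invariant_const_on_coset[OF nu _ \<open>small N\<close>, of _ 1] by (intro sum.cong) auto
  finally have "\<nu> (const_on U 1) = index N * \<nu> (const_on N 1)" by simp
  then show ?case
    using coset left_invariant_const_on_coset[OF nu] index_neq_0[OF \<open>small N\<close>]
    by (simp add: haar_const_on_coset)
qed

text \<open>The \<open>k\<close>-valued modulus character: since \<open>haar\<close> gives
  \<open>U\<close> mass 1, the shifted indicator of \<open>U\<close> reads off the factor by which a
  right shift rescales \<open>haar\<close>.\<close>

definition modulus :: "'g \<Rightarrow> 'k" where
  "modulus g = haar (right_shift G g (const_on U 1))"

text \<open>Right shifts commute with left shifts, so shifting first gives another left-invariant
  measure, and uniqueness makes it a multiple of \<open>haar\<close>.\<close>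

lemma haar_right_shift:
  assumes g: "g \<in> carrier G" and phi: "\<phi> \<in> tests"
  shows "haar (right_shift G g \<phi>) = modulus g * haar \<phi>"
proof -
  let ?\<nu> = "extend0 tests (\<lambda>\<phi>. haar (right_shift G g \<phi>))"
  have "right_shift G g (\<lambda>x. \<phi> x + \<psi> x) = (\<lambda>x. right_shift G g \<phi> x + right_shift G g \<psi> x)" for \<phi> \<psi> :: "'g \<Rightarrow> 'k"
    by (auto simp: right_shift_def extend0_def)
  moreover have "right_shift G g (\<lambda>x. c * \<phi> x) = (\<lambda>x. c * right_shift G g \<phi> x)" for c and \<phi> :: "'g \<Rightarrow> 'k"
    by (auto simp: right_shift_def extend0_def)
  ultimately have "?\<nu> \<in> distributions T"
    using g by (auto simp: distributions_def extend0_def haar_add haar_scale test_right_shift test_add test_scale)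
  moreover have "?\<nu> (left_shift G x \<psi>) = ?\<nu> \<psi>" if "x \<in> carrier G" "\<psi> \<in> tests" for x \<psi>
    using that g haar_left_shift[of x "right_shift G g \<psi>"]
    by (simp add: extend0_def test_left_shift test_right_shift left_shift_right_shift)
  ultimately have "?\<nu> \<in> left_invariant_measures G T"
    by (simp add: left_invariant_measures_def left_shift_def)
  from left_invariant_unique[OF this phi] show ?thesis
    using phi test_const_on[OF small_U] by (simp add: extend0_def modulus_def)
qed

lemma modulus_U:
  assumes "g \<in> U"
  shows "modulus g = 1"
  using right_shift_invariant[OF test_const_on[OF small_U] right_invariant_const_on[OF small_U] assms]
    haar_const_on[OF small_U] index_U by (simp add: modulus_def)

lemma modulus_inverse:
  assumes g: "g \<in> carrier G"
  shows "modulus g * modulus (inv g) = 1"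
proof -
  let ?u = "const_on U (1::'k)"
  have u: "?u \<in> tests" using test_const_on[OF small_U] .
  have "haar ?u = 1" using haar_const_on[OF small_U] index_U by simp
  have "haar (right_shift G g (right_shift G (inv g) ?u)) = modulus g * (modulus (inv g) * haar ?u)"
    using g u by (simp add: haar_right_shift test_right_shift)
  moreover have "right_shift G g (right_shift G (inv g) ?u) = ?u"
    using g u by (simp add: right_shift_right_shift right_shift_one)
  ultimately show ?thesis using \<open>haar ?u = 1\<close> by simp
qed

section \<open>Elements of H(G) as densities of one Haar measure\<close>

definition density :: "('g \<Rightarrow> 'k) \<Rightarrow> ('g, 'k) distribution" where
  "density \<theta> = extend0 tests (\<lambda>\<phi>. haar (\<lambda>x. \<theta> x * \<phi> x))"

lemma density_apply: "\<phi> \<in> tests \<Longrightarrow> density \<theta> \<phi> = haar (\<lambda>x. \<theta> x * \<phi> x)"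
  by (simp add: density_def extend0_def)

lemma density_add:
  assumes "\<theta> \<in> tests" "\<eta> \<in> tests"
  shows "density (\<lambda>x. \<theta> x + \<eta> x) = (\<lambda>\<phi>. density \<theta> \<phi> + density \<eta> \<phi>)"
  using assms by (auto simp: density_def extend0_def fun_eq_iff distrib_right haar_add test_mult)

lemma density_scale:
  assumes "\<theta> \<in> tests"
  shows "density (\<lambda>x. c * \<theta> x) = (\<lambda>\<phi>. c * density \<theta> \<phi>)"
  using assms by (auto simp: density_def extend0_def fun_eq_iff mult.assoc haar_scale test_mult)

lemma density_zero: "density (\<lambda>_. 0) = (\<lambda>_. 0)"
  using density_scale[OF test_zero, of 0] by simp

lemma density_sum:
  assumes "finite I" "\<And>i. i \<in> I \<Longrightarrow> \<theta> i \<in> tests"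
  shows "density (\<lambda>x. \<Sum>i\<in>I. \<theta> i x) = (\<lambda>\<phi>. \<Sum>i\<in>I. density (\<theta> i) \<phi>)"
  using assms by (induction I) (simp_all add: density_zero density_add test_sum)

lemma density_distribution:
  assumes "\<theta> \<in> tests"
  shows "density \<theta> \<in> distributions T"
  using assms haar_scale[OF test_mult[OF assms]]
  by (auto simp: distributions_def density_def extend0_def test_add test_scale distrib_left
      haar_add test_mult mult.left_commute)

text \<open>By uniqueness any invariant measure is a scalar times \<open>haar\<close>, and the
  scalar is absorbed into the function. With one measure for all elements, closure of
  \<open>H(G)\<close> under sums becomes evident.\<close>

lemma hecke_eq: "hecke G T = density ` tests"
proof
  show "hecke G T \<subseteq> density ` tests"
  proof
    fix h assume "h \<in> (hecke G T :: ('g, 'k) distribution set)"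
    then obtain \<nu> \<theta> where h: "h = extend0 tests (\<lambda>\<phi>. \<nu> (\<lambda>x. \<theta> x * \<phi> x))"
      and nu: "\<nu> \<in> left_invariant_measures G T" and th: "\<theta> \<in> tests" by (auto simp: hecke_def)
    have "h = density (\<lambda>x. \<nu> (const_on U 1) * \<theta> x)"
      using th left_invariant_unique[OF nu] density_scale[OF th]
      by (auto simp: h density_def extend0_def fun_eq_iff test_mult)
    then show "h \<in> density ` tests" using th test_scale by blast
  qed
  show "density ` tests \<subseteq> hecke G T"
  proof
    fix h assume "h \<in> density ` tests"
    then obtain \<theta> where th: "\<theta> \<in> tests" "h = density \<theta>" by blast
    then have "h = extend0 tests (\<lambda>\<phi>. extend0 tests haar (\<lambda>x. \<theta> x * \<phi> x))"
      by (auto simp: density_def extend0_def fun_eq_iff test_mult)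
    then show "h \<in> hecke G T" using th haar_measure by (auto simp: hecke_def)
  qed
qed

lemma left_translate_density:
  assumes g: "g \<in> carrier G" and th: "\<theta> \<in> tests"
  shows "left_translate G T g (density \<theta>) = density (left_shift G (inv g) \<theta>)"
proof
  fix \<phi>
  show "left_translate G T g (density \<theta>) \<phi> = density (left_shift G (inv g) \<theta>) \<phi>"
  proof (cases "\<phi> \<in> tests")
    case True
    let ?\<psi> = "\<lambda>x. left_shift G (inv g) \<theta> x * \<phi> x"
    have "(\<lambda>x. \<theta> x * left_shift G g \<phi> x) = left_shift G g ?\<psi>"
      using g th by (auto simp: left_shift_def extend0_def fun_eq_iff m_assoc[symmetric])
    moreover have "?\<psi> \<in> tests" using True g th by (simp add: test_mult test_left_shift)
    ultimately show ?thesis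
      using True g th by (simp add: left_translate_shift density_def extend0_def test_left_shift haar_left_shift)
  qed (simp add: left_translate_shift density_def extend0_def)
qed

text \<open>Moving the shift from the test function to the density is a right change of variable,
  which costs \<open>modulus g\<close>; the left-handed version is free of it.\<close>

lemma right_translate_density:
  assumes g: "g \<in> carrier G" and th: "\<theta> \<in> tests"
  shows "right_translate G T g (density \<theta>) = density (\<lambda>x. modulus g * right_shift G (inv g) \<theta> x)"
proof
  fix \<phi>
  show "right_translate G T g (density \<theta>) \<phi> = density (\<lambda>x. modulus g * right_shift G (inv g) \<theta> x) \<phi>"
  proof (cases "\<phi> \<in> tests")
    case True
    let ?\<psi> = "\<lambda>x. right_shift G (inv g) \<theta> x * \<phi> x"
    have "(\<lambda>x. \<theta> x * right_shift G g \<phi> x) = right_shift G g ?\<psi>"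
      using g th by (auto simp: right_shift_def extend0_def fun_eq_iff m_assoc)
    moreover have "?\<psi> \<in> tests" using True g th by (simp add: test_mult test_right_shift)
    ultimately show ?thesis
      using True g th density_scale[OF test_right_shift[of "inv g", OF _ th], of "modulus g"]
      by (simp add: right_translate_def density_def extend0_def test_right_shift haar_right_shift)
  qed (simp add: right_translate_def density_def extend0_def)
qed

lemma right_translate_density_U:
  assumes "g \<in> U" "\<theta> \<in> tests"
  shows "right_translate G T g (density \<theta>) = density (right_shift G (inv g) \<theta>)"
  using right_translate_density[OF small_mem_carrier[OF small_U assms(1)] assms(2)] modulus_U[OF assms(1)]
  by simp

lemma hecke_add: "h \<in> hecke G T \<Longrightarrow> h' \<in> hecke G T \<Longrightarrow> (\<lambda>\<phi>. h \<phi> + (h' \<phi> :: 'k)) \<in> hecke G T"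
  unfolding hecke_eq by (auto simp: density_add[symmetric] test_add)

lemma hecke_scale: "h \<in> hecke G T \<Longrightarrow> (\<lambda>\<phi>. c * (h \<phi> :: 'k)) \<in> hecke G T"
  unfolding hecke_eq by (auto simp: density_scale[symmetric] test_scale)

lemma hecke_zero: "(\<lambda>\<phi>. (0::'k)) \<in> hecke G T"
  unfolding hecke_eq using density_zero test_zero by (metis imageI)

lemma hecke_left_translate:
  "g \<in> carrier G \<Longrightarrow> h \<in> hecke G T \<Longrightarrow> (left_translate G T g h :: ('g, 'k) distribution) \<in> hecke G T"
  unfolding hecke_eq by (auto simp: left_translate_density test_left_shift)

lemma hecke_right_translate:
  "g \<in> carrier G \<Longrightarrow> h \<in> hecke G T \<Longrightarrow> (right_translate G T g h :: ('g, 'k) distribution) \<in> hecke G T"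
  unfolding hecke_eq by (auto simp: right_translate_density test_right_shift test_scale)

lemma hecke_distribution: "h \<in> hecke G T \<Longrightarrow> (h :: ('g, 'k) distribution) \<in> distributions T"
  unfolding hecke_eq using density_distribution by blast

text \<open>Smoothness of \<open>H(G)\<close> under left translation: the density of
  \<open>h\<close> is uniformly left-invariant by \<open>test_left_invariant\<close>.\<close>

lemma hecke_left_invariant:
  assumes "(h :: ('g, 'k) distribution) \<in> hecke G T"
  obtains N where "small N" "\<And>n. n \<in> N \<Longrightarrow> left_translate G T n h = h"
proof -
  obtain \<theta> where th: "\<theta> \<in> tests" "h = density \<theta>" using assms by (auto simp: hecke_eq)
  obtain N where N: "small N" "\<And>n x. n \<in> N \<Longrightarrow> x \<in> carrier G \<Longrightarrow> \<theta> (n \<otimes> x) = \<theta> x"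
    using test_left_invariant th by blast
  have "left_translate G T n h = h" if "n \<in> N" for n
  proof -
    have "inv n \<in> N" "n \<in> carrier G" using that N by (auto simp: smallD subgroup.m_inv_closed small_mem_carrier)
    moreover from this have "left_shift G (inv n) \<theta> = \<theta>"
      using N th by (auto simp: left_shift_def extend0_def fun_eq_iff test_zero_outside)
    ultimately show ?thesis using th left_translate_density by simp
  qed
  then show ?thesis using that N by blast
qed

end

section \<open>The distribution of a central element\<close>

context hecke_setup
begin

text \<open>The inner integral of the convolution, that is, the function on which \<open>f\<close>
  is evaluated in \<open>f * h\<close>.\<close>

definition slide :: "('g, 'k) distribution \<Rightarrow> ('g \<Rightarrow> 'k) \<Rightarrow> 'g \<Rightarrow> 'k" where
  "slide h \<phi> = extend0 (carrier G) (\<lambda>g. h (left_shift G g \<phi>))"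

lemma left_translate_apply: "\<phi> \<in> tests \<Longrightarrow> left_translate G T g h \<phi> = h (left_shift G g \<phi>)"
  by (simp add: left_translate_shift extend0_def)

lemma right_translate_apply: "\<phi> \<in> tests \<Longrightarrow> right_translate G T g h \<phi> = h (right_shift G g \<phi>)"
  by (simp add: right_translate_def extend0_def)

lemma left_translate_add:
  "left_translate G T g (\<lambda>\<phi>. h \<phi> + h' \<phi>) = (\<lambda>\<phi>. left_translate G T g h \<phi> + (left_translate G T g h' \<phi> :: 'k))"
  by (auto simp: left_translate_def extend0_def)

lemma left_translate_scale:
  "left_translate G T g (\<lambda>\<phi>. c * h \<phi>) = (\<lambda>\<phi>. c * (left_translate G T g h \<phi> :: 'k))"
  by (auto simp: left_translate_def extend0_def)

lemma right_translate_add: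
  "right_translate G T g (\<lambda>\<phi>. h \<phi> + h' \<phi>) = (\<lambda>\<phi>. right_translate G T g h \<phi> + (right_translate G T g h' \<phi> :: 'k))"
  by (auto simp: right_translate_def extend0_def)

lemma right_translate_scale:
  "right_translate G T g (\<lambda>\<phi>. c * h \<phi>) = (\<lambda>\<phi>. c * (right_translate G T g h \<phi> :: 'k))"
  by (auto simp: right_translate_def extend0_def)

lemma left_translate_mult:
  assumes "g \<in> carrier G" "x \<in> carrier G"
  shows "left_translate G T (g \<otimes> x) h = left_translate G T g (left_translate G T x (h :: ('g, 'k) distribution))"
proof
  fix \<phi>
  show "left_translate G T (g \<otimes> x) h \<phi> = left_translate G T g (left_translate G T x h) \<phi>"
  proof (cases "\<phi> \<in> tests")
    case True
    then show ?thesis using assms by (simp add: left_translate_apply test_left_shift left_shift_left_shift)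
  qed (simp add: left_translate_def extend0_def)
qed

lemma left_right_translate:
  assumes "g \<in> carrier G" "x \<in> carrier G"
  shows "left_translate G T g (right_translate G T x h) = right_translate G T x (left_translate G T g (h :: ('g, 'k) distribution))"
proof
  fix \<phi>
  show "left_translate G T g (right_translate G T x h) \<phi> = right_translate G T x (left_translate G T g h) \<phi>"
  proof (cases "\<phi> \<in> tests")
    case True
    then show ?thesis
      using assms by (simp add: left_translate_apply right_translate_apply test_left_shift test_right_shift left_shift_right_shift)
  qed (simp add: left_translate_def right_translate_def extend0_def)
qed

lemma left_translate_one:
  assumes "h \<in> hecke G T"
  shows "left_translate G T \<one> h = (h :: ('g, 'k) distribution)"
proof
  fix \<phi>
  show "left_translate G T \<one> h \<phi> = h \<phi>"
    using distributionsD(3)[OF hecke_distribution[OF assms]]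
    by (cases "\<phi> \<in> tests") (simp add: left_translate_apply left_shift_one, simp add: left_translate_def extend0_def)
qed

lemma convolution_apply: "\<phi> \<in> tests \<Longrightarrow> convolution G T f h \<phi> = f (slide h \<phi>)"
  by (simp add: convolution_def extend0_def slide_def left_shift_def)

text \<open>Mass \<open>1 / index K\<close> rather than 1, because the Haar measure is normalized on
  \<open>U\<close>; the normalized measure of \<open>K\<close> is \<open>index K\<close> times
  this.\<close>

definition haar_on :: "'g set \<Rightarrow> ('g, 'k) distribution" where
  "haar_on K = density (const_on K (1::'k))"

lemma haar_on_hecke: "small K \<Longrightarrow> haar_on K \<in> hecke G T"
  by (simp add: haar_on_def hecke_eq test_const_on)

lemma haar_on_apply_left_shift:
  assumes K: "small K" and N: "small N" "N \<subseteq> K" "right_invariant G N \<phi>"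
    and phi: "\<phi> \<in> tests" and g: "g \<in> carrier G"
  shows "haar_on K (left_shift G g \<phi>) = (\<Sum>C\<in>lcosets_in G K N. \<phi> (g \<otimes> coset_rep C)) / index N"
proof -
  let ?\<psi> = "\<lambda>x. const_on K 1 x * left_shift G g \<phi> x"
  have KG: "K \<subseteq> carrier G" using K smallD by blast
  have rep: "coset_rep C \<in> K" if "C \<in> lcosets_in G K N" for C
    using small_coset_rep[OF K _ _ that] N by blast
  have "right_invariant G N (const_on K (1::'k))"
    using right_invariant_mono[OF right_invariant_const_on[OF K] N(2)] .
  moreover have "right_invariant G N (left_shift G g \<phi>)"
    using N g small_mem_carrier[OF N(1)]
    by (auto simp: right_invariant_def left_shift_def extend0_def m_assoc[symmetric])
  ultimately have "right_invariant G N ?\<psi>" by (simp add: right_invariant_def)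
  then have "haar ?\<psi> = (\<Sum>C\<in>lcosets_in G K N. ?\<psi> (coset_rep C)) / index N"
  proof (rule haar_eq[OF N(1) _ finite_lcosets[OF K N(1,2)]])
    show "x <# N \<in> lcosets_in G K N" if "?\<psi> x \<noteq> 0" for x
      using that by (auto simp: const_on_def lcosets_in_def split: if_splits)
  qed (use KG in \<open>auto simp: lcosets_in_def\<close>)
  also have "(\<Sum>C\<in>lcosets_in G K N. ?\<psi> (coset_rep C)) = (\<Sum>C\<in>lcosets_in G K N. \<phi> (g \<otimes> coset_rep C))"
    using rep KG by (intro sum.cong) (auto simp: const_on_def left_shift_def extend0_def)
  finally show ?thesis using phi g by (simp add: haar_on_def density_apply test_left_shift)
qed

text \<open>Integration over \<open>K\<close> becomes a finite combination of right shifts of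
  \<open>\<phi>\<close>, so the slide is a test function and distributions can be applied term by
  term.\<close>

lemma slide_haar_on:
  assumes K: "small K" and N: "small N" "N \<subseteq> K" "right_invariant G N \<phi>" and phi: "\<phi> \<in> tests"
  shows "slide (haar_on K) \<phi> = (\<lambda>g. \<Sum>C\<in>lcosets_in G K N. (1 / index N) * right_shift G (coset_rep C) \<phi> g)"
  using haar_on_apply_left_shift[OF assms]
  by (auto simp: slide_def extend0_def right_shift_def fun_eq_iff sum_divide_distrib)

lemma slide_haar_on_test:
  assumes K: "small K" and phi: "\<phi> \<in> tests"
  shows "slide (haar_on K) \<phi> \<in> tests"
proof -
  obtain N0 where N0: "small N0" "right_invariant G N0 \<phi>" using test_right_invariant phi by blast
  define N where "N = N0 \<inter> K"
  have N: "small N" "N \<subseteq> K" "right_invariant G N \<phi>"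
    using N0 K small_Int right_invariant_mono[of N0 \<phi> N] by (auto simp: N_def)
  have rep: "coset_rep C \<in> carrier G" if "C \<in> lcosets_in G K N" for C
    using that coset_rep_closed[of N] small_mem_carrier[OF K] smallD(1)[OF N(1)] by (auto simp: lcosets_in_def)
  show ?thesis
    unfolding slide_haar_on[OF K N phi]
    using rep phi by (intro test_sum finite_lcosets K N test_scale test_right_shift) auto
qed

lemma slide_left_translate:
  assumes x: "x \<in> carrier G" and phi: "\<phi> \<in> tests"
  shows "slide (left_translate G T x h) \<phi> = right_shift G x (slide h \<phi>)"
  using x phi
  by (auto simp: slide_def left_translate_shift extend0_def right_shift_def fun_eq_iff
      test_left_shift left_shift_left_shift)

lemma slide_add: "slide (\<lambda>\<phi>. h \<phi> + h' \<phi>) \<phi> = (\<lambda>g. slide h \<phi> g + slide h' \<phi> g)"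
  by (auto simp: slide_def extend0_def)

lemma slide_scale: "slide (\<lambda>\<phi>. c * h \<phi>) \<phi> = (\<lambda>g. c * slide h \<phi> g)"
  by (auto simp: slide_def extend0_def)

lemma slide_zero: "slide (\<lambda>_. 0) \<phi> = (\<lambda>_. 0)"
  by (auto simp: slide_def extend0_def)

lemma density_const_on_coset:
  assumes x: "x \<in> carrier G" and N: "small N"
  shows "density (const_on (x <# N) c) = (\<lambda>\<phi>. c * left_translate G T x (haar_on N) \<phi>)"
proof -
  have "left_shift G (inv x) (const_on N 1) = left_shift G (inv x) (left_shift G x (const_on (x <# N) (1::'k)))"
    by (simp add: left_shift_const_on_coset[OF x N])
  also have "\<dots> = const_on (x <# N) 1"
    using x test_const_on_coset[OF x N] by (simp add: left_shift_left_shift left_shift_one)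
  finally have "left_translate G T x (haar_on N) = density (const_on (x <# N) 1)"
    using left_translate_density[OF x test_const_on[OF N]] by (simp add: haar_on_def)
  moreover have "const_on (x <# N) c = (\<lambda>y. c * const_on (x <# N) 1 y)" by (auto simp: const_on_def)
  ultimately show ?thesis using density_scale[OF test_const_on_coset[OF x N]] by simp
qed

text \<open>Indicators of cosets are left translates of indicators of subgroups, so
  \<open>H(G)\<close> is spanned by translates of the measures \<open>haar_on N\<close>; equivariant
  linear maps are determined on these.\<close>

lemma hecke_induct [consumes 1, case_names zero add translate]:
  assumes h: "h \<in> hecke G T"
    and zero: "P (\<lambda>_. 0)"
    and add: "\<And>h h'. h \<in> hecke G T \<Longrightarrow> h' \<in> hecke G T \<Longrightarrow> P h \<Longrightarrow> P h' \<Longrightarrow> P (\<lambda>\<phi>. h \<phi> + h' \<phi>)"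
    and translate: "\<And>c x N. x \<in> carrier G \<Longrightarrow> small N \<Longrightarrow> P (\<lambda>\<phi>. c * left_translate G T x (haar_on N) \<phi>)"
  shows "P h"
proof -
  obtain \<theta> where th: "\<theta> \<in> tests" "h = density \<theta>" using h by (auto simp: hecke_eq)
  have "P (density \<theta>)"
    using th(1)
  proof (induction \<theta> rule: test_induct)
    case (add \<theta> \<eta>)
    then show ?case using assms(3)[of "density \<theta>" "density \<eta>"] by (simp add: density_add hecke_eq)
  qed (simp_all add: density_zero zero density_const_on_coset translate)
  then show ?thesis using th by simp
qed

lemma slide_test:
  assumes "h \<in> hecke G T" "\<phi> \<in> tests"
  shows "slide h \<phi> \<in> tests"
  using assms(1)
  by (induction h rule: hecke_induct)
     (simp_all add: slide_zero test_zero slide_add test_add slide_scale slide_left_translate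
       assms(2) test_scale test_right_shift slide_haar_on_test)

lemma convolution_zero: "f \<in> distributions T \<Longrightarrow> convolution G T f (\<lambda>_. 0) = (\<lambda>_. 0::'k)"
  using distribution_zero[of f] slide_zero
  by (auto simp: fun_eq_iff convolution_def extend0_def convolution_apply[unfolded convolution_def])

lemma convolution_add:
  assumes "f \<in> distributions T" "h \<in> hecke G T" "h' \<in> hecke G T"
  shows "convolution G T f (\<lambda>\<phi>. h \<phi> + h' \<phi>) = (\<lambda>\<phi>. convolution G T f h \<phi> + (convolution G T f h' \<phi> :: 'k))"
proof
  fix \<phi>
  show "convolution G T f (\<lambda>\<phi>. h \<phi> + h' \<phi>) \<phi> = convolution G T f h \<phi> + convolution G T f h' \<phi>"
    using assms distributionsD(1)[OF assms(1)]
    by (cases "\<phi> \<in> tests")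
       (simp add: convolution_apply slide_add slide_test, simp add: convolution_def extend0_def)
qed

lemma convolution_scale:
  assumes "f \<in> distributions T" "h \<in> hecke G T"
  shows "convolution G T f (\<lambda>\<phi>. c * h \<phi>) = (\<lambda>\<phi>. c * (convolution G T f h \<phi> :: 'k))"
proof
  fix \<phi>
  show "convolution G T f (\<lambda>\<phi>. c * h \<phi>) \<phi> = c * convolution G T f h \<phi>"
    using assms distributionsD(2)[OF assms(1)]
    by (cases "\<phi> \<in> tests")
       (simp add: convolution_apply slide_scale slide_test, simp add: convolution_def extend0_def)
qed

lemma invariant_distributionsD:
  assumes "f \<in> invariant_distributions G T"
  shows "f \<in> distributions T"
    and "g \<in> carrier G \<Longrightarrow> \<phi> \<in> tests \<Longrightarrow> f (left_shift G g (right_shift G (inv g) \<phi>)) = f \<phi>"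
proof -
  show "f \<in> distributions T" using assms by (simp add: invariant_distributions_def)
  assume g: "g \<in> carrier G" "\<phi> \<in> tests"
  have "left_shift G g (right_shift G (inv g) \<phi>) = extend0 (carrier G) (\<lambda>x. \<phi> (g \<otimes> x \<otimes> inv g))"
    using g by (auto simp: left_shift_def right_shift_def extend0_def fun_eq_iff)
  then show "f (left_shift G g (right_shift G (inv g) \<phi>)) = f \<phi>"
    using assms g by (simp add: invariant_distributions_def)
qed

text \<open>Translating \<open>h\<close> by \<open>x\<close> shifts its slide on the right, whereas
  translating the convolution shifts it on the left. The two shifts differ by a conjugation, to
  which \<open>f\<close> is blind.\<close>

lemma convolution_left_translate:
  assumes f: "f \<in> invariant_distributions G T" and x: "x \<in> carrier G" and h: "h \<in> hecke G T"
  shows "convolution G T f (left_translate G T x h) = left_translate G T x (convolution G T f h :: ('g, 'k) distribution)"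
proof
  fix \<phi>
  show "convolution G T f (left_translate G T x h) \<phi> = left_translate G T x (convolution G T f h) \<phi>"
  proof (cases "\<phi> \<in> tests")
    case True
    have s: "slide h \<phi> \<in> tests" using slide_test h True .
    have "slide h (left_shift G x \<phi>) = left_shift G x (slide h \<phi>)"
    proof
      fix g
      have "left_shift G x (slide h \<phi>) g = (if g \<in> carrier G then slide h \<phi> (x \<otimes> g) else 0)"
        by (simp add: left_shift_def extend0_def)
      then show "slide h (left_shift G x \<phi>) g = left_shift G x (slide h \<phi>) g"
        using x by (simp add: slide_def extend0_def left_shift_left_shift)
    qed
    \<comment> \<open>Inserting a right shift by \<open>x\<close> and its inverse exhibits the
      conjugation.\<close>
    moreover have "left_shift G x (slide h \<phi>) = left_shift G x (right_shift G (inv x) (right_shift G x (slide h \<phi>)))"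
      using x s by (simp add: right_shift_right_shift right_shift_one)
    ultimately have "f (slide h (left_shift G x \<phi>)) = f (right_shift G x (slide h \<phi>))"
      using invariant_distributionsD(2)[OF f x test_right_shift[OF x s]] by simp
    then show ?thesis
      using True x by (simp add: left_translate_apply convolution_apply test_left_shift slide_left_translate)
  qed (simp add: convolution_def left_translate_def extend0_def)
qed

text \<open>For \<open>K\<close>-invariant \<open>\<phi>\<close> the slide is a multiple of
  \<open>\<phi>\<close>, so convolution with \<open>haar_on K\<close> recovers
  \<open>f \<phi>\<close> up to the invertible index. Uniqueness of the distribution of a central
  element rests on this.\<close>

lemma convolution_haar_on:
  assumes f: "f \<in> distributions T" and K: "small K" and phi: "\<phi> \<in> tests" "right_invariant G K \<phi>"
  shows "convolution G T f (haar_on K) \<phi> = f \<phi> / (index K :: 'k)"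
proof -
  have kk: "K = \<one> <# K" using small_one_lcoset[OF K] by simp
  have "lcosets_in G K K = {K}" using lcosets_in_self[OF smallD(1)[OF K]] .
  moreover have "coset_rep K \<in> K" using coset_rep_in[OF smallD(1)[OF K] one_closed] kk by simp
  ultimately have "slide (haar_on K) \<phi> = (\<lambda>g. (1 / index K) * \<phi> g)"
    using slide_haar_on[OF K K _ phi(2,1)] right_shift_invariant[OF phi] by simp
  then show ?thesis using phi distributionsD(2)[OF f phi(1), of "1 / index K"] by (simp add: convolution_apply)
qed

lemma distribution_eqI:
  assumes f: "f \<in> distributions T" "f' \<in> distributions T"
    and eq: "\<And>h. h \<in> hecke G T \<Longrightarrow> convolution G T f h = (convolution G T f' h :: ('g, 'k) distribution)"
  shows "f = f'"
proof
  fix \<phi>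
  show "f \<phi> = f' \<phi>"
  proof (cases "\<phi> \<in> tests")
    case True
    obtain K where K: "small K" "right_invariant G K \<phi>" using test_right_invariant True by blast
    have "f \<phi> / index K = f' \<phi> / index K"
      using convolution_haar_on[OF f(1) K(1) True K(2)] convolution_haar_on[OF f(2) K(1) True K(2)]
        eq[OF haar_on_hecke[OF K(1)]] by metis
    then show ?thesis using index_neq_0[OF K(1)] by simp
  next
    case False
    then show ?thesis using f by (simp add: distributionsD(3))
  qed
qed

end

text \<open>The map \<open>Z\<close> stands for the action of a central element on \<open>H(G)\<close>. It commutes with right
  translations by naturality, since these are endomorphisms of the left module \<open>H(G)\<close>.\<close>

locale central_map = hecke_setup G T U coeff
  for G :: "('g, 'm) monoid_scheme" (structure) and T :: "'g topology"
    and U :: "'g set" and coeff :: "'k::field itself" +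
  fixes Z :: "('g, 'k) distribution \<Rightarrow> ('g, 'k) distribution"
  assumes Z_hecke: "h \<in> hecke G T \<Longrightarrow> Z h \<in> hecke G T"
    and Z_add: "h \<in> hecke G T \<Longrightarrow> h' \<in> hecke G T \<Longrightarrow> Z (\<lambda>\<phi>. h \<phi> + h' \<phi>) = (\<lambda>\<phi>. Z h \<phi> + Z h' \<phi>)"
    and Z_scale: "h \<in> hecke G T \<Longrightarrow> Z (\<lambda>\<phi>. c * h \<phi>) = (\<lambda>\<phi>. c * Z h \<phi>)"
    and Z_left: "g \<in> carrier G \<Longrightarrow> h \<in> hecke G T \<Longrightarrow> Z (left_translate G T g h) = left_translate G T g (Z h)"
    and Z_right: "g \<in> carrier G \<Longrightarrow> h \<in> hecke G T \<Longrightarrow> Z (right_translate G T g h) = right_translate G T g (Z h)"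
begin

lemma Z_zero: "Z (\<lambda>_. 0) = (\<lambda>_. 0)"
  using Z_scale[OF hecke_zero, of 0] by simp

lemma Z_sum:
  assumes "finite I" "\<And>i. i \<in> I \<Longrightarrow> h i \<in> hecke G T"
  shows "Z (\<lambda>\<phi>. \<Sum>i\<in>I. h i \<phi>) = (\<lambda>\<phi>. \<Sum>i\<in>I. Z (h i) \<phi>) \<and> (\<lambda>\<phi>. \<Sum>i\<in>I. h i \<phi>) \<in> hecke G T"
  using assms by (induction I) (simp_all add: Z_zero Z_add hecke_add hecke_zero)

text \<open>Right translation by \<open>k\<close> leaves \<open>haar_on K\<close> unchanged, as the
  modulus is 1 on \<open>U\<close>, and \<open>Z\<close> commutes with this translation.\<close>

lemma Z_haar_on_right_shift:
  assumes "small K" "k \<in> K" "\<phi> \<in> tests"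
  shows "Z (haar_on K) (right_shift G k \<phi>) = Z (haar_on K) \<phi>"
proof -
  have k: "k \<in> U" "k \<in> carrier G" "inv k \<in> K"
    using assms smallD small_mem_carrier by (auto simp: subgroup.m_inv_closed)
  have "right_translate G T k (haar_on K) = haar_on K"
    using right_translate_density_U[OF k(1) test_const_on[OF assms(1)]]
      right_shift_invariant[OF test_const_on[OF assms(1)] right_invariant_const_on[OF assms(1)] k(3)]
    by (simp add: haar_on_def)
  then have "right_translate G T k (Z (haar_on K)) = Z (haar_on K)"
    using Z_right[OF k(2) haar_on_hecke[OF assms(1)]] by simp
  from fun_cong[OF this, of \<phi>] show ?thesis using assms(3) by (simp add: right_translate_def extend0_def)
qed

text \<open>\<open>right_shift G r (const_on N 1)\<close> is the indicator of the right coset of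
  \<open>N\<close> through \<open>inv r\<close>; inversion matches these with the left cosets, so
  they partition \<open>K\<close>. Right translates are wanted because \<open>Z_right\<close>
  applies to them.\<close>

lemma const_on_right_shifts:
  assumes K: "small K" and N: "small N" "N \<subseteq> K"
  shows "const_on K (1::'k) = (\<lambda>y. \<Sum>C\<in>lcosets_in G K N. right_shift G (coset_rep C) (const_on N 1) y)"
proof
  fix y
  have KG: "K \<subseteq> carrier G" using K smallD by blast
  have rep: "coset_rep C \<in> K" "coset_rep C <# N = C" if C: "C \<in> lcosets_in G K N" for C
  proof -
    obtain x where x: "x \<in> K" "C = x <# N" using C by (auto simp: lcosets_in_def)
    show "coset_rep C \<in> K" by (rule small_coset_rep[OF K N C])
    show "coset_rep C <# N = C"
      using x coset_rep_lcoset[OF smallD(1)[OF N(1)] subsetD[OF KG x(1)]] by simp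
  qed
  show "const_on K (1::'k) y = (\<Sum>C\<in>lcosets_in G K N. right_shift G (coset_rep C) (const_on N 1) y)"
  proof (cases "y \<in> K")
    case True
    then have y: "y \<in> carrier G" "inv y \<in> K"
      using subsetD[OF KG] K by (simp_all add: smallD subgroup.m_inv_closed)
    have "y \<otimes> coset_rep C \<in> N \<longleftrightarrow> C = inv y <# N" if "C \<in> lcosets_in G K N" for C
      using lcoset_eq_iff[OF smallD(1)[OF N(1)] inv_closed[OF y(1)], of "coset_rep C"] rep[OF that] KG y by auto
    then have "(\<Sum>C\<in>lcosets_in G K N. right_shift G (coset_rep C) (const_on N 1) y)
        = (\<Sum>C\<in>lcosets_in G K N. if C = inv y <# N then 1 else (0::'k))"
      using y by (intro sum.cong) (auto simp: right_shift_def extend0_def const_on_def)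
    also have "\<dots> = 1" using finite_lcosets[OF K N] y by (simp add: sum.delta lcosets_in_def)
    finally show ?thesis using True by (simp add: const_on_def)
  next
    case False
    have "y \<otimes> r \<notin> N" if "r \<in> K" "y \<in> carrier G" for r
    proof
      assume "y \<otimes> r \<in> N"
      then have "(y \<otimes> r) \<otimes> inv r \<in> K" using that N K by (meson smallD(1) subgroup.m_closed subgroup.m_inv_closed subsetD)
      moreover have "(y \<otimes> r) \<otimes> inv r = y" using that KG by (auto simp: m_assoc subset_iff)
      ultimately show False using False by simp
    qed
    then have "right_shift G (coset_rep C) (const_on N (1::'k)) y = 0" if "C \<in> lcosets_in G K N" for C
      using rep[OF that] by (simp add: right_shift_def extend0_def const_on_def)
    then show ?thesis using False by (simp add: const_on_def)
  qed
qed

text \<open>\<open>haar_on K\<close> is a sum of right translates of \<open>haar_on N\<close>, with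
  which \<open>Z\<close> commutes; on a \<open>K\<close>-invariant \<open>\<phi>\<close> all terms
  agree. Hence the formula for \<open>kernel\<close> does not depend on the subgroup.\<close>

lemma Z_haar_on_refine:
  assumes K: "small K" and N: "small N" "N \<subseteq> K" and phi: "\<phi> \<in> tests" "right_invariant G K \<phi>"
  shows "Z (haar_on K) \<phi> * index K = Z (haar_on N) \<phi> * index N"
proof -
  have KG: "K \<subseteq> carrier G" using K smallD by blast
  have rep: "coset_rep C \<in> K" if "C \<in> lcosets_in G K N" for C
    using small_coset_rep[OF K _ _ that] N by blast
  have repG: "coset_rep C \<in> carrier G" "inv (coset_rep C) \<in> K" "inv (coset_rep C) \<in> U" if "C \<in> lcosets_in G K N" for C
    using subsetD[OF KG rep[OF that]] subgroup.m_inv_closed[OF smallD(1)[OF K] rep[OF that]] smallD(3)[OF K]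
    by auto
  have fin: "finite (lcosets_in G K N)" using finite_lcosets K N by blast
  have "haar_on K = (\<lambda>\<phi>. \<Sum>C\<in>lcosets_in G K N. density (right_shift G (coset_rep C) (const_on N 1)) \<phi>)"
    unfolding haar_on_def
    by (subst const_on_right_shifts[OF K N], rule density_sum[OF fin]) (simp add: repG test_right_shift test_const_on N)
  also have "\<dots> = (\<lambda>\<phi>. \<Sum>C\<in>lcosets_in G K N. right_translate G T (inv (coset_rep C)) (haar_on N) \<phi>)"
    using repG by (simp add: haar_on_def right_translate_density_U test_const_on N)
  finally have "Z (haar_on K) = (\<lambda>\<phi>. \<Sum>C\<in>lcosets_in G K N. Z (right_translate G T (inv (coset_rep C)) (haar_on N)) \<phi>)"
    using Z_sum[OF fin, of "\<lambda>C. right_translate G T (inv (coset_rep C)) (haar_on N)"] repG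
    by (simp add: hecke_right_translate haar_on_hecke N)
  then have "Z (haar_on K) \<phi> = (\<Sum>C\<in>lcosets_in G K N. Z (haar_on N) (right_shift G (inv (coset_rep C)) \<phi>))"
    using repG phi by (simp add: Z_right haar_on_hecke N right_translate_apply)
  also have "\<dots> = (\<Sum>C\<in>lcosets_in G K N. Z (haar_on N) \<phi>)"
    using repG right_shift_invariant[OF phi] by (intro sum.cong) auto
  finally show ?thesis using index_refine[OF K N] by simp
qed

text \<open>A distribution \<open>f\<close> with \<open>f * h = Z h\<close> takes the value \<open>(f * e) \<phi> = Z e \<phi>\<close> at \<open>\<phi>\<close>, where
  \<open>e\<close> is the normalized Haar measure of any \<open>K\<close> fixing \<open>\<phi>\<close> on the right; here
  \<open>e = index K * haar_on K\<close>.\<close>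

definition kernel :: "('g, 'k) distribution" where
  "kernel = extend0 tests (\<lambda>\<phi>. let K = SOME K. small K \<and> right_invariant G K \<phi> in Z (haar_on K) \<phi> * index K)"

lemma kernel_apply:
  assumes K: "small K" "right_invariant G K \<phi>" and phi: "\<phi> \<in> tests"
  shows "kernel \<phi> = Z (haar_on K) \<phi> * index K"
proof -
  define M where "M = (SOME K. small K \<and> right_invariant G K \<phi>)"
  have M: "small M" "right_invariant G M \<phi>"
    using someI[of "\<lambda>K. small K \<and> right_invariant G K \<phi>" K] K by (auto simp: M_def)
  have KM: "small (K \<inter> M)" using small_Int K M by blast
  have "kernel \<phi> = Z (haar_on M) \<phi> * index M" using phi by (simp add: kernel_def extend0_def M_def Let_def)
  also have "\<dots> = Z (haar_on K) \<phi> * index K"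
    using Z_haar_on_refine[OF K(1) KM _ phi K(2)] Z_haar_on_refine[OF M(1) KM _ phi M(2)] by simp
  finally show ?thesis .
qed

lemma kernel_distribution: "kernel \<in> distributions T"
proof -
  have "kernel (\<lambda>x. \<phi> x + \<psi> x) = kernel \<phi> + kernel \<psi>" if t: "\<phi> \<in> tests" "\<psi> \<in> tests" for \<phi> \<psi>
  proof -
    obtain N1 where N1: "small N1" "right_invariant G N1 \<phi>" using test_right_invariant t by blast
    obtain N2 where N2: "small N2" "right_invariant G N2 \<psi>" using test_right_invariant t by blast
    define N where "N = N1 \<inter> N2"
    have N: "small N" "right_invariant G N \<phi>" "right_invariant G N \<psi>" "right_invariant G N (\<lambda>x. \<phi> x + \<psi> x)"
      using N1 N2 small_Int by (auto simp: N_def right_invariant_def)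
    show ?thesis
      using t kernel_apply[OF N(1,2)] kernel_apply[OF N(1,3)] kernel_apply[OF N(1,4)]
        distributionsD(1)[OF hecke_distribution[OF Z_hecke[OF haar_on_hecke[OF N(1)]]]]
      by (simp add: test_add distrib_right)
  qed
  moreover have "kernel (\<lambda>x. c * \<phi> x) = c * kernel \<phi>" if t: "\<phi> \<in> tests" for c \<phi>
  proof -
    obtain N where N: "small N" "right_invariant G N \<phi>" using test_right_invariant t by blast
    then have N': "right_invariant G N (\<lambda>x. c * \<phi> x)" by (simp add: right_invariant_def)
    show ?thesis
      using t kernel_apply[OF N] kernel_apply[OF N(1) N']
        distributionsD(2)[OF hecke_distribution[OF Z_hecke[OF haar_on_hecke[OF N(1)]]] t]
      by (simp add: test_scale)
  qed
  ultimately show ?thesis by (simp add: distributions_def kernel_def extend0_def)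
qed

text \<open>Conjugation turns \<open>K\<close> into \<open>K1\<close>. The index changes by
  \<open>modulus (inv g)\<close> and the translated \<open>haar_on K\<close> by
  \<open>modulus g\<close>; the two factors cancel.\<close>

lemma kernel_conjugate:
  assumes g: "g \<in> carrier G" and phi: "\<phi> \<in> tests"
  shows "kernel (left_shift G g (right_shift G (inv g) \<phi>)) = kernel \<phi>"
proof -
  let ?\<psi> = "left_shift G g (right_shift G (inv g) \<phi>)"
  have g': "inv g \<in> carrier G" using g by simp
  obtain K0 where K0: "small K0" "right_invariant G K0 \<phi>" using test_right_invariant phi by blast
  \<comment> \<open>\<open>K\<close> is shrunk until its conjugate lies in \<open>U\<close>, so that
    \<open>K1\<close> is the full conjugate and \<open>K1_eq\<close> holds.\<close>
  define K where "K = K0 \<inter> {x \<in> U. inv g \<otimes> x \<otimes> inv (inv g) \<in> U}"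
  have K: "small K" using K0 small_Int small_conj[OF g' small_U] by (simp add: K_def)
  have phiK: "right_invariant G K \<phi>" using right_invariant_mono[OF K0(2)] by (simp add: K_def)
  define K1 where "K1 = {x \<in> U. g \<otimes> x \<otimes> inv g \<in> K}"
  have K1: "small K1" using small_conj[OF g K] by (simp add: K1_def)
  have psi: "?\<psi> \<in> tests" using g phi by (simp add: test_left_shift test_right_shift)
  have "\<phi> (g \<otimes> (x \<otimes> n) \<otimes> inv g) = \<phi> (g \<otimes> x \<otimes> inv g)" if x: "x \<in> carrier G" "n \<in> K1" for x n
  proof -
    have n: "n \<in> carrier G" "g \<otimes> n \<otimes> inv g \<in> K" using x small_mem_carrier[OF K1] by (auto simp: K1_def)
    have "inv g \<otimes> (g \<otimes> (n \<otimes> inv g)) = n \<otimes> inv g" using g n by (simp add: m_assoc[symmetric])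
    then have "g \<otimes> (x \<otimes> n) \<otimes> inv g = (g \<otimes> x \<otimes> inv g) \<otimes> (g \<otimes> n \<otimes> inv g)"
      using x n g by (simp add: m_assoc)
    then show ?thesis using phiK n x g by (simp add: right_invariant_def)
  qed
  then have psiK1: "right_invariant G K1 ?\<psi>"
    using g small_mem_carrier[OF K1]
    by (auto simp: right_invariant_def left_shift_def right_shift_def extend0_def)
  have K1_eq: "const_on K1 (1::'k) = left_shift G g (right_shift G (inv g) (const_on K 1))"
  proof
    fix y
    have "y \<in> K1 \<longleftrightarrow> g \<otimes> y \<otimes> inv g \<in> K" if y: "y \<in> carrier G"
    proof -
      have "inv g \<otimes> (g \<otimes> y \<otimes> inv g) \<otimes> g = y"
      proof -
        have "inv g \<otimes> (g \<otimes> y) = y" using g y by (simp add: m_assoc[symmetric])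
        then show ?thesis using g y by (simp add: m_assoc)
      qed
      then show ?thesis using g by (auto simp: K1_def K_def)
    qed
    moreover have "y \<notin> K1" if "y \<notin> carrier G" using that small_mem_carrier[OF K1] by blast
    ultimately show "const_on K1 (1::'k) y = left_shift G g (right_shift G (inv g) (const_on K 1)) y"
      using g by (auto simp: const_on_def left_shift_def right_shift_def extend0_def)
  qed
  have t1: "const_on K (1::'k) \<in> tests" "right_shift G (inv g) (const_on K (1::'k)) \<in> tests"
    using test_const_on[OF K] g by (auto simp: test_right_shift)
  have t2: "const_on K1 (1::'k) \<in> tests" using test_const_on[OF K1] .
  have "1 / index K1 = haar (const_on K1 1)" using haar_const_on[OF K1] by simp
  also have "\<dots> = modulus (inv g) * (1 / index K)"
    using haar_left_shift[OF g t1(2)] haar_right_shift[OF g' t1(1)] haar_const_on[OF K] K1_eq by simp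
  finally have idx: "index K = modulus (inv g) * index K1"
    using index_neq_0[OF K] index_neq_0[OF K1] by (simp add: field_simps)
  \<comment> \<open>The conjugate of the measure \<open>haar_on K\<close> is a multiple of
    \<open>haar_on K1\<close>; \<open>Z\<close>, commuting with both translations, respects this
    relation.\<close>
  have "left_translate G T (inv g) (right_translate G T g (haar_on K))
      = left_translate G T (inv g) (density (\<lambda>x. modulus g * right_shift G (inv g) (const_on K 1) x))"
    by (simp add: haar_on_def right_translate_density[OF g t1(1)])
  also have "\<dots> = density (left_shift G g (\<lambda>x. modulus g * right_shift G (inv g) (const_on K 1) x))"
    using left_translate_density[OF g' test_scale[OF t1(2)]] g by simp
  also have "left_shift G g (\<lambda>x. modulus g * right_shift G (inv g) (const_on K 1) x) = (\<lambda>x. modulus g * const_on K1 1 x)"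
    unfolding K1_eq by (auto simp: left_shift_def extend0_def)
  also have "density \<dots> = (\<lambda>\<phi>. modulus g * haar_on K1 \<phi>)"
    using density_scale[OF t2] by (simp add: haar_on_def)
  finally have "left_translate G T (inv g) (right_translate G T g (Z (haar_on K))) = (\<lambda>\<phi>. modulus g * Z (haar_on K1) \<phi>)"
    using Z_left[OF g' hecke_right_translate[OF g haar_on_hecke[OF K]]] Z_right[OF g haar_on_hecke[OF K]]
      Z_scale[OF haar_on_hecke[OF K1], of "modulus g"] by simp
  from fun_cong[OF this, of ?\<psi>] have "modulus g * Z (haar_on K1) ?\<psi> = Z (haar_on K) (right_shift G g (left_shift G (inv g) ?\<psi>))"
    using psi g by (simp add: left_translate_apply right_translate_apply test_left_shift)
  also have "right_shift G g (left_shift G (inv g) ?\<psi>) = \<phi>"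
    using g phi by (simp add: left_shift_left_shift left_shift_one right_shift_right_shift right_shift_one test_right_shift)
  finally have *: "modulus g * Z (haar_on K1) ?\<psi> = Z (haar_on K) \<phi>" .
  have "kernel \<phi> = (modulus g * modulus (inv g)) * (Z (haar_on K1) ?\<psi> * index K1)"
    using kernel_apply[OF K phiK phi] idx by (simp add: *[symmetric] mult_ac)
  also have "\<dots> = kernel ?\<psi>" using kernel_apply[OF K1 psiK1 psi] modulus_inverse[OF g] by simp
  finally show ?thesis by simp
qed

lemma kernel_invariant: "kernel \<in> invariant_distributions G T"
proof -
  have "left_shift G g (right_shift G (inv g) \<phi>) = extend0 (carrier G) (\<lambda>x. \<phi> (g \<otimes> x \<otimes> inv g))"
    if "g \<in> carrier G" for g and \<phi> :: "'g \<Rightarrow> 'k"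
    using that by (auto simp: left_shift_def right_shift_def extend0_def fun_eq_iff)
  then show ?thesis using kernel_distribution kernel_conjugate by (simp add: invariant_distributions_def)
qed

text \<open>The slide is \<open>K\<close>-invariant even if \<open>\<phi>\<close> is not, so
  \<open>kernel\<close> can be evaluated on it with \<open>K\<close> itself.
  \<open>Z (haar_on K)\<close> does not see the right shifts by \<open>K\<close> that make up the
  slide.\<close>

lemma convolution_kernel_haar_on:
  assumes K: "small K"
  shows "convolution G T kernel (haar_on K) = Z (haar_on K)"
proof
  fix \<phi>
  show "convolution G T kernel (haar_on K) \<phi> = Z (haar_on K) \<phi>"
  proof (cases "\<phi> \<in> tests")
    case False
    then show ?thesis
      using distributionsD(3)[OF hecke_distribution[OF Z_hecke[OF haar_on_hecke[OF K]]]]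
      by (simp add: convolution_def extend0_def)
  next
    case phi: True
    obtain N0 where N0: "small N0" "right_invariant G N0 \<phi>" using test_right_invariant phi by blast
    define N where "N = N0 \<inter> K"
    have N: "small N" "N \<subseteq> K" "right_invariant G N \<phi>"
      using N0 K small_Int right_invariant_mono[of N0 \<phi> N] by (auto simp: N_def)
    have rep: "coset_rep C \<in> K" if "C \<in> lcosets_in G K N" for C
      using small_coset_rep[OF K _ _ that] N by blast
    have repG: "coset_rep C \<in> carrier G" if "C \<in> lcosets_in G K N" for C
      using rep[OF that] small_mem_carrier[OF K] by blast
    have fin: "finite (lcosets_in G K N)" using finite_lcosets K N by blast
    let ?\<psi> = "slide (haar_on K) \<phi>"
    have t: "\<And>x. x \<in> carrier G \<Longrightarrow> left_shift G x \<phi> \<in> tests" using phi test_left_shift by blast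
    \<comment> \<open>Left invariance of \<open>haar_on K\<close> under \<open>K\<close> becomes
      right invariance of the slide.\<close>
    have "haar_on K (left_shift G (g \<otimes> k) \<phi>) = haar_on K (left_shift G g \<phi>)" if "g \<in> carrier G" "k \<in> K" for g k
    proof -
      have k: "k \<in> carrier G" "inv k \<in> K"
        using that small_mem_carrier[OF K] K by (auto simp: smallD subgroup.m_inv_closed)
      have "left_shift G (inv k) (const_on K (1::'k)) = const_on K 1"
      proof
        fix y
        have "inv k \<otimes> y \<in> K \<longleftrightarrow> y \<in> K" if "y \<in> carrier G"
          using that k K \<open>k \<in> K\<close> mem_lcoset_iff[OF smallD(1)[OF K] k(1) that] small_one_lcoset[OF K]
            lcoset_eq_iff[OF smallD(1)[OF K] one_closed k(1)] by (simp add: smallD)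
        then show "left_shift G (inv k) (const_on K (1::'k)) y = const_on K 1 y"
          using small_mem_carrier[OF K] by (auto simp: left_shift_def extend0_def const_on_def)
      qed
      then have "left_translate G T k (haar_on K) = haar_on K"
        using left_translate_density[OF k(1) test_const_on[OF K]] by (simp add: haar_on_def)
      from fun_cong[OF this, of "left_shift G g \<phi>"] show ?thesis
        using that k t by (simp add: left_translate_apply left_shift_left_shift)
    qed
    then have inv: "right_invariant G K ?\<psi>"
      using small_mem_carrier[OF K] by (simp add: right_invariant_def slide_def extend0_def)
    have psi: "?\<psi> \<in> tests" using slide_haar_on_test K phi .
    have hd: "Z (haar_on K) \<in> distributions T" using hecke_distribution[OF Z_hecke[OF haar_on_hecke[OF K]]] .
    have "Z (haar_on K) ?\<psi> = (\<Sum>C\<in>lcosets_in G K N. Z (haar_on K) (\<lambda>g. (1 / index N) * right_shift G (coset_rep C) \<phi> g))"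
      unfolding slide_haar_on[OF K N phi]
      by (rule distribution_sum[OF hd fin], rule test_scale, rule test_right_shift[OF repG phi])
    also have "\<dots> = (\<Sum>C\<in>lcosets_in G K N. (1 / index N) * Z (haar_on K) \<phi>)"
    proof (rule sum.cong)
      fix C assume C: "C \<in> lcosets_in G K N"
      have "Z (haar_on K) (\<lambda>g. (1 / index N) * right_shift G (coset_rep C) \<phi> g)
          = (1 / index N) * Z (haar_on K) (right_shift G (coset_rep C) \<phi>)"
        by (rule distributionsD(2)[OF hd test_right_shift[OF repG[OF C] phi]])
      then show "Z (haar_on K) (\<lambda>g. (1 / index N) * right_shift G (coset_rep C) \<phi> g) = (1 / index N) * Z (haar_on K) \<phi>"
        using Z_haar_on_right_shift[OF K rep[OF C] phi] by simp
    qed simp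
    also have "\<dots> * index K = Z (haar_on K) \<phi>"
      using index_refine[OF K N(1,2)] index_neq_0[OF K] index_nonzero[OF K N(1,2)] by simp
    finally show ?thesis using kernel_apply[OF K inv psi] phi by (simp add: convolution_apply)
  qed
qed

text \<open>Both sides are linear and commute with left translations, so the case of
  \<open>haar_on N\<close> suffices.\<close>

lemma convolution_kernel:
  assumes "h \<in> hecke G T"
  shows "convolution G T kernel h = Z h"
  using assms
proof (induction h rule: hecke_induct)
  case zero
  then show ?case using convolution_zero[OF kernel_distribution] Z_zero by simp
next
  case (add h h')
  then show ?case by (simp add: convolution_add[OF kernel_distribution] Z_add)
next
  case (translate c x N)
  then show ?case
    by (simp add: convolution_scale[OF kernel_distribution] Z_scale hecke_left_translate haar_on_hecke
        convolution_left_translate[OF kernel_invariant] convolution_kernel_haar_on Z_left)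
qed

text \<open>Gives meaning to the definite description in \<open>center_distribution\<close>.\<close>

lemma ex1_kernel: "\<exists>!f. f \<in> invariant_distributions G T \<and> (\<forall>h\<in>hecke G T. convolution G T f h = Z h)"
proof (rule ex1I)
  show "kernel \<in> invariant_distributions G T \<and> (\<forall>h\<in>hecke G T. convolution G T kernel h = Z h)"
    using kernel_invariant convolution_kernel by blast
  fix f assume f: "f \<in> invariant_distributions G T \<and> (\<forall>h\<in>hecke G T. convolution G T f h = Z h)"
  show "f = kernel"
  proof (rule distribution_eqI)
    show "f \<in> distributions T" using f invariant_distributionsD(1) by blast
    show "kernel \<in> distributions T" by (rule kernel_distribution)
    show "convolution G T f h = convolution G T kernel h" if "h \<in> hecke G T" for h
      using f that convolution_kernel by simp
  qed
qed

end

section \<open>Characters of open compact subgroups\<close>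

context hecke_setup
begin

text \<open>\<open>K\<close> is open and closed, so functions on \<open>K\<close> extended by 0 stay
  locally constant; integration over \<open>K\<close> can thus be done inside
  \<open>G\<close>.\<close>

lemma sub_test_iff:
  assumes K: "small K"
  shows "\<phi> \<in> test_functions (subtopology T K) \<longleftrightarrow> \<phi> \<in> tests \<and> (\<forall>x. x \<notin> K \<longrightarrow> \<phi> x = 0)"
proof -
  have KG: "K \<subseteq> carrier G" and opK: "openin T K" using K smallD by auto
  have clK: "closedin T K" using K open_subgroup_closed smallD by blast
  have top: "topspace (subtopology T K) = K" using KG by (auto simp: topspace_eq)
  show ?thesis
  proof
    assume phi: "\<phi> \<in> test_functions (subtopology T K)"
    then have out: "\<phi> x = 0" if "x \<notin> K" for x using that unfolding test_functions_def top by blast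
    have "\<exists>W. openin T W \<and> x \<in> W \<and> (\<forall>y\<in>W. \<phi> y = \<phi> x)" if x: "x \<in> carrier G" for x
    proof (cases "x \<in> K")
      case True
      have "\<forall>x\<in>K. \<exists>W. openin (subtopology T K) W \<and> x \<in> W \<and> (\<forall>y\<in>W. \<phi> y = \<phi> x)"
        using phi unfolding test_functions_def top by blast
      with True show ?thesis using openin_open_subtopology[OF opK] by blast
    next
      case False
      have "openin T (topspace T - K)" using clK by blast
      with False x show ?thesis
        by (intro exI[of _ "topspace T - K"]) (auto simp: topspace_eq out)
    qed
    moreover have "compactin T (T closure_of {x \<in> topspace T. \<phi> x \<noteq> 0})"
    proof (rule closed_compactin[OF small_compact[OF K]])
      show "T closure_of {x \<in> topspace T. \<phi> x \<noteq> 0} \<subseteq> K"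
        using clK out by (intro closure_of_minimal) auto
    qed simp
    ultimately show "\<phi> \<in> tests \<and> (\<forall>x. x \<notin> K \<longrightarrow> \<phi> x = 0)"
      using out KG by (auto simp: test_functions_def topspace_eq)
  next
    assume phi: "\<phi> \<in> tests \<and> (\<forall>x. x \<notin> K \<longrightarrow> \<phi> x = 0)"
    have "\<exists>W. openin (subtopology T K) W \<and> x \<in> W \<and> (\<forall>y\<in>W. \<phi> y = \<phi> x)" if x: "x \<in> K" for x
    proof -
      have "\<forall>x\<in>carrier G. \<exists>W. openin T W \<and> x \<in> W \<and> (\<forall>y\<in>W. \<phi> y = \<phi> x)"
        using phi by (simp add: test_functions_def topspace_eq)
      then obtain W where W: "openin T W" "x \<in> W" "\<forall>y\<in>W. \<phi> y = \<phi> x" using x KG by blast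
      have "openin (subtopology T K) (K \<inter> W)" using W opK by (auto simp: openin_open_subtopology)
      with W x show ?thesis by blast
    qed
    moreover have "compactin (subtopology T K) (subtopology T K closure_of {x \<in> K. \<phi> x \<noteq> 0})"
      using small_compact[OF K] by (intro closedin_compact_space) (auto simp: compact_space_subtopology)
    ultimately show "\<phi> \<in> test_functions (subtopology T K)"
      using phi unfolding test_functions_def top by blast
  qed
qed

text \<open>The argument of \<open>left_invariant_unique\<close> inside \<open>K\<close>, where only
  translations by \<open>K\<close> are available.\<close>

lemma sub_measure_eq:
  assumes K: "small K"
    and nu: "\<nu> \<in> left_invariant_measures (G\<lparr>carrier := K\<rparr>) (subtopology T K)"
    and one: "\<nu> (const_on K 1) = (1::'k)"
    and phi: "\<phi> \<in> test_functions (subtopology T K)"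
    and N: "small N" "N \<subseteq> K" "right_invariant G N \<phi>"
  shows "\<nu> \<phi> = (\<Sum>C\<in>lcosets_in G K N. \<phi> (coset_rep C)) / of_nat (card (lcosets_in G K N))"
proof -
  let ?S = "test_functions (subtopology T K) :: ('g \<Rightarrow> 'k) set"
  have KG: "K \<subseteq> carrier G" using K smallD by blast
  have nud: "\<nu> \<in> distributions (subtopology T K)" using nu by (simp add: left_invariant_measures_def)
  \<comment> \<open>\<open>\<nu>\<close> extended to a distribution on \<open>G\<close>, so that
    \<open>distribution_sum\<close> applies; it agrees with \<open>\<nu>\<close> on functions
    supported in \<open>K\<close>.\<close>
  define \<nu>' where "\<nu>' = extend0 tests (\<lambda>\<phi>. \<nu> (\<lambda>x. const_on K 1 x * \<phi> x))"
  have S: "(\<lambda>x. const_on K 1 x * \<phi> x) \<in> ?S" if "\<phi> \<in> tests" for \<phi>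
    using that K by (simp add: sub_test_iff test_mult test_const_on) (simp add: const_on_def)
  have nu': "\<nu>' \<in> distributions T"
    using distributionsD[OF nud] S
    by (auto simp: \<nu>'_def distributions_def extend0_def test_add test_scale distrib_left mult.left_commute)
  have restr: "\<nu>' \<phi> = \<nu> \<phi>" if "\<phi> \<in> ?S" for \<phi>
  proof -
    have "(\<lambda>x. const_on K 1 x * \<phi> x) = \<phi>" using that K by (auto simp: sub_test_iff const_on_def fun_eq_iff)
    then show ?thesis using that K by (simp add: \<nu>'_def extend0_def sub_test_iff)
  qed
  have cosetK: "const_on C c \<in> tests \<and> const_on C c \<in> ?S \<and> \<nu> (const_on C c) = c * \<nu> (const_on N 1)"
    if C: "C \<in> lcosets_in G K N" for C c
  proof -
    obtain x where x: "x \<in> K" "C = x <# N" using C by (auto simp: lcosets_in_def)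
    have xG: "x \<in> carrier G" using x KG by blast
    have CK: "C \<subseteq> K" using x K N(2) by (auto simp: l_coset_def smallD subgroup.m_closed subset_iff)
    have t: "const_on C c \<in> tests" using x xG N test_const_on_coset by simp
    moreover have "const_on C c \<in> ?S" using t CK K by (auto simp: sub_test_iff const_on_def)
    moreover have "const_on N (1::'k) \<in> ?S" using test_const_on[OF N(1)] K N(2) by (auto simp: sub_test_iff const_on_def)
    moreover have "extend0 K (\<lambda>y. const_on C c (x \<otimes> y)) = const_on N c"
    proof
      fix y
      have "x \<otimes> y \<in> C \<longleftrightarrow> y \<in> N" if "y \<in> K"
      proof -
        have "y \<in> carrier G" using that KG by blast
        then show ?thesis using xG x N by (simp add: mem_lcoset_iff smallD m_assoc[symmetric])
      qed
      then show "extend0 K (\<lambda>y. const_on C c (x \<otimes> y)) y = const_on N c y"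
        using N(2) by (auto simp: extend0_def const_on_def)
    qed
    then have "\<nu> (const_on C c) = \<nu> (const_on N c)"
      using nu x(1) \<open>const_on C c \<in> ?S\<close> by (fastforce simp: left_invariant_measures_def)
    moreover have "const_on N c = (\<lambda>y. c * const_on N 1 y)" by (auto simp: const_on_def)
    ultimately show ?thesis using distributionsD(2)[OF nud, of "const_on N 1" c] by simp
  qed
  have fin: "finite (lcosets_in G K N)" using finite_lcosets K N by blast
  have S1: "const_on K (1::'k) \<in> ?S" using test_const_on[OF K] K by (auto simp: sub_test_iff const_on_def)
  have "\<nu> (const_on K 1) = \<nu>' (\<lambda>y. \<Sum>C\<in>lcosets_in G K N. const_on C 1 y)"
    using restr[OF S1] const_on_partition[OF K N(1,2), of "1::'k"] by simp
  also have "\<dots> = (\<Sum>C\<in>lcosets_in G K N. \<nu> (const_on N 1))"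
  proof (subst distribution_sum[OF nu' fin])
    show "const_on C (1::'k) \<in> tests" if "C \<in> lcosets_in G K N" for C using cosetK[OF that] by blast
    show "(\<Sum>C\<in>lcosets_in G K N. \<nu>' (const_on C 1)) = (\<Sum>C\<in>lcosets_in G K N. \<nu> (const_on N 1))"
      by (rule sum.cong) (simp_all add: cosetK restr)
  qed
  finally have nuN: "of_nat (card (lcosets_in G K N)) * \<nu> (const_on N 1) = 1" using one by simp
  have dec: "\<phi> y = (\<Sum>C\<in>lcosets_in G K N. const_on C (\<phi> (coset_rep C)) y)" for y
  proof (cases "y \<in> K")
    case True
    then have "y \<in> carrier G" using KG by blast
    then show ?thesis
      using True KG by (intro right_invariant_decomp[OF N(1,3) _ fin]) (auto simp: lcosets_in_def)
  next
    case False
    have "const_on C c y = 0" if "C \<in> lcosets_in G K N" for C and c :: 'k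
      using cosetK[OF that, of 1] False K by (auto simp: sub_test_iff const_on_def)
    then show ?thesis using False phi K by (simp add: sub_test_iff)
  qed
  have "\<nu> \<phi> = \<nu>' (\<lambda>y. \<Sum>C\<in>lcosets_in G K N. const_on C (\<phi> (coset_rep C)) y)"
    by (subst ext[OF dec, symmetric], rule restr[OF phi, symmetric])
  also have "\<dots> = (\<Sum>C\<in>lcosets_in G K N. \<phi> (coset_rep C) * \<nu> (const_on N 1))"
  proof (subst distribution_sum[OF nu' fin])
    show "const_on C (\<phi> (coset_rep C)) \<in> tests" if "C \<in> lcosets_in G K N" for C using cosetK[OF that] by blast
    show "(\<Sum>C\<in>lcosets_in G K N. \<nu>' (const_on C (\<phi> (coset_rep C)))) = (\<Sum>C\<in>lcosets_in G K N. \<phi> (coset_rep C) * \<nu> (const_on N 1))"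
      by (rule sum.cong) (simp_all add: cosetK restr)
  qed
  also have "\<dots> = (\<Sum>C\<in>lcosets_in G K N. \<phi> (coset_rep C)) * \<nu> (const_on N 1)"
    by (simp add: sum_distrib_right)
  also have "\<dots> = (\<Sum>C\<in>lcosets_in G K N. \<phi> (coset_rep C)) / of_nat (card (lcosets_in G K N))"
    using nuN index_nonzero[OF K N(1,2)] by (simp add: field_simps)
  finally show ?thesis .
qed

text \<open>\<open>haar\<close> gives \<open>K\<close> mass \<open>1 / index K\<close>, whence the
  factor \<open>index K\<close>. \<open>sub_measure_eq\<close> supplies the uniqueness that the
  definite description requires.\<close>

lemma normalized_haar_eq:
  assumes K: "small K"
  shows "normalized_haar (G\<lparr>carrier := K\<rparr>) (subtopology T K)
    = extend0 (test_functions (subtopology T K)) (\<lambda>\<phi>. haar \<phi> * index K)"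
    (is "_ = ?\<nu>")
proof -
  have KG: "K \<subseteq> carrier G" using K smallD by blast
  have ext: "extend0 K (\<lambda>_. 1::'k) = const_on K 1" by (auto simp: extend0_def const_on_def)
  have shift: "extend0 K (\<lambda>x. \<phi> (g \<otimes> x)) = left_shift G g \<phi>"
    if "g \<in> K" "\<phi> \<in> test_functions (subtopology T K)" for g and \<phi> :: "'g \<Rightarrow> 'k"
  proof
    fix x
    have g: "g \<in> carrier G" "inv g \<in> K"
      using subsetD[OF KG that(1)] that(1) K by (simp_all add: smallD subgroup.m_inv_closed)
    have "g \<otimes> x \<notin> K" if x: "x \<in> carrier G" "x \<notin> K"
    proof
      assume "g \<otimes> x \<in> K"
      then have "inv g \<otimes> (g \<otimes> x) \<in> K" using g K by (simp add: smallD subgroup.m_closed)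
      then show False using x g by (simp add: m_assoc[symmetric])
    qed
    then show "extend0 K (\<lambda>x. \<phi> (g \<otimes> x)) x = left_shift G g \<phi> x"
      using that KG K by (auto simp: extend0_def left_shift_def sub_test_iff)
  qed
  have nu: "?\<nu> \<in> left_invariant_measures (G\<lparr>carrier := K\<rparr>) (subtopology T K)"
  proof -
    have "left_shift G g \<phi> \<in> test_functions (subtopology T K)"
      if g: "g \<in> K" "\<phi> \<in> test_functions (subtopology T K)" for g and \<phi> :: "'g \<Rightarrow> 'k"
      using that shift[OF that] KG K test_left_shift[of g \<phi>]
      by (auto simp: sub_test_iff) (metis extend0_def)
    moreover have "haar (left_shift G g \<phi>) = haar \<phi>"
      if "g \<in> K" "\<phi> \<in> test_functions (subtopology T K)" for g and \<phi> :: "'g \<Rightarrow> 'k"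
      using that KG K haar_left_shift by (auto simp: sub_test_iff)
    ultimately show ?thesis
      using K by (auto simp: left_invariant_measures_def distributions_def shift extend0_def[of "test_functions _"]
          sub_test_iff test_add test_scale haar_add haar_scale distrib_right)
  qed
  have S1: "const_on K (1::'k) \<in> test_functions (subtopology T K)"
    using test_const_on[OF K] K by (auto simp: sub_test_iff const_on_def)
  have one: "?\<nu> (const_on K 1) = 1"
    using S1 haar_const_on[OF K] index_neq_0[OF K] by (simp add: extend0_def)
  show ?thesis
    unfolding normalized_haar_def
  proof (rule the_equality)
    show "?\<nu> \<in> left_invariant_measures (G\<lparr>carrier := K\<rparr>) (subtopology T K)
        \<and> ?\<nu> (extend0 (carrier (G\<lparr>carrier := K\<rparr>)) (\<lambda>_. 1)) = 1"
      using nu one ext by simp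
  next
    fix \<nu> :: "('g, 'k) distribution"
    assume *: "\<nu> \<in> left_invariant_measures (G\<lparr>carrier := K\<rparr>) (subtopology T K)
        \<and> \<nu> (extend0 (carrier (G\<lparr>carrier := K\<rparr>)) (\<lambda>_. 1)) = 1"
    show "\<nu> = ?\<nu>"
    proof
      fix \<phi>
      show "\<nu> \<phi> = ?\<nu> \<phi>"
      proof (cases "\<phi> \<in> test_functions (subtopology T K)")
        case True
        then obtain N0 where N0: "small N0" "right_invariant G N0 \<phi>"
          using test_right_invariant K by (auto simp: sub_test_iff)
        define N where "N = N0 \<inter> K"
        have N: "small N" "N \<subseteq> K" "right_invariant G N \<phi>"
          using N0 K small_Int right_invariant_mono[of N0 \<phi> N] by (auto simp: N_def)
        show ?thesis
          using sub_measure_eq[OF K _ _ True N, of \<nu>] sub_measure_eq[OF K nu one True N] * ext by simp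
      next
        case False
        then show ?thesis
          using * by (auto simp: left_invariant_measures_def distributions_def extend0_def)
      qed
    qed
  qed
qed

lemma character_measure_eq:
  assumes K: "small K"
    and th: "extend0 K (\<lambda>u. of_nat (vector_space.dim scl (vectors \<rho>)) * trace_on scl (vectors \<rho>) (action \<rho> u)) \<in> tests"
      (is "?\<theta> \<in> _")
  shows "character_measure G T scl K \<rho> = density (\<lambda>x. index K * ?\<theta> x)"
proof
  fix \<phi>
  show "character_measure G T scl K \<rho> \<phi> = density (\<lambda>x. index K * ?\<theta> x) \<phi>"
  proof (cases "\<phi> \<in> tests")
    case True
    have eq: "extend0 K (\<lambda>u. of_nat (vector_space.dim scl (vectors \<rho>)) * trace_on scl (vectors \<rho>) (action \<rho> u) * \<phi> u)
        = (\<lambda>x. ?\<theta> x * \<phi> x)" (is "?l = _")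
      by (auto simp: extend0_def)
    have t: "(\<lambda>x. ?\<theta> x * \<phi> x) \<in> tests" using th True by (rule test_mult)
    moreover have "(\<lambda>x. ?\<theta> x * \<phi> x) \<in> test_functions (subtopology T K)"
      using t K by (simp add: sub_test_iff) (simp add: extend0_def)
    ultimately have "character_measure G T scl K \<rho> \<phi> = haar (\<lambda>x. ?\<theta> x * \<phi> x) * index K"
      unfolding character_measure_def normalized_haar_eq[OF K] using True eq
      by (simp add: extend0_def[of "test_functions _"])
    also have "\<dots> = haar (\<lambda>x. index K * (?\<theta> x * \<phi> x))" using haar_scale[OF t] by simp
    finally show ?thesis using True by (simp add: density_apply mult.assoc)
  qed (simp add: character_measure_def density_def extend0_def)
qed

end

section \<open>Smooth representations, traces and averages of characters\<close>

locale smooth_rep = vector_space scl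
  for scl :: "'k::field \<Rightarrow> 'v \<Rightarrow> 'v::ab_group_add" +
  fixes G :: "('g, 'm) monoid_scheme" and T :: "'g topology" and \<pi> :: "('g, 'v) group_rep"
  assumes smooth: "\<pi> \<in> smooth_reps G T scl"
begin

lemma subspace_vectors: "subspace (vectors \<pi>)"
  using smooth by (simp add: smooth_reps_def)

lemma action_linear: "g \<in> carrier G \<Longrightarrow> linear_between scl (vectors \<pi>) (vectors \<pi>) (action \<pi> g)"
  using smooth by (simp add: smooth_reps_def)

lemma action_closed: "g \<in> carrier G \<Longrightarrow> v \<in> vectors \<pi> \<Longrightarrow> action \<pi> g v \<in> vectors \<pi>"
  and action_add: "g \<in> carrier G \<Longrightarrow> v \<in> vectors \<pi> \<Longrightarrow> w \<in> vectors \<pi> \<Longrightarrow> action \<pi> g (v + w) = action \<pi> g v + action \<pi> g w"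
  and action_scale: "g \<in> carrier G \<Longrightarrow> v \<in> vectors \<pi> \<Longrightarrow> action \<pi> g (scl c v) = scl c (action \<pi> g v)"
  using action_linear by (auto simp: linear_between_def)

lemma action_mult:
  "g \<in> carrier G \<Longrightarrow> h \<in> carrier G \<Longrightarrow> v \<in> vectors \<pi> \<Longrightarrow> action \<pi> (g \<otimes>\<^bsub>G\<^esub> h) v = action \<pi> g (action \<pi> h v)"
  using smooth by (simp add: smooth_reps_def)

lemma action_one: "v \<in> vectors \<pi> \<Longrightarrow> action \<pi> \<one>\<^bsub>G\<^esub> v = v"
  using smooth by (simp add: smooth_reps_def)

lemma stabilizer_open: "v \<in> vectors \<pi> \<Longrightarrow> openin T {g \<in> carrier G. action \<pi> g v = v}"
  using smooth by (simp add: smooth_reps_def)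

lemma action_zero: "g \<in> carrier G \<Longrightarrow> action \<pi> g 0 = 0"
  using action_scale[of g 0 0] subspace_0[OF subspace_vectors] by simp

lemma action_sum:
  assumes "g \<in> carrier G" "\<And>i. i \<in> I \<Longrightarrow> v i \<in> vectors \<pi>"
  shows "action \<pi> g (\<Sum>i\<in>I. v i) = (\<Sum>i\<in>I. action \<pi> g (v i))"
  using assms(2)
  by (induction I rule: infinite_finite_induct)
     (simp_all add: action_zero assms(1) action_add subspace_sum[OF subspace_vectors])

end

text \<open>The basis chosen in \<open>trace_on\<close> depends on \<open>V\<close> only, so one
  basis serves all endomorphisms and their traces can be compared and added.\<close>

lemma (in vector_space) trace_on_basis:
  assumes V: "subspace V"
  obtains B where "independent B" "span B = V"
    "\<And>f. trace_on scale V f = (\<Sum>b\<in>B. representation B (f b) b)"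
proof -
  define B where "B = (SOME B. independent B \<and> span B = V)"
  obtain B0 where "independent B0" "span B0 = V"
    using maximal_independent_subset[of V] span_minimal[OF _ V] by (metis subset_antisym)
  then have B: "independent B" "span B = V"
    using someI[of "\<lambda>B. independent B \<and> span B = V" B0] by (auto simp: B_def)
  then show ?thesis using that by (simp add: trace_on_def B_def Let_def)
qed

lemma (in vector_space) trace_on_sum_zero:
  assumes V: "subspace V" and f: "\<And>i b. i \<in> I \<Longrightarrow> b \<in> V \<Longrightarrow> f i b \<in> V"
    and zero: "\<And>b. b \<in> V \<Longrightarrow> (\<Sum>i\<in>I. f i b) = 0"
  shows "(\<Sum>i\<in>I. trace_on scale V (f i)) = 0"
proof -
  obtain B where B: "independent B" "span B = V"
      and tr: "\<And>f. trace_on scale V f = (\<Sum>b\<in>B. representation B (f b) b)"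
    using trace_on_basis[OF V] by metis
  have "(\<Sum>i\<in>I. trace_on scale V (f i)) = (\<Sum>b\<in>B. \<Sum>i\<in>I. representation B (f i b) b)"
    by (subst sum.swap) (simp add: tr)
  also have "\<dots> = 0"
  proof (rule sum.neutral, rule ballI)
    fix b assume "b \<in> B"
    then have b: "b \<in> V" using B span_base by blast
    have "(\<Sum>i\<in>I. representation B (f i b) b) = representation B (\<Sum>i\<in>I. f i b) b"
      using B f b by (subst representation_sum) auto
    then show "(\<Sum>i\<in>I. representation B (f i b) b) = 0" using zero[OF b] B by (simp add: representation_zero)
  qed
  finally show ?thesis .
qed

lemma (in vector_space) trace_on_cong:
  assumes V: "subspace V" and f: "\<And>b. b \<in> V \<Longrightarrow> f b = f' b"
  shows "trace_on scale V f = trace_on scale V f'"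
proof -
  obtain B where B: "independent B" "span B = V"
      and tr: "\<And>f. trace_on scale V f = (\<Sum>b\<in>B. representation B (f b) b)"
    using trace_on_basis[OF V] by metis
  have "f b = f' b" if "b \<in> B" for b using that B span_base f by blast
  then show ?thesis by (simp add: tr)
qed

context hecke_setup
begin

text \<open>Either the basis is finite and the stabilizers of its vectors contain a common small
  subgroup, or it is infinite and the sum defining the trace is 0 by convention. Both alternatives
  make the character function locally constant.\<close>

lemma smooth_trace:
  assumes vs: "vector_space scl" and K: "small K"
    and \<rho>: "\<rho> \<in> smooth_reps (G\<lparr>carrier := K\<rparr>) (subtopology T K) scl"
  obtains N where "small N" "N \<subseteq> K"
    "(\<forall>n\<in>N. \<forall>v\<in>vectors \<rho>. action \<rho> n v = v) \<or> (\<forall>f. trace_on scl (vectors \<rho>) f = 0)"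
proof -
  interpret R: smooth_rep scl "G\<lparr>carrier := K\<rparr>" "subtopology T K" \<rho>
    using vs \<rho> by (simp add: smooth_rep_def smooth_rep_axioms_def)
  have KG: "K \<subseteq> carrier G" and opK: "openin T K" using K smallD by auto
  obtain B where B: "R.span B = vectors \<rho>"
      and tr: "\<And>f. trace_on scl (vectors \<rho>) f = (\<Sum>b\<in>B. R.representation B (f b) b)"
    using R.trace_on_basis[OF R.subspace_vectors] by metis
  show ?thesis
  proof (cases "finite B")
    case False
    then have "\<forall>f. trace_on scl (vectors \<rho>) f = 0" by (simp add: tr)
    then show ?thesis using that K by blast
  next
    case True
    have "\<exists>N. small N \<and> N \<subseteq> {g \<in> K. action \<rho> g b = b}" if b: "b \<in> B" for b
    proof -
      have bV: "b \<in> vectors \<rho>" using b B R.span_base by blast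
      have "openin T {g \<in> K. action \<rho> g b = b}"
        using R.stabilizer_open[OF bV] opK by (simp add: openin_open_subtopology)
      moreover have "\<one> \<in> {g \<in> K. action \<rho> g b = b}"
        using R.action_one[OF bV] smallD(5)[OF K] by simp
      ultimately show ?thesis using small_exists by blast
    qed
    then have "\<exists>N. \<forall>b\<in>B. small (N b) \<and> N b \<subseteq> {g \<in> K. action \<rho> g b = b}" by (intro bchoice) blast
    then obtain N where N: "\<And>b. b \<in> B \<Longrightarrow> small (N b)" "\<And>b. b \<in> B \<Longrightarrow> N b \<subseteq> {g \<in> K. action \<rho> g b = b}" by blast
    obtain M where M: "small M" "\<And>b. b \<in> B \<Longrightarrow> M \<subseteq> N b" using small_Inter[OF True, of N] N(1) by blast
    have "action \<rho> n v = v" if n: "n \<in> M \<inter> K" and v: "v \<in> vectors \<rho>" for n v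
    proof -
      have nK: "n \<in> carrier (G\<lparr>carrier := K\<rparr>)" using n by simp
      have "R.subspace {v \<in> vectors \<rho>. action \<rho> n v = v}"
        using R.subspace_vectors R.action_zero[OF nK] R.action_add[OF nK] R.action_scale[OF nK]
        by (auto simp: R.subspace_def)
      moreover have "B \<subseteq> {v \<in> vectors \<rho>. action \<rho> n v = v}" using n M(2) N(2) B R.span_base by blast
      ultimately have "vectors \<rho> \<subseteq> {v \<in> vectors \<rho>. action \<rho> n v = v}" using R.span_minimal B by metis
      then show ?thesis using v by blast
    qed
    then show ?thesis using that[of "M \<inter> K"] small_Int[OF M(1) K] by blast
  qed
qed

text \<open>If \<open>N\<close> acts trivially, the sum at a point \<open>x\<close> of
  \<open>K\<close> is a multiple of the trace of a composite: \<open>\<rho>(x)\<close>, then the sum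
  of \<open>\<rho>(inv r)\<close> over representatives \<open>r\<close> of \<open>L / M\<close>,
  then \<open>\<rho>(inv y)\<close>. The middle factor has its image in the \<open>L\<close>-fixed
  vectors and is 0. The extra \<open>y\<close> is there because the vanishing is later needed on the
  whole \<open>K\<close>-orbit of a vector.\<close>

lemma character_translates_vanish:
  assumes vs: "vector_space scl" and K: "small K"
    and \<rho>: "\<rho> \<in> smooth_reps (G\<lparr>carrier := K\<rparr>) (subtopology T K) scl"
  obtains N where "small N" "N \<subseteq> K" "character_measure G T scl K \<rho> \<in> hecke G T"
    "\<And>M L y. small M \<Longrightarrow> M \<subseteq> N \<Longrightarrow> (\<And>x m. x \<in> K \<Longrightarrow> m \<in> M \<Longrightarrow> x \<otimes> m \<otimes> inv x \<in> M) \<Longrightarrow>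
       small L \<Longrightarrow> M \<subseteq> L \<Longrightarrow> L \<subseteq> K \<Longrightarrow> fixed_vectors \<rho> L = {0} \<Longrightarrow> y \<in> K \<Longrightarrow>
       (\<lambda>\<phi>. \<Sum>C\<in>lcosets_in G L M. left_translate G T (coset_rep C \<otimes> y) (character_measure G T scl K \<rho>) \<phi>)
         = (\<lambda>_. 0::'k)"
proof -
  interpret R: smooth_rep scl "G\<lparr>carrier := K\<rparr>" "subtopology T K" \<rho>
    using vs \<rho> by (simp add: smooth_rep_def smooth_rep_axioms_def)
  have KG: "K \<subseteq> carrier G" using K smallD by blast
  have sK: "subgroup K G" using K smallD by blast
  have Kinv: "x \<in> K \<Longrightarrow> inv x \<in> K" and Kmult: "x \<in> K \<Longrightarrow> y \<in> K \<Longrightarrow> x \<otimes> y \<in> K" for x y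
    using sK by (auto simp: subgroup.m_inv_closed subgroup.m_closed)
  have act: "x \<in> K \<Longrightarrow> v \<in> vectors \<rho> \<Longrightarrow> action \<rho> x v \<in> vectors \<rho>"
    "x \<in> K \<Longrightarrow> y \<in> K \<Longrightarrow> v \<in> vectors \<rho> \<Longrightarrow> action \<rho> (x \<otimes> y) v = action \<rho> x (action \<rho> y v)" for x y v
    using R.action_closed R.action_mult by auto
  obtain N where N: "small N" "N \<subseteq> K"
    "(\<forall>n\<in>N. \<forall>v\<in>vectors \<rho>. action \<rho> n v = v) \<or> (\<forall>f. trace_on scl (vectors \<rho>) f = 0)"
    using smooth_trace[OF vs K \<rho>] by blast
  let ?d = "of_nat (R.dim (vectors \<rho>)) :: 'k"
  define \<theta> where "\<theta> = extend0 K (\<lambda>u. ?d * trace_on scl (vectors \<rho>) (action \<rho> u))"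
  have "\<theta> (x \<otimes> n) = \<theta> x" if xn: "x \<in> carrier G" "n \<in> N" for x n
  proof -
    have nK: "n \<in> K" "n \<in> carrier G" using xn N(2) KG by auto
    show ?thesis
    proof (cases "x \<in> K")
      case True
      show ?thesis using N(3)
      proof
        assume *: "\<forall>n\<in>N. \<forall>v\<in>vectors \<rho>. action \<rho> n v = v"
        have "trace_on scl (vectors \<rho>) (action \<rho> (x \<otimes> n)) = trace_on scl (vectors \<rho>) (action \<rho> x)"
          by (rule R.trace_on_cong[OF R.subspace_vectors]) (simp add: act True nK * xn)
        then show ?thesis using True nK Kmult by (simp add: \<theta>_def extend0_def)
      qed (simp add: \<theta>_def extend0_def)
    next
      case False
      have "x \<otimes> n \<notin> K"
      proof
        assume "x \<otimes> n \<in> K"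
        then have "x \<otimes> n \<otimes> inv n \<in> K" using nK Kmult Kinv by blast
        then show False using False xn nK by (simp add: m_assoc)
      qed
      then show ?thesis using False by (simp add: \<theta>_def extend0_def)
    qed
  qed
  then have inv: "right_invariant G N \<theta>" by (simp add: right_invariant_def)
  have th: "\<theta> \<in> tests"
    by (rule test_restrict_support[OF test_const_on[OF K, of 1] N(1) inv])
       (auto simp: \<theta>_def extend0_def const_on_def split: if_splits)
  have th': "(\<lambda>x. index K * \<theta> x) \<in> tests" using th by (rule test_scale)
  have char: "character_measure G T scl K \<rho> = density (\<lambda>x. index K * \<theta> x)"
    unfolding \<theta>_def by (rule character_measure_eq[OF K]) (use th in \<open>simp add: \<theta>_def\<close>)
  have "(\<lambda>\<phi>. \<Sum>C\<in>lcosets_in G L M. left_translate G T (coset_rep C \<otimes> y) (character_measure G T scl K \<rho>) \<phi>)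
         = (\<lambda>_. 0::'k)"
    if M: "small M" "M \<subseteq> N" "\<And>x m. x \<in> K \<Longrightarrow> m \<in> M \<Longrightarrow> x \<otimes> m \<otimes> inv x \<in> M"
      and L: "small L" "M \<subseteq> L" "L \<subseteq> K" "fixed_vectors \<rho> L = {0}" and y: "y \<in> K" for M L y
  proof -
    have sL: "subgroup L G" and sM: "subgroup M G" using L M smallD by auto
    have rep: "coset_rep C \<in> L" if "C \<in> lcosets_in G L M" for C
      using coset_rep_lcosets_in[OF sM sL L(2) that] .
    have repK: "coset_rep C \<in> K" if "C \<in> lcosets_in G L M" for C using rep[OF that] L(3) by blast
    have yG: "y \<in> carrier G" using y KG by blast
    have repyG: "coset_rep C \<otimes> y \<in> carrier G" if "C \<in> lcosets_in G L M" for C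
      using Kmult[OF repK[OF that] y] KG by blast
    have fin: "finite (lcosets_in G L M)" using finite_lcosets L M by blast
    \<comment> \<open>The sum over the representatives themselves is \<open>L\<close>-fixed, hence
      0; normality of \<open>M\<close> allows passing to inverse representatives.\<close>
    have avg: "(\<Sum>C\<in>lcosets_in G L M. action \<rho> (inv (coset_rep C)) w) = 0"
      if triv: "\<forall>n\<in>N. \<forall>v\<in>vectors \<rho>. action \<rho> n v = v" and w: "w \<in> vectors \<rho>" for w
    proof -
      have Finv: "action \<rho> (x \<otimes> n) w = action \<rho> x w" if "x \<in> K" "n \<in> M" for x n
        using that M(2) N(2) w triv by (simp add: act subset_iff)
      define s where "s = (\<Sum>C\<in>lcosets_in G L M. action \<rho> (coset_rep C) w)"
      have sV: "s \<in> vectors \<rho>"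
        unfolding s_def using act(1) repK w by (intro R.subspace_sum[OF R.subspace_vectors]) blast
      have "action \<rho> l s = s" if l: "l \<in> L" for l
      proof -
        have lK: "l \<in> K" "l \<in> carrier G" using l L(3) KG by auto
        have "action \<rho> l s = (\<Sum>C\<in>lcosets_in G L M. action \<rho> l (action \<rho> (coset_rep C) w))"
          unfolding s_def using lK act(1) repK w by (intro R.action_sum) auto
        also have "\<dots> = (\<Sum>C\<in>lcosets_in G L M. action \<rho> (l \<otimes> coset_rep C) w)"
          using lK repK w by (intro sum.cong) (simp_all add: act)
        also have "\<dots> = (\<Sum>C\<in>lcosets_in G ((\<lambda>x. l \<otimes> x) ` L) M. action \<rho> (coset_rep C) w)"
        proof (rule sum_lcosets_in_left_translate[OF sM lK(2)])
          show "L \<subseteq> carrier G" using L(3) KG by blast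
          fix x n assume xn: "x \<in> L" "n \<in> M"
          then have "x \<in> K" "n \<in> carrier G" "x \<in> carrier G" using L(3) KG M(1) small_mem_carrier by auto
          then show "action \<rho> (l \<otimes> (x \<otimes> n)) w = action \<rho> (l \<otimes> x) w"
            using Finv[of "l \<otimes> x" n] Kmult lK xn by (simp add: m_assoc)
        qed
        also have "(\<lambda>x. l \<otimes> x) ` L = L" by (rule left_mult_image_subgroup[OF sL l])
        finally show ?thesis by (simp add: s_def)
      qed
      then have "s \<in> fixed_vectors \<rho> L" using sV by (simp add: fixed_vectors_def)
      then have "s = 0" using L(4) by blast
      moreover have "(\<Sum>C\<in>lcosets_in G L M. action \<rho> (inv (coset_rep C)) w) = s"
        unfolding s_def
        using L(3) M(3) Finv by (intro sum_lcosets_in_inverse[OF sM sL L(2), of "\<lambda>x. action \<rho> x w"]) blast+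
      ultimately show ?thesis by simp
    qed
    have tr: "(\<Sum>C\<in>lcosets_in G L M. trace_on scl (vectors \<rho>) (action \<rho> (inv y \<otimes> (inv (coset_rep C) \<otimes> x)))) = 0"
      if x: "x \<in> K" for x
      using N(3)
    proof
      assume triv: "\<forall>n\<in>N. \<forall>v\<in>vectors \<rho>. action \<rho> n v = v"
      have split: "action \<rho> (inv y \<otimes> (inv (coset_rep C) \<otimes> x)) b = action \<rho> (inv y) (action \<rho> (inv (coset_rep C)) (action \<rho> x b))"
        if "C \<in> lcosets_in G L M" "b \<in> vectors \<rho>" for C b
        using that Kinv[OF y] Kinv[OF repK] x Kmult by (simp add: act)
      show ?thesis
      proof (rule R.trace_on_sum_zero[OF R.subspace_vectors])
        show "action \<rho> (inv y \<otimes> (inv (coset_rep C) \<otimes> x)) b \<in> vectors \<rho>"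
          if "C \<in> lcosets_in G L M" "b \<in> vectors \<rho>" for C b
          using that Kinv[OF y] Kinv[OF repK] x Kmult act(1) by blast
        fix b assume b: "b \<in> vectors \<rho>"
        have "(\<Sum>C\<in>lcosets_in G L M. action \<rho> (inv y \<otimes> (inv (coset_rep C) \<otimes> x)) b)
            = (\<Sum>C\<in>lcosets_in G L M. action \<rho> (inv y) (action \<rho> (inv (coset_rep C)) (action \<rho> x b)))"
          using split b by (intro sum.cong) auto
        also have "\<dots> = action \<rho> (inv y) (\<Sum>C\<in>lcosets_in G L M. action \<rho> (inv (coset_rep C)) (action \<rho> x b))"
          using Kinv[OF y] Kinv[OF repK] act(1) x b by (intro R.action_sum[symmetric]) auto
        also have "\<dots> = 0" using avg[OF triv act(1)[OF x b]] R.action_zero Kinv[OF y] by simp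
        finally show "(\<Sum>C\<in>lcosets_in G L M. action \<rho> (inv y \<otimes> (inv (coset_rep C) \<otimes> x)) b) = 0" .
      qed
    qed simp
    have zero: "(\<Sum>C\<in>lcosets_in G L M. left_shift G (inv (coset_rep C \<otimes> y)) (\<lambda>x. index K * \<theta> x) x) = 0" for x
    proof (cases "x \<in> carrier G")
      case True
      have eq: "inv (coset_rep C \<otimes> y) \<otimes> x = inv y \<otimes> (inv (coset_rep C) \<otimes> x)" if "C \<in> lcosets_in G L M" for C
        using repK[OF that] KG True yG by (simp add: inv_mult_group m_assoc subset_iff)
      \<comment> \<open>\<open>r\<close> and \<open>y\<close> lie in \<open>K\<close>, so the
        translations preserve the support condition: off \<open>K\<close> every term is 0.\<close>
      have mem: "inv y \<otimes> (inv r \<otimes> x) \<in> K \<longleftrightarrow> x \<in> K" if r: "r \<in> K" for r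
      proof
        have rG: "r \<in> carrier G" using r KG by blast
        assume "inv y \<otimes> (inv r \<otimes> x) \<in> K"
        then have "r \<otimes> (y \<otimes> (inv y \<otimes> (inv r \<otimes> x))) \<in> K" using r y Kmult by blast
        moreover have "y \<otimes> (inv y \<otimes> (inv r \<otimes> x)) = inv r \<otimes> x" "r \<otimes> (inv r \<otimes> x) = x"
          using rG yG True by (simp_all add: m_assoc[symmetric])
        ultimately show "x \<in> K" by simp
      qed (use r y Kmult Kinv in blast)
      have "(\<Sum>C\<in>lcosets_in G L M. left_shift G (inv (coset_rep C \<otimes> y)) (\<lambda>x. index K * \<theta> x) x)
          = (\<Sum>C\<in>lcosets_in G L M. index K * \<theta> (inv y \<otimes> (inv (coset_rep C) \<otimes> x)))"
        using True eq by (intro sum.cong) (auto simp: left_shift_def extend0_def)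
      also have "\<dots> = 0"
      proof (cases "x \<in> K")
        case xK: True
        have "(\<Sum>C\<in>lcosets_in G L M. index K * \<theta> (inv y \<otimes> (inv (coset_rep C) \<otimes> x)))
          = (\<Sum>C\<in>lcosets_in G L M. index K * ?d * trace_on scl (vectors \<rho>) (action \<rho> (inv y \<otimes> (inv (coset_rep C) \<otimes> x))))"
          using mem repK xK by (intro sum.cong) (simp_all add: \<theta>_def extend0_def)
        also have "\<dots> = 0" using tr[OF xK] by (simp add: sum_distrib_left[symmetric])
        finally show ?thesis .
      next
        case False
        then show ?thesis using mem repK by (intro sum.neutral) (simp add: \<theta>_def extend0_def)
      qed
      finally show ?thesis .
    qed (simp add: left_shift_def extend0_def)
    have "(\<lambda>\<phi>. \<Sum>C\<in>lcosets_in G L M. left_translate G T (coset_rep C \<otimes> y) (character_measure G T scl K \<rho>) \<phi>)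
        = (\<lambda>\<phi>. \<Sum>C\<in>lcosets_in G L M. density (left_shift G (inv (coset_rep C \<otimes> y)) (\<lambda>x. index K * \<theta> x)) \<phi>)"
      unfolding char using left_translate_density[OF repyG th'] by (intro ext sum.cong) auto
    also have "\<dots> = density (\<lambda>x. \<Sum>C\<in>lcosets_in G L M. left_shift G (inv (coset_rep C \<otimes> y)) (\<lambda>x. index K * \<theta> x) x)"
      using test_left_shift[OF inv_closed[OF repyG] th'] by (intro density_sum[symmetric] fin)
    also have "\<dots> = (\<lambda>_. 0)" unfolding zero by (rule density_zero)
    finally show ?thesis .
  qed
  moreover have "character_measure G T scl K \<rho> \<in> hecke G T" using char th' by (simp add: hecke_eq)
  ultimately show ?thesis using that[OF N(1,2)] by blast
qed

text \<open>Averaging a linear projection onto the span of the \<open>K\<close>-orbit of \<open>w\<close> over \<open>K/N\<close> gives an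
  equivariant one; it maps each \<open>u i\<close> to an \<open>L i\<close>-fixed vector of that span, hence to \<open>0\<close>.\<close>

lemma sum_fixed_vectors_vanish:
  fixes scl :: "'k \<Rightarrow> 'v \<Rightarrow> 'v::ab_group_add"
  assumes rep: "smooth_rep scl G T \<pi>"
    and K: "small K" and N: "small N" "N \<subseteq> K" and nrm: "\<And>x m. x \<in> K \<Longrightarrow> m \<in> N \<Longrightarrow> x \<otimes> m \<otimes> inv x \<in> N"
    and I: "finite I" and u: "\<And>i. i \<in> I \<Longrightarrow> u i \<in> vectors \<pi>"
    and L: "\<And>i. i \<in> I \<Longrightarrow> small (L i)" "\<And>i. i \<in> I \<Longrightarrow> N \<subseteq> L i" "\<And>i. i \<in> I \<Longrightarrow> L i \<subseteq> K"
    and uL: "\<And>i l. i \<in> I \<Longrightarrow> l \<in> L i \<Longrightarrow> action \<pi> l (u i) = u i"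
    and w: "w = (\<Sum>i\<in>I. u i)" and wN: "\<And>n. n \<in> N \<Longrightarrow> action \<pi> n w = w"
    and vanish: "\<And>i y. i \<in> I \<Longrightarrow> y \<in> K \<Longrightarrow> (\<Sum>C\<in>lcosets_in G (L i) N. action \<pi> (coset_rep C \<otimes> y) w) = 0"
  shows "w = 0"
proof -
  interpret R: smooth_rep scl G T \<pi> by (rule rep)
  interpret P: vector_space_pair scl scl ..
  have KG: "K \<subseteq> carrier G" and NG: "N \<subseteq> carrier G" using K N smallD by auto
  have sK: "subgroup K G" and sN: "subgroup N G" using K N smallD by auto
  have Kinv: "x \<in> K \<Longrightarrow> inv x \<in> K" and Kmult: "x \<in> K \<Longrightarrow> y \<in> K \<Longrightarrow> x \<otimes> y \<in> K" for x y
    using sK by (auto simp: subgroup.m_inv_closed subgroup.m_closed)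
  have wV: "w \<in> vectors \<pi>" unfolding w using u by (rule R.subspace_sum[OF R.subspace_vectors])
  define W where "W = R.span ((\<lambda>x. action \<pi> x w) ` K)"
  have WV: "W \<subseteq> vectors \<pi>"
    unfolding W_def using KG wV R.action_closed by (intro R.span_minimal R.subspace_vectors) auto
  have gen: "action \<pi> x w \<in> W" if "x \<in> K" for x using that by (auto simp: W_def intro: R.span_base)
  have WK: "action \<pi> x v \<in> W" if x: "x \<in> K" and v: "v \<in> W" for x v
  proof -
    have xG: "x \<in> carrier G" using x KG by blast
    have "R.subspace {v \<in> vectors \<pi>. action \<pi> x v \<in> W}"
      using R.subspace_vectors R.action_zero[OF xG] R.action_add[OF xG] R.action_scale[OF xG]
      unfolding W_def by (auto simp: R.subspace_def R.span_zero R.span_add R.span_scale)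
    moreover have "(\<lambda>y. action \<pi> y w) ` K \<subseteq> {v \<in> vectors \<pi>. action \<pi> x v \<in> W}"
    proof
      fix v assume "v \<in> (\<lambda>y. action \<pi> y w) ` K"
      then obtain y where y: "y \<in> K" "v = action \<pi> y w" by blast
      then have "action \<pi> x v = action \<pi> (x \<otimes> y) w" using R.action_mult[OF xG _ wV] KG by auto
      then show "v \<in> {v \<in> vectors \<pi>. action \<pi> x v \<in> W}" using gen Kmult[OF x y(1)] y gen WV by auto
    qed
    ultimately have "W \<subseteq> {v \<in> vectors \<pi>. action \<pi> x v \<in> W}" unfolding W_def by (rule R.span_minimal[rotated])
    then show ?thesis using v by blast
  qed
  \<comment> \<open>\<open>K\<close> normalizes \<open>N\<close>, so \<open>N\<close> fixes the
    whole orbit of \<open>w\<close>. This helps to make the summands of \<open>Q (u i)\<close>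
    constant on cosets of \<open>N\<close>.\<close>
  have WN: "action \<pi> n v = v" if n: "n \<in> N" and v: "v \<in> W" for n v
  proof -
    have nG: "n \<in> carrier G" using n NG by blast
    have "R.subspace {v \<in> vectors \<pi>. action \<pi> n v = v}"
      using R.subspace_vectors R.action_zero[OF nG] R.action_add[OF nG] R.action_scale[OF nG]
      by (auto simp: R.subspace_def)
    moreover have "(\<lambda>y. action \<pi> y w) ` K \<subseteq> {v \<in> vectors \<pi>. action \<pi> n v = v}"
    proof
      fix v assume "v \<in> (\<lambda>y. action \<pi> y w) ` K"
      then obtain y where y: "y \<in> K" "v = action \<pi> y w" by blast
      have yG: "y \<in> carrier G" using y KG by blast
      have m: "inv y \<otimes> n \<otimes> y \<in> N" using nrm[OF Kinv[OF y(1)] n] yG by simp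
      have "action \<pi> n v = action \<pi> (n \<otimes> y) w" using R.action_mult nG yG wV y by simp
      also have "n \<otimes> y = y \<otimes> (inv y \<otimes> n \<otimes> y)" using nG yG by (simp add: m_assoc[symmetric])
      also have "action \<pi> \<dots> w = action \<pi> y (action \<pi> (inv y \<otimes> n \<otimes> y) w)"
        using R.action_mult[of y "inv y \<otimes> n \<otimes> y" w] nG yG wV by simp
      also have "\<dots> = v" using wN[OF m] y by simp
      finally show "v \<in> {v \<in> vectors \<pi>. action \<pi> n v = v}" using y gen WV by auto
    qed
    ultimately have "W \<subseteq> {v \<in> vectors \<pi>. action \<pi> n v = v}" unfolding W_def by (rule R.span_minimal[rotated])
    then show ?thesis using v by blast
  qed
  \<comment> \<open>A projection onto \<open>W\<close> that is merely linear, obtained as a left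
    inverse of the identity on \<open>W\<close>.\<close>
  obtain q where q: "range q \<subseteq> W" "Vector_Spaces.linear scl scl q" "\<And>v. v \<in> W \<Longrightarrow> q v = v"
    using P.linear_exists_left_inverse_on[OF R.linear_id, of W] R.subspace_span
    unfolding W_def by (auto simp: id_def)
  have qW: "q v \<in> W" for v using q(1) by blast
  \<comment> \<open>The sum of the conjugates of \<open>q\<close>, without division by the number of
    cosets; \<open>Q w\<close> is therefore a multiple of \<open>w\<close>.\<close>
  define Q where "Q v = (\<Sum>C\<in>lcosets_in G K N. action \<pi> (coset_rep C) (q (action \<pi> (inv (coset_rep C)) v)))" for v
  have repK: "coset_rep C \<in> K" if "C \<in> lcosets_in G K N" for C
    using coset_rep_lcosets_in[OF sN sK N(2) that] .
  have repG: "coset_rep C \<in> carrier G" if "C \<in> lcosets_in G K N" for C using repK[OF that] KG by blast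
  have "Q (u i) = 0" if i: "i \<in> I" for i
  proof -
    have sL: "subgroup (L i) G" using L(1)[OF i] smallD by blast
    have LG: "L i \<subseteq> carrier G" using L(3)[OF i] KG by blast
    let ?F = "\<lambda>x. action \<pi> x (q (action \<pi> (inv x) (u i)))"
    \<comment> \<open>\<open>inv (x \<otimes> n)\<close> differs from \<open>inv x\<close> by the
      conjugate \<open>x \<otimes> inv n \<otimes> inv x\<close>, which lies in
      \<open>N \<subseteq> L i\<close> and fixes \<open>u i\<close>; on the outside,
      \<open>n\<close> fixes \<open>W\<close>.\<close>
    have Finv: "?F (x \<otimes> n) = ?F x" if xn: "x \<in> K" "n \<in> N" for x n
    proof -
      have xnG: "x \<in> carrier G" "n \<in> carrier G" using xn KG NG by auto
      have "inv n \<in> N" using xn sN by (simp add: subgroup.m_inv_closed)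
      then have m: "x \<otimes> inv n \<otimes> inv x \<in> L i" using nrm[OF xn(1)] L(2)[OF i] by blast
      have "inv (x \<otimes> n) = inv x \<otimes> (x \<otimes> inv n \<otimes> inv x)"
        using xnG by (simp add: inv_mult_group m_assoc[symmetric])
      then have "action \<pi> (inv (x \<otimes> n)) (u i) = action \<pi> (inv x) (u i)"
        using R.action_mult[of "inv x" "x \<otimes> inv n \<otimes> inv x" "u i"] xnG u[OF i] uL[OF i m] by simp
      then show ?thesis
        using R.action_mult[OF xnG subsetD[OF WV qW]] WN[OF xn(2) qW] by simp
    qed
    have QW: "Q (u i) \<in> W"
      unfolding Q_def W_def using WK[OF repK qW] by (intro R.span_sum) (simp add: W_def)
    have fixQ: "action \<pi> l (Q (u i)) = Q (u i)" if l: "l \<in> L i" for l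
    proof -
      have lK: "l \<in> K" "l \<in> carrier G" using l L(3)[OF i] KG by auto
      have lu: "action \<pi> (inv l) (u i) = u i" using l sL uL[OF i] by (simp add: subgroup.m_inv_closed)
      have "action \<pi> l (Q (u i)) = (\<Sum>C\<in>lcosets_in G K N. action \<pi> l (?F (coset_rep C)))"
        unfolding Q_def using lK WK[OF repK qW] WV by (intro R.action_sum) auto
      also have "\<dots> = (\<Sum>C\<in>lcosets_in G K N. ?F (l \<otimes> coset_rep C))"
      proof (rule sum.cong)
        fix C assume C: "C \<in> lcosets_in G K N"
        have "action \<pi> (inv (l \<otimes> coset_rep C)) (u i) = action \<pi> (inv (coset_rep C)) (u i)"
          using R.action_mult[of "inv (coset_rep C)" "inv l" "u i"] lK repG[OF C] u[OF i] lu
          by (simp add: inv_mult_group)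
        then show "action \<pi> l (?F (coset_rep C)) = ?F (l \<otimes> coset_rep C)"
          using R.action_mult[OF lK(2) repG[OF C] subsetD[OF WV qW]] by simp
      qed simp
      also have "\<dots> = (\<Sum>C\<in>lcosets_in G ((\<lambda>x. l \<otimes> x) ` K) N. ?F (coset_rep C))"
      proof (rule sum_lcosets_in_left_translate[OF sN lK(2) KG])
        fix x n assume xn: "x \<in> K" "n \<in> N"
        then have "l \<otimes> (x \<otimes> n) = (l \<otimes> x) \<otimes> n" using lK KG NG by (simp add: m_assoc subset_iff)
        then show "?F (l \<otimes> (x \<otimes> n)) = ?F (l \<otimes> x)" using Finv[OF Kmult[OF lK(1) xn(1)] xn(2)] by simp
      qed
      also have "(\<lambda>x. l \<otimes> x) ` K = K" by (rule left_mult_image_subgroup[OF sK lK(1)])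
      finally show ?thesis by (simp add: Q_def)
    qed
    have repL: "coset_rep C \<in> L i" if "C \<in> lcosets_in G (L i) N" for C
      using coset_rep_lcosets_in[OF sN sL L(2)[OF i] that] .
    have repLG: "coset_rep C \<in> carrier G" if "C \<in> lcosets_in G (L i) N" for C using repL[OF that] LG by blast
    \<comment> \<open>The hypothesis \<open>vanish\<close> gives this on the generators of
      \<open>W\<close>, and the vectors with this property form a subspace.\<close>
    have killW: "(\<Sum>C\<in>lcosets_in G (L i) N. action \<pi> (coset_rep C) v) = 0" if v: "v \<in> W" for v
    proof -
      have "R.subspace {v \<in> vectors \<pi>. (\<Sum>C\<in>lcosets_in G (L i) N. action \<pi> (coset_rep C) v) = 0}"
        using R.subspace_vectors repLG
        by (auto simp: R.subspace_def R.action_zero R.action_add R.action_scale sum.distrib R.scale_sum_right[symmetric])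
      moreover have "(\<lambda>y. action \<pi> y w) ` K \<subseteq> {v \<in> vectors \<pi>. (\<Sum>C\<in>lcosets_in G (L i) N. action \<pi> (coset_rep C) v) = 0}"
      proof
        fix v assume "v \<in> (\<lambda>y. action \<pi> y w) ` K"
        then obtain y where y: "y \<in> K" "v = action \<pi> y w" by blast
        have yG: "y \<in> carrier G" using y KG by blast
        have "(\<Sum>C\<in>lcosets_in G (L i) N. action \<pi> (coset_rep C) v) = (\<Sum>C\<in>lcosets_in G (L i) N. action \<pi> (coset_rep C \<otimes> y) w)"
          using y R.action_mult[OF repLG yG wV] by (intro sum.cong) auto
        then show "v \<in> {v \<in> vectors \<pi>. (\<Sum>C\<in>lcosets_in G (L i) N. action \<pi> (coset_rep C) v) = 0}"
          using vanish[OF i y(1)] y gen WV by auto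
      qed
      ultimately have "W \<subseteq> {v \<in> vectors \<pi>. (\<Sum>C\<in>lcosets_in G (L i) N. action \<pi> (coset_rep C) v) = 0}"
        unfolding W_def by (rule R.span_minimal[rotated])
      then show ?thesis using v by blast
    qed
    \<comment> \<open>\<open>Q (u i)\<close> is \<open>L i\<close>-fixed and lies in
      \<open>W\<close>: summing over \<open>L i\<close> multiplies it by an invertible index, yet
      the result is 0.\<close>
    have "(\<Sum>C\<in>lcosets_in G (L i) N. action \<pi> (coset_rep C) (Q (u i))) = (\<Sum>C\<in>lcosets_in G (L i) N. Q (u i))"
      using fixQ repL by (intro sum.cong) auto
    then have "scl (of_nat (card (lcosets_in G (L i) N))) (Q (u i)) = 0"
      using killW[OF QW] by (simp add: R.sum_constant_scale)
    then show ?thesis using index_nonzero[OF L(1)[OF i] N(1) L(2)[OF i]] by (simp add: R.scale_eq_0_iff)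
  qed
  then have "(\<Sum>i\<in>I. Q (u i)) = 0" by simp
  moreover have "(\<Sum>i\<in>I. Q (u i)) = Q w"
  proof -
    have "action \<pi> (coset_rep C) (q (action \<pi> (inv (coset_rep C)) w))
        = (\<Sum>i\<in>I. action \<pi> (coset_rep C) (q (action \<pi> (inv (coset_rep C)) (u i))))"
      if C: "C \<in> lcosets_in G K N" for C
    proof -
      have "action \<pi> (inv (coset_rep C)) w = (\<Sum>i\<in>I. action \<pi> (inv (coset_rep C)) (u i))"
        unfolding w using repG[OF C] u by (intro R.action_sum) auto
      then have "q (action \<pi> (inv (coset_rep C)) w) = (\<Sum>i\<in>I. q (action \<pi> (inv (coset_rep C)) (u i)))"
        using P.linear_sum[OF q(2)] by simp
      then show ?thesis using repG[OF C] qW WV by (simp add: R.action_sum subset_iff)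
    qed
    then have "Q w = (\<Sum>C\<in>lcosets_in G K N. \<Sum>i\<in>I. action \<pi> (coset_rep C) (q (action \<pi> (inv (coset_rep C)) (u i))))"
      unfolding Q_def by (intro sum.cong) auto
    also have "\<dots> = (\<Sum>i\<in>I. Q (u i))" unfolding Q_def by (rule sum.swap)
    finally show ?thesis by simp
  qed
  moreover have "Q w = scl (of_nat (card (lcosets_in G K N))) w"
  proof -
    \<comment> \<open>The orbit of \<open>w\<close> lies in \<open>W\<close>, where \<open>q\<close>
      is the identity, so every conjugate of \<open>q\<close> fixes \<open>w\<close>.\<close>
    have "action \<pi> (coset_rep C) (q (action \<pi> (inv (coset_rep C)) w)) = w" if C: "C \<in> lcosets_in G K N" for C
      using q(3)[OF gen[OF Kinv[OF repK[OF C]]]] R.action_mult[of "coset_rep C" "inv (coset_rep C)" w]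
        repG[OF C] wV R.action_one[OF wV] by simp
    then show ?thesis unfolding Q_def by (simp add: R.sum_constant_scale)
  qed
  ultimately show ?thesis using index_nonzero[OF K N] by (simp add: R.scale_eq_0_iff)
qed

end

section \<open>The Hecke algebra as a smooth representation\<close>

locale hecke_model = hecke_setup G T U coeff + vs: vector_space scl
  for G :: "('g, 'm) monoid_scheme" (structure) and T :: "'g topology"
    and U :: "'g set" and coeff :: "'k::field itself"
    and scl :: "'k \<Rightarrow> 'v \<Rightarrow> 'v::ab_group_add" +
  fixes \<iota> :: "('g, 'k) distribution \<Rightarrow> 'v"
  assumes embedding: "hecke_embedding G T scl \<iota>"
begin

lemma iota_inj: "inj_on \<iota> (hecke G T)"
  and iota_add: "h \<in> hecke G T \<Longrightarrow> h' \<in> hecke G T \<Longrightarrow> \<iota> (\<lambda>\<phi>. h \<phi> + h' \<phi>) = \<iota> h + \<iota> h'"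
  and iota_scale: "h \<in> hecke G T \<Longrightarrow> \<iota> (\<lambda>\<phi>. c * h \<phi>) = scl c (\<iota> h)"
  using embedding by (auto simp: hecke_embedding_def)

lemma iota_zero: "\<iota> (\<lambda>_. 0) = 0"
  using iota_scale[OF hecke_zero, of 0] by simp

lemma iota_sum:
  assumes "finite I" "\<And>i. i \<in> I \<Longrightarrow> h i \<in> hecke G T"
  shows "\<iota> (\<lambda>\<phi>. \<Sum>i\<in>I. h i \<phi>) = (\<Sum>i\<in>I. \<iota> (h i)) \<and> (\<lambda>\<phi>. \<Sum>i\<in>I. h i \<phi>) \<in> hecke G T"
  using assms by (induction I) (simp_all add: iota_zero iota_add hecke_add hecke_zero)

abbreviation model :: "('g, 'v) group_rep" where "model \<equiv> hecke_rep G T \<iota>"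

lemma vectors_model: "vectors model = \<iota> ` hecke G T"
  by (simp add: hecke_rep_def)

lemma action_model: "h \<in> hecke G T \<Longrightarrow> action model g (\<iota> h) = \<iota> (left_translate G T g h)"
  by (simp add: hecke_rep_def the_inv_into_f_f[OF iota_inj])

lemma model_smooth: "model \<in> smooth_reps G T scl"
proof -
  have "vs.subspace (vectors model)"
    unfolding vs.subspace_def vectors_model
  proof (intro conjI ballI allI)
    show "0 \<in> \<iota> ` hecke G T" using iota_zero hecke_zero by (metis imageI)
    show "x + y \<in> \<iota> ` hecke G T" if "x \<in> \<iota> ` hecke G T" "y \<in> \<iota> ` hecke G T" for x y
      using that by (auto simp: iota_add[symmetric] hecke_add)
    show "scl c x \<in> \<iota> ` hecke G T" if "x \<in> \<iota> ` hecke G T" for c x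
      using that by (auto simp: iota_scale[symmetric] hecke_scale)
  qed
  moreover have "linear_between scl (vectors model) (vectors model) (action model g)" if g: "g \<in> carrier G" for g
    unfolding linear_between_def vectors_model
  proof (intro conjI ballI allI)
    show "action model g v \<in> \<iota> ` hecke G T" if "v \<in> \<iota> ` hecke G T" for v
      using that g by (auto simp: action_model hecke_left_translate)
    show "action model g (v + w) = action model g v + action model g w"
      if "v \<in> \<iota> ` hecke G T" "w \<in> \<iota> ` hecke G T" for v w
      using that g by (auto simp: iota_add[symmetric] action_model hecke_add left_translate_add hecke_left_translate)
    show "action model g (scl c v) = scl c (action model g v)" if "v \<in> \<iota> ` hecke G T" for c v
      using that g by (auto simp: iota_scale[symmetric] action_model hecke_scale left_translate_scale hecke_left_translate)
  qed
  moreover have "action model \<one> v = v" if "v \<in> vectors model" for v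
    using that by (auto simp: vectors_model action_model left_translate_one)
  moreover have mult: "action model (g \<otimes> x) v = action model g (action model x v)"
    if "g \<in> carrier G" "x \<in> carrier G" "v \<in> vectors model" for g x v
    using that by (auto simp: vectors_model action_model hecke_left_translate left_translate_mult)
  moreover have "openin T {g \<in> carrier G. action model g v = v}" if v: "v \<in> vectors model" for v
  proof (subst openin_subopen, intro ballI)
    fix g assume "g \<in> {g \<in> carrier G. action model g v = v}"
    then have g: "g \<in> carrier G" "action model g v = v" by auto
    obtain h where h: "h \<in> hecke G T" "v = \<iota> h" using v by (auto simp: vectors_model)
    obtain N where N: "small N" "\<And>n. n \<in> N \<Longrightarrow> left_translate G T n h = h" using hecke_left_invariant[OF h(1)] by blast
    have "action model n v = v" if "n \<in> N" for n using N(2)[OF that] h by (simp add: action_model)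
    then have "g <# N \<subseteq> {g \<in> carrier G. action model g v = v}"
      using g mult[OF g(1) _ v] small_mem_carrier[OF N(1)] by (auto simp: l_coset_def)
    moreover have "g \<in> g <# N" using g N(1) by (simp add: mem_lcoset_iff smallD)
    ultimately show "\<exists>W. openin T W \<and> g \<in> W \<and> W \<subseteq> {g \<in> carrier G. action model g v = v}"
      using openin_lcoset[OF g(1) smallD(2)[OF N(1)]] by blast
  qed
  ultimately show ?thesis by (simp add: smooth_reps_def)
qed

lemma center_on_hecke:
  assumes z: "z \<in> bernstein_center G T scl" and h: "h \<in> hecke G T"
  shows "center_on_hecke G T \<iota> z h \<in> hecke G T" "\<iota> (center_on_hecke G T \<iota> z h) = z model (\<iota> h)"
proof -
  have "z model \<in> rep_hom G scl model model" using z model_smooth by (simp add: bernstein_center_def)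
  then have "z model (\<iota> h) \<in> \<iota> ` hecke G T"
    using h by (auto simp: rep_hom_def linear_between_def vectors_model)
  then show "center_on_hecke G T \<iota> z h \<in> hecke G T" "\<iota> (center_on_hecke G T \<iota> z h) = z model (\<iota> h)"
    unfolding center_on_hecke_def
    by (auto intro: the_inv_into_into[OF iota_inj] f_the_inv_into_f[OF iota_inj])
qed

lemma central_map_center:
  assumes z: "z \<in> bernstein_center G T scl"
  shows "central_map G T U (center_on_hecke G T \<iota> z)"
proof -
  have zh: "z model \<in> rep_hom G scl model model" using z model_smooth by (simp add: bernstein_center_def)
  have add: "z model (v + w) = z model v + z model w" if "v \<in> vectors model" "w \<in> vectors model" for v w
    using zh that by (simp add: rep_hom_def linear_between_def)
  have scale: "z model (scl c v) = scl c (z model v)" if "v \<in> vectors model" for c v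
    using zh that by (simp add: rep_hom_def linear_between_def)
  have act: "z model (action model g v) = action model g (z model v)" if "v \<in> vectors model" "g \<in> carrier G" for g v
    using zh that by (simp add: rep_hom_def)
  note Z = center_on_hecke[OF z]
  have eq: "h = h'" if "\<iota> h = \<iota> h'" "h \<in> hecke G T" "h' \<in> hecke G T" for h h'
    using that iota_inj by (simp add: inj_on_eq_iff)
  show ?thesis
  proof (unfold_locales)
    fix h :: "('g, 'k) distribution" assume h: "h \<in> hecke G T"
    have hv: "\<iota> h \<in> vectors model" using h by (simp add: vectors_model)
    show "center_on_hecke G T \<iota> z h \<in> hecke G T" by (rule Z(1)[OF h])
    show "center_on_hecke G T \<iota> z (\<lambda>\<phi>. c * h \<phi>) = (\<lambda>\<phi>. c * center_on_hecke G T \<iota> z h \<phi>)" for c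
      by (rule eq) (simp_all add: Z h hecke_scale iota_scale scale hv)
    show "center_on_hecke G T \<iota> z (left_translate G T g h) = left_translate G T g (center_on_hecke G T \<iota> z h)"
      if g: "g \<in> carrier G" for g
    proof (rule eq)
      have "\<iota> (center_on_hecke G T \<iota> z (left_translate G T g h)) = z model (action model g (\<iota> h))"
        by (simp add: Z(2) action_model h hecke_left_translate g)
      also have "\<dots> = \<iota> (left_translate G T g (center_on_hecke G T \<iota> z h))"
        using action_model[OF Z(1)[OF h], of g] by (simp add: act hv g Z(2)[OF h])
      finally show "\<iota> (center_on_hecke G T \<iota> z (left_translate G T g h)) = \<iota> (left_translate G T g (center_on_hecke G T \<iota> z h))" .
    qed (simp_all add: Z h hecke_left_translate g)
    show "center_on_hecke G T \<iota> z (right_translate G T g h) = right_translate G T g (center_on_hecke G T \<iota> z h)"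
      if g: "g \<in> carrier G" for g
    proof (rule eq)
      \<comment> \<open>Right translation, transported to the model, is an endomorphism in
        \<open>R(G)\<close>; naturality of \<open>z\<close> with respect to it is the commutation
        sought.\<close>
      define f where "f v = \<iota> (right_translate G T g (the_inv_into (hecke G T) \<iota> v))" for v
      have f: "f (\<iota> h) = \<iota> (right_translate G T g h)" if "h \<in> hecke G T" for h
        using that by (simp add: f_def the_inv_into_f_f[OF iota_inj])
      have "f \<in> rep_hom G scl model model"
        unfolding rep_hom_def linear_between_def vectors_model
        using g by (auto simp: f hecke_right_translate action_model hecke_left_translate left_right_translate
            iota_add[symmetric] iota_scale[symmetric] hecke_add hecke_scale right_translate_add right_translate_scale)
      then have "f (z model (\<iota> h)) = z model (f (\<iota> h))"
        using z model_smooth hv by (simp add: bernstein_center_def)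
      then show "\<iota> (center_on_hecke G T \<iota> z (right_translate G T g h)) = \<iota> (right_translate G T g (center_on_hecke G T \<iota> z h))"
        using f[OF h] f[OF Z(1)[OF h]] by (simp add: Z h hecke_right_translate g)
    qed (simp_all add: Z h hecke_right_translate g)
    fix h' :: "('g, 'k) distribution" assume h': "h' \<in> hecke G T"
    have hv': "\<iota> h' \<in> vectors model" using h' by (simp add: vectors_model)
    show "center_on_hecke G T \<iota> z (\<lambda>\<phi>. h \<phi> + h' \<phi>)
        = (\<lambda>\<phi>. center_on_hecke G T \<iota> z h \<phi> + center_on_hecke G T \<iota> z h' \<phi>)"
      by (rule eq) (simp_all add: Z h h' hecke_add iota_add add hv hv')
  qed
qed

lemma center_distribution:
  assumes z: "z \<in> bernstein_center G T scl"
  shows "center_distribution G T \<iota> z \<in> invariant_distributions G T"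
    and "h \<in> hecke G T \<Longrightarrow> convolution G T (center_distribution G T \<iota> z) h = center_on_hecke G T \<iota> z h"
proof -
  interpret central_map G T U coeff "center_on_hecke G T \<iota> z" by (rule central_map_center[OF z])
  from theI'[OF ex1_kernel]
  show "center_distribution G T \<iota> z \<in> invariant_distributions G T"
    and "h \<in> hecke G T \<Longrightarrow> convolution G T (center_distribution G T \<iota> z) h = center_on_hecke G T \<iota> z h"
    by (simp_all add: center_distribution_def)
qed

text \<open>The summands are only isomorphic to objects of \<open>A\<close> and \<open>B\<close>.
  Generation by \<open>U\<close>-fixed vectors is pulled back along the first isomorphism, and
  \<open>z \<pi> v2 = 0\<close> follows from naturality along the second and along the inclusion of
  the second summand.\<close>

lemma stable_decomposition:
  assumes dec: "category_decomposition G T scl A B" and gen: "\<forall>\<pi>\<in>A. generated_by_fixed_vectors G scl U \<pi>"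
    and \<pi>: "\<pi> \<in> smooth_reps G T scl" and v: "v \<in> vectors \<pi>"
  obtains V W v1 v2 where "invariant_subspace G scl \<pi> V" "invariant_subspace G scl \<pi> W" "V \<inter> W = {0}"
    "v = v1 + v2" "v1 \<in> V" "v2 \<in> W"
    "v1 \<in> vs.span {action \<pi> g x |g x. g \<in> carrier G \<and> x \<in> V \<and> (\<forall>k\<in>U. action \<pi> k x = x)}"
    "\<And>z. z \<in> center_vanishing_on G T scl B \<Longrightarrow> z \<pi> v2 = 0"
proof -
  have "\<exists>a b. \<forall>\<pi>\<in>smooth_reps G T scl.
          invariant_subspace G scl \<pi> (a \<pi>) \<and> invariant_subspace G scl \<pi> (b \<pi>) \<and>
          (\<exists>\<sigma>\<in>A. rep_isomorphic G scl (\<pi>\<lparr>vectors := a \<pi>\<rparr>) \<sigma>) \<and>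
          (\<exists>\<sigma>\<in>B. rep_isomorphic G scl (\<pi>\<lparr>vectors := b \<pi>\<rparr>) \<sigma>) \<and>
          vectors \<pi> = {v + w | v w. v \<in> a \<pi> \<and> w \<in> b \<pi>} \<and> a \<pi> \<inter> b \<pi> = {0}"
    using dec[unfolded category_decomposition_def] by (elim conjE exE) (intro exI, assumption)
  then obtain a b where "invariant_subspace G scl \<pi> (a \<pi>) \<and> invariant_subspace G scl \<pi> (b \<pi>) \<and>
          (\<exists>\<sigma>\<in>A. rep_isomorphic G scl (\<pi>\<lparr>vectors := a \<pi>\<rparr>) \<sigma>) \<and>
          (\<exists>\<sigma>\<in>B. rep_isomorphic G scl (\<pi>\<lparr>vectors := b \<pi>\<rparr>) \<sigma>) \<and>
          vectors \<pi> = {v + w | v w. v \<in> a \<pi> \<and> w \<in> b \<pi>} \<and> a \<pi> \<inter> b \<pi> = {0}"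
    by (elim exE) (drule bspec[OF _ \<pi>], erule that)
  then have ab: "invariant_subspace G scl \<pi> (a \<pi>)" "invariant_subspace G scl \<pi> (b \<pi>)"
      "\<exists>\<sigma>\<in>A. rep_isomorphic G scl (\<pi>\<lparr>vectors := a \<pi>\<rparr>) \<sigma>" "\<exists>\<sigma>\<in>B. rep_isomorphic G scl (\<pi>\<lparr>vectors := b \<pi>\<rparr>) \<sigma>"
      "vectors \<pi> = {v + w | v w. v \<in> a \<pi> \<and> w \<in> b \<pi>}" "a \<pi> \<inter> b \<pi> = {0}"
    by simp_all
  have AB: "A \<subseteq> smooth_reps G T scl" "B \<subseteq> smooth_reps G T scl"
    using dec[unfolded category_decomposition_def] by simp_all
  interpret R: smooth_rep scl G T \<pi> using \<pi> by unfold_locales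
  have sub: "\<pi>\<lparr>vectors := V\<rparr> \<in> smooth_reps G T scl" if V: "invariant_subspace G scl \<pi> V" for V
  proof -
    have "vs.subspace V" "V \<subseteq> vectors \<pi>" "\<And>g w. g \<in> carrier G \<Longrightarrow> w \<in> V \<Longrightarrow> action \<pi> g w \<in> V"
      using V by (auto simp: invariant_subspace_def)
    then show ?thesis
      using \<pi> by (simp add: smooth_reps_def linear_between_def subset_iff)
  qed
  obtain v1 v2 where v12: "v = v1 + v2" "v1 \<in> a \<pi>" "v2 \<in> b \<pi>" using v ab(5) by blast
  have "v1 \<in> vs.span {action \<pi> g x |g x. g \<in> carrier G \<and> x \<in> a \<pi> \<and> (\<forall>k\<in>U. action \<pi> k x = x)}"
    (is "_ \<in> vs.span ?X")
  proof -
    obtain \<sigma> f where \<sigma>: "\<sigma> \<in> A" "f \<in> rep_hom G scl (\<pi>\<lparr>vectors := a \<pi>\<rparr>) \<sigma>" "bij_betw f (a \<pi>) (vectors \<sigma>)"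
      using ab(3) by (auto simp: rep_isomorphic_def)
    have UG: "U \<subseteq> carrier G" using small_U smallD by blast
    have fadd: "f (x + y) = f x + f y" if "x \<in> a \<pi>" "y \<in> a \<pi>" for x y
      using \<sigma>(2) that by (simp add: rep_hom_def linear_between_def)
    have fscale: "f (scl c x) = scl c (f x)" if "x \<in> a \<pi>" for c x
      using \<sigma>(2) that by (simp add: rep_hom_def linear_between_def)
    have fact: "f (action \<pi> g x) = action \<sigma> g (f x)" if "g \<in> carrier G" "x \<in> a \<pi>" for g x
      using \<sigma>(2) that by (simp add: rep_hom_def)
    have Va: "vs.subspace (a \<pi>)" "\<And>g w. g \<in> carrier G \<Longrightarrow> w \<in> a \<pi> \<Longrightarrow> action \<pi> g w \<in> a \<pi>"
      using ab(1) by (auto simp: invariant_subspace_def)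
    have inj: "inj_on f (a \<pi>)" and im: "f ` a \<pi> = vectors \<sigma>" using \<sigma>(3) by (auto simp: bij_betw_def)
    let ?Y = "{action \<sigma> g x |g x. g \<in> carrier G \<and> x \<in> fixed_vectors \<sigma> U}"
    have Xa: "?X \<subseteq> a \<pi>" using Va(2) by auto
    have spX: "vs.span ?X \<subseteq> a \<pi>" by (rule vs.span_minimal[OF Xa Va(1)])
    \<comment> \<open>\<open>f\<close> is linear on \<open>a \<pi>\<close> only, so this is checked
      by hand; \<open>spX\<close> keeps all vectors in \<open>a \<pi>\<close>.\<close>
    have "vs.subspace (f ` vs.span ?X)"
      unfolding vs.subspace_def
    proof (intro conjI ballI allI)
      have "f 0 = 0" using fscale[OF vs.subspace_0[OF Va(1)], of 0] by simp
      then show "0 \<in> f ` vs.span ?X" by (intro image_eqI[of 0 f 0] vs.span_zero) simp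
      show "x + y \<in> f ` vs.span ?X" if x: "x \<in> f ` vs.span ?X" and y: "y \<in> f ` vs.span ?X" for x y
      proof -
        obtain x' where x': "x = f x'" "x' \<in> vs.span ?X" using x by (rule imageE)
        obtain y' where y': "y = f y'" "y' \<in> vs.span ?X" using y by (rule imageE)
        have "x + y = f (x' + y')" using fadd subsetD[OF spX] x' y' by simp
        then show ?thesis using vs.span_add[OF x'(2) y'(2)] by (rule image_eqI)
      qed
      show "scl c x \<in> f ` vs.span ?X" if x: "x \<in> f ` vs.span ?X" for c x
      proof -
        obtain x' where x': "x = f x'" "x' \<in> vs.span ?X" using x by (rule imageE)
        have "scl c x = f (scl c x')" using fscale subsetD[OF spX] x' by simp
        then show ?thesis using vs.span_scale[OF x'(2)] by (rule image_eqI)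
      qed
    qed
    moreover have "?Y \<subseteq> f ` vs.span ?X"
    proof
      fix y assume "y \<in> ?Y"
      then obtain g x where gx: "g \<in> carrier G" "x \<in> vectors \<sigma>" "\<forall>k\<in>U. action \<sigma> k x = x" "y = action \<sigma> g x"
        by (auto simp: fixed_vectors_def)
      obtain x' where x': "x' \<in> a \<pi>" "x = f x'" using gx(2) im by blast
      have "action \<pi> k x' = x'" if k: "k \<in> U" for k
      proof (rule inj_onD[OF inj])
        have kG: "k \<in> carrier G" using k UG by blast
        show "f (action \<pi> k x') = f x'" using gx(3) k x' fact[OF kG x'(1)] by simp
        show "action \<pi> k x' \<in> a \<pi>" using Va(2) kG x' by blast
      qed (rule x'(1))
      then have "action \<pi> g x' \<in> ?X" using gx(1) x'(1) by blast
      then have "action \<pi> g x' \<in> vs.span ?X" by (rule vs.span_base)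
      moreover have "y = f (action \<pi> g x')" using gx x' fact by simp
      ultimately show "y \<in> f ` vs.span ?X" by blast
    qed
    ultimately have "vs.span ?Y \<subseteq> f ` vs.span ?X" by (rule vs.span_minimal[rotated])
    moreover have "vs.span ?Y = vectors \<sigma>"
      using gen \<sigma>(1) by (simp add: generated_by_fixed_vectors_def)
    ultimately have "f v1 \<in> f ` vs.span ?X" using im v12(2) by blast
    then obtain x where x: "x \<in> vs.span ?X" "f v1 = f x" by blast
    then have "v1 = x" using inj_onD[OF inj x(2) v12(2)] spX by blast
    then show ?thesis using x(1) by simp
  qed
  moreover have "z \<pi> v2 = 0" if z: "z \<in> center_vanishing_on G T scl B" for z
  proof -
    have zc: "z \<in> bernstein_center G T scl" and zB: "\<forall>\<pi>\<in>B. \<forall>v\<in>vectors \<pi>. z \<pi> v = 0"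
      using z by (auto simp: center_vanishing_on_def)
    let ?\<tau> = "\<pi>\<lparr>vectors := b \<pi>\<rparr>"
    have \<tau>: "?\<tau> \<in> smooth_reps G T scl" by (rule sub[OF ab(2)])
    have nat: "f (z \<pi>' v) = z \<sigma>' (f v)"
      if "\<pi>' \<in> smooth_reps G T scl" "\<sigma>' \<in> smooth_reps G T scl" "f \<in> rep_hom G scl \<pi>' \<sigma>'" "v \<in> vectors \<pi>'" for \<pi>' \<sigma>' f v
      using zc that by (simp add: bernstein_center_def)
    obtain \<sigma> f where \<sigma>: "\<sigma> \<in> B" "f \<in> rep_hom G scl ?\<tau> \<sigma>" "bij_betw f (b \<pi>) (vectors \<sigma>)"
      using ab(4) by (auto simp: rep_isomorphic_def)
    have lin: "f 0 = 0"
    proof -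
      have "0 \<in> b \<pi>" using ab(6) by blast
      moreover have "\<forall>c. \<forall>v\<in>b \<pi>. f (scl c v) = scl c (f v)"
        using \<sigma>(2) by (simp add: rep_hom_def linear_between_def)
      ultimately have "f (scl 0 0) = scl 0 (f 0)" by blast
      then show ?thesis by simp
    qed
    have "f v2 \<in> vectors \<sigma>" using \<sigma>(3) v12(3) by (auto simp: bij_betw_def)
    then have "z \<sigma> (f v2) = 0" using zB \<sigma>(1) by blast
    then have "f (z ?\<tau> v2) = f 0" using nat[OF \<tau> _ \<sigma>(2), of v2] AB(2) \<sigma>(1) v12(3) lin by auto
    moreover have "z ?\<tau> v2 \<in> b \<pi>"
      using zc \<tau> v12(3) by (auto simp: bernstein_center_def rep_hom_def linear_between_def)
    moreover have "0 \<in> b \<pi>" using ab(6) by blast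
    ultimately have "z ?\<tau> v2 = 0" using \<sigma>(3) by (auto simp: bij_betw_def dest: inj_onD)
    moreover have "(\<lambda>x. x) \<in> rep_hom G scl ?\<tau> \<pi>"
      using ab(2) by (auto simp: rep_hom_def linear_between_def invariant_subspace_def)
    ultimately show ?thesis using nat[OF \<tau> \<pi>, of "\<lambda>x. x" v2] v12(3) by simp
  qed
  ultimately show ?thesis using that ab(1,2,6) v12 by blast
qed

lemma admissible_at_irreducible:
  fixes scl' :: "'k \<Rightarrow> 'w \<Rightarrow> 'w::ab_group_add"
  assumes vs': "vector_space scl'"
    and dec: "category_decomposition G T scl A B" and gen: "\<forall>\<pi>\<in>A. generated_by_fixed_vectors G scl U \<pi>"
    and z: "z \<in> center_vanishing_on G T scl B"
    and K: "small K" and \<rho>: "\<rho> \<in> smooth_reps (G\<lparr>carrier := K\<rparr>) (subtopology T K) scl'"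
    and conv: "convolution G T (center_distribution G T \<iota> z) (character_measure G T scl' K \<rho>) \<noteq> (\<lambda>_. 0)"
  shows "\<exists>g\<in>carrier G. fixed_vectors \<rho> (K \<inter> ((g <# U) #> inv g)) \<noteq> {0}"
proof (rule ccontr)
  assume neg: "\<not> ?thesis"
  let ?\<Theta> = "character_measure G T scl' K \<rho>"
  have zc: "z \<in> bernstein_center G T scl" using z by (simp add: center_vanishing_on_def)
  show False
  proof (rule character_translates_vanish[OF vs' K \<rho>])
    fix N1
    assume N1: "small N1" "N1 \<subseteq> K" and \<Theta>: "?\<Theta> \<in> hecke G T"
      and kill: "\<And>M L y. small M \<Longrightarrow> M \<subseteq> N1 \<Longrightarrow> (\<And>x m. x \<in> K \<Longrightarrow> m \<in> M \<Longrightarrow> x \<otimes> m \<otimes> inv x \<in> M) \<Longrightarrow>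
         small L \<Longrightarrow> M \<subseteq> L \<Longrightarrow> L \<subseteq> K \<Longrightarrow> fixed_vectors \<rho> L = {0} \<Longrightarrow> y \<in> K \<Longrightarrow>
         (\<lambda>\<phi>. \<Sum>C\<in>lcosets_in G L M. left_translate G T (coset_rep C \<otimes> y) ?\<Theta> \<phi>) = (\<lambda>_. 0::'k)"
    have rep: "smooth_rep scl G T model"
      using model_smooth vs.vector_space_axioms by (simp add: smooth_rep_def smooth_rep_axioms_def)
    interpret R: smooth_rep scl G T model by (rule rep)
    let ?v = "\<iota> ?\<Theta>"
    have v: "?v \<in> vectors model" using \<Theta> by (simp add: vectors_model)
    have zadd: "z model (x + y) = z model x + z model y" if "x \<in> vectors model" "y \<in> vectors model" for x y
      using zc model_smooth that by (simp add: bernstein_center_def rep_hom_def linear_between_def)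
    have zv: "z model ?v \<noteq> 0"
    proof
      assume "z model ?v = 0"
      then have "\<iota> (center_on_hecke G T \<iota> z ?\<Theta>) = \<iota> (\<lambda>_. 0)"
        using center_on_hecke(2)[OF zc \<Theta>] iota_zero by simp
      then have "center_on_hecke G T \<iota> z ?\<Theta> = (\<lambda>_. 0)"
        using inj_onD[OF iota_inj] center_on_hecke(1)[OF zc \<Theta>] hecke_zero by blast
      then show False using conv center_distribution(2)[OF zc \<Theta>] by simp
    qed
    obtain V W w v2 where V: "invariant_subspace G scl model V" and W: "invariant_subspace G scl model W" and VW: "V \<inter> W = {0}"
      and sp: "?v = w + v2" "w \<in> V" "v2 \<in> W"
      and wspan: "w \<in> vs.span {action model g x |g x. g \<in> carrier G \<and> x \<in> V \<and> (\<forall>k\<in>U. action model k x = x)}"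
      and z2: "\<And>z. z \<in> center_vanishing_on G T scl B \<Longrightarrow> z model v2 = 0"
      using stable_decomposition[OF dec gen model_smooth v] by blast
    have VV: "V \<subseteq> vectors model" "W \<subseteq> vectors model" "vs.subspace V" "vs.subspace W"
      using V W by (auto simp: invariant_subspace_def)
    have VA: "action model g x \<in> V" if "g \<in> carrier G" "x \<in> V" for g x using V that by (auto simp: invariant_subspace_def)
    have WA: "action model g x \<in> W" if "g \<in> carrier G" "x \<in> W" for g x using W that by (auto simp: invariant_subspace_def)
    have wV: "w \<in> vectors model" and v2V: "v2 \<in> vectors model" using sp VV by auto
    \<comment> \<open>Otherwise \<open>?v\<close> would lie in the summand on which \<open>z\<close>
      vanishes.\<close>
    have "w \<noteq> 0"
    proof
      assume "w = 0"
      then have "z model ?v = 0" using sp z2[OF z] by simp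
      then show False using zv by simp
    qed
    moreover have "w = 0"
    proof -
      obtain t r where t: "finite t" "t \<subseteq> {action model g x |g x. g \<in> carrier G \<and> x \<in> V \<and> (\<forall>k\<in>U. action model k x = x)}"
        and wt: "w = (\<Sum>y\<in>t. scl (r y) y)"
        using wspan by (auto simp: vs.span_explicit)
      have "\<forall>y\<in>t. \<exists>g. g \<in> carrier G \<and> (\<exists>x\<in>V. (\<forall>k\<in>U. action model k x = x) \<and> y = action model g x)"
        using t(2) by blast
      from bchoice[OF this] obtain g where
        "\<forall>y\<in>t. g y \<in> carrier G \<and> (\<exists>x\<in>V. (\<forall>k\<in>U. action model k x = x) \<and> y = action model (g y) x)"
        by (rule exE)
      then have g: "g y \<in> carrier G" "\<exists>x\<in>V. (\<forall>k\<in>U. action model k x = x) \<and> y = action model (g y) x"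
        if "y \<in> t" for y using that by simp_all
      \<comment> \<open>The group attached to \<open>g y\<close> in the definition of admissibility,
        in the form that \<open>small_conj\<close> handles; the intersection with \<open>U\<close>
        is absorbed by \<open>K \<subseteq> U\<close>.\<close>
      define L where "L y = K \<inter> {x \<in> U. inv (g y) \<otimes> x \<otimes> inv (inv (g y)) \<in> U}" for y
      have tV: "y \<in> V" if y: "y \<in> t" for y
      proof -
        obtain x where x: "x \<in> V" "y = action model (g y) x" using g(2)[OF y] by blast
        have "action model (g y) x \<in> V" by (rule VA[OF g(1)[OF y] x(1)])
        then show ?thesis using x(2) by simp
      qed
      have Ls: "small (L y)" if "y \<in> t" for y
        unfolding L_def using small_conj[OF inv_closed[OF g(1)[OF that]] small_U] by (rule small_Int[OF K])
      have LK: "L y \<subseteq> K" for y by (auto simp: L_def)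
      have KG: "K \<subseteq> carrier G" and KU: "K \<subseteq> U" using K smallD by auto
      have UG: "U \<subseteq> carrier G" using small_U smallD by blast
      have Leq: "L y = K \<inter> ((g y <# U) #> inv (g y))" if y: "y \<in> t" for y
      proof -
        have gy: "g y \<in> carrier G" by (rule g(1)[OF y])
        have "x \<in> (g y <# U) #> inv (g y) \<longleftrightarrow> inv (g y) \<otimes> x \<otimes> g y \<in> U" if x: "x \<in> K" for x
        proof
          have xG: "x \<in> carrier G" using x KG by blast
          assume "inv (g y) \<otimes> x \<otimes> g y \<in> U"
          moreover have "x = g y \<otimes> (inv (g y) \<otimes> x \<otimes> g y) \<otimes> inv (g y)"
          proof -
            have "g y \<otimes> (inv (g y) \<otimes> (x \<otimes> g y)) = x \<otimes> g y" using xG gy by (simp add: m_assoc[symmetric])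
            then have "g y \<otimes> (inv (g y) \<otimes> x \<otimes> g y) = x \<otimes> g y" using xG gy by (simp add: m_assoc)
            then show ?thesis using xG gy by (simp add: m_assoc)
          qed
          ultimately show "x \<in> (g y <# U) #> inv (g y)" unfolding l_coset_def r_coset_def by blast
        next
          assume "x \<in> (g y <# U) #> inv (g y)"
          then obtain k where k: "k \<in> U" "x = g y \<otimes> k \<otimes> inv (g y)" by (auto simp: l_coset_def r_coset_def)
          have kG: "k \<in> carrier G" using k UG by blast
          have "inv (g y) \<otimes> (g y \<otimes> k) = k" using kG gy by (simp add: m_assoc[symmetric])
          then have "inv (g y) \<otimes> x \<otimes> g y = k" using kG gy k by (simp add: m_assoc)
          then show "inv (g y) \<otimes> x \<otimes> g y \<in> U" using k by simp
        qed
        then show ?thesis using KU gy by (auto simp: L_def)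
      qed
      have Lfix: "fixed_vectors \<rho> (L y) = {0}" if "y \<in> t" for y
        using neg g(1)[OF that] Leq[OF that] by auto
      have Ly: "action model l y = y" if y: "y \<in> t" and l: "l \<in> L y" for y l
      proof -
        obtain x where x: "x \<in> V" "\<forall>k\<in>U. action model k x = x" "y = action model (g y) x" using g(2)[OF y] by blast
        have gy: "g y \<in> carrier G" and lG: "l \<in> carrier G" using g(1)[OF y] l LK KG by auto
        have xv: "x \<in> vectors model" using x VV by blast
        have k: "inv (g y) \<otimes> l \<otimes> g y \<in> U" using l gy by (auto simp: L_def)
        have "action model l y = action model (l \<otimes> g y) x" using R.action_mult[OF lG gy xv] x(3) by simp
        also have "l \<otimes> g y = g y \<otimes> (inv (g y) \<otimes> l \<otimes> g y)" using lG gy by (simp add: m_assoc[symmetric])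
        also have "action model \<dots> x = action model (g y) (action model (inv (g y) \<otimes> l \<otimes> g y) x)"
          using R.action_mult[OF gy subsetD[OF UG k] xv] .
        also have "\<dots> = y" using x k by simp
        finally show ?thesis .
      qed
      obtain M0 where M0: "small M0" "\<And>y. y \<in> t \<Longrightarrow> M0 \<subseteq> L y" using small_Inter[OF t(1), of L] Ls by blast
      have "openin T {x \<in> carrier G. action model x w = w}" "\<one> \<in> {x \<in> carrier G. action model x w = w}"
        using R.stabilizer_open[OF wV] R.action_one[OF wV] by auto
      then obtain M1 where M1: "small M1" "M1 \<subseteq> {x \<in> carrier G. action model x w = w}" using small_exists by blast
      \<comment> \<open>\<open>M\<close> must lie in all \<open>L y\<close>, fix \<open>w\<close>,
        be small enough for the character and be normalized by \<open>K\<close>; the core of this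
        intersection does all four.\<close>
      have "small (M0 \<inter> M1 \<inter> N1)" using M0 M1 N1 small_Int by blast
      then obtain M where M: "small M" "M \<subseteq> M0 \<inter> M1 \<inter> N1" "\<And>x m. x \<in> K \<Longrightarrow> m \<in> M \<Longrightarrow> x \<otimes> m \<otimes> inv x \<in> M"
        using small_core[OF K, of "M0 \<inter> M1 \<inter> N1"] N1(2) by blast
      have vanish: "(\<Sum>C\<in>lcosets_in G (L y) M. action model (coset_rep C \<otimes> x) w) = 0" if y: "y \<in> t" and x: "x \<in> K" for y x
      proof -
        have MsubL: "M \<subseteq> L y" using M(2) M0(2)[OF y] by blast
        have xG: "x \<in> carrier G" using x KG by blast
        have repG: "coset_rep C \<otimes> x \<in> carrier G" if "C \<in> lcosets_in G (L y) M" for C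
        proof -
          have "coset_rep C \<in> L y"
            by (rule small_coset_rep[OF Ls[OF y] M(1) MsubL that])
          then show ?thesis using LK KG xG by blast
        qed
        have fin: "finite (lcosets_in G (L y) M)" using finite_lcosets[OF Ls[OF y] M(1) MsubL] .
        \<comment> \<open>The translates of \<open>?v\<close> sum to 0. The sum splits into a part
          in \<open>V\<close> and a part in \<open>W\<close>, and \<open>V \<inter> W = {0}\<close>
          makes the part coming from \<open>w\<close> vanish.\<close>
        have "(\<Sum>C\<in>lcosets_in G (L y) M. action model (coset_rep C \<otimes> x) ?v)
            = (\<Sum>C\<in>lcosets_in G (L y) M. \<iota> (left_translate G T (coset_rep C \<otimes> x) ?\<Theta>))"
          by (simp add: action_model[OF \<Theta>])
        also have "\<dots> = \<iota> (\<lambda>\<phi>. \<Sum>C\<in>lcosets_in G (L y) M. left_translate G T (coset_rep C \<otimes> x) ?\<Theta> \<phi>)"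
          using iota_sum[OF fin, of "\<lambda>C. left_translate G T (coset_rep C \<otimes> x) ?\<Theta>"] hecke_left_translate[OF repG \<Theta>] by simp
        also have "\<dots> = 0"
          using kill[OF M(1) _ M(3) Ls[OF y] MsubL LK Lfix[OF y] x] M(2) iota_zero by simp
        finally have "(\<Sum>C\<in>lcosets_in G (L y) M. action model (coset_rep C \<otimes> x) w)
            + (\<Sum>C\<in>lcosets_in G (L y) M. action model (coset_rep C \<otimes> x) v2) = 0"
          unfolding sp(1) using repG by (simp add: R.action_add wV v2V sum.distrib)
        then have eq: "(\<Sum>C\<in>lcosets_in G (L y) M. action model (coset_rep C \<otimes> x) w)
            = - (\<Sum>C\<in>lcosets_in G (L y) M. action model (coset_rep C \<otimes> x) v2)" (is "?s = - ?s2")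
          by (simp add: eq_neg_iff_add_eq_0)
        have "?s \<in> V" using VA[OF repG sp(2)] by (intro vs.subspace_sum[OF VV(3)])
        moreover have "?s2 \<in> W" using WA[OF repG sp(3)] by (intro vs.subspace_sum[OF VV(4)])
        then have "?s \<in> W" unfolding eq by (rule vs.subspace_neg[OF VV(4)])
        ultimately show ?thesis using VW by blast
      qed
      show ?thesis
      proof (rule sum_fixed_vectors_vanish[OF rep K M(1) _ M(3) t(1)])
        show "M \<subseteq> K" using M(2) N1(2) by blast
        show "scl (r y) y \<in> vectors model" if "y \<in> t" for y
          using tV[OF that] VV vs.subspace_scale[OF VV(3)] by blast
        show "small (L y)" if "y \<in> t" for y by (rule Ls[OF that])
        show "M \<subseteq> L y" if "y \<in> t" for y using M(2) M0(2)[OF that] by blast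
        show "L y \<subseteq> K" for y by (rule LK)
        show "action model l (scl (r y) y) = scl (r y) y" if "y \<in> t" "l \<in> L y" for y l
          using Ly[OF that] R.action_scale[of l y] tV[OF that(1)] VV that(2) LK KG by (metis subsetD)
        show "w = (\<Sum>y\<in>t. scl (r y) y)" by (rule wt)
        show "action model n w = w" if "n \<in> M" for n using that M(2) M1(2) by blast
        show "(\<Sum>C\<in>lcosets_in G (L y) M. action model (coset_rep C \<otimes> x) w) = 0" if "y \<in> t" "x \<in> K" for y x
          by (rule vanish[OF that])
      qed
    qed
    ultimately show False by blast
  qed
qed

end

text \<open>\<open>pro_p_group\<close> speaks of normal open subgroups only. For general
  \<open>N\<close> the core \<open>M\<close> is normal in \<open>U\<close>, its index is a power of
  \<open>p\<close>, and the index of \<open>N\<close> divides it; as the characteristic is not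
  \<open>p\<close>, that power is invertible in \<open>'k\<close>.\<close>

lemma hecke_setup_pro_p:
  fixes G :: "('g, 'm) monoid_scheme"
  assumes p: "prime p" and char: "CHAR('k::field) \<noteq> p"
    and tdlc: "tdlc_group G T" and U: "compact_open_pro_p_subgroup p G T U"
  shows "hecke_setup TYPE('k) G T U"
proof -
  interpret topological_group G T using tdlc by (simp add: tdlc_group_def)
  have haus: "Hausdorff_space T" and td: "totally_disconnected_top T" using tdlc by (auto simp: tdlc_group_def)
  have sU: "subgroup U G" and cU: "compactin T U" and oU: "openin T U"
    and pro: "pro_p_group p (G\<lparr>carrier := U\<rparr>) (subtopology T U)"
    using U by (auto simp: compact_open_pro_p_subgroup_def compact_open_subgroup_def)
  have UG: "U \<subseteq> carrier G" using sU subgroup.subset by blast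
  have gU: "group (G\<lparr>carrier := U\<rparr>)" using subgroup.subgroup_is_group[OF sU is_group] .
  have pk: "of_nat p \<noteq> (0::'k)"
  proof
    assume "of_nat p = (0::'k)"
    then have "CHAR('k) dvd p" by (simp add: of_nat_eq_0_iff_char_dvd)
    then show False using p char by (auto simp: prime_nat_iff)
  qed
  show ?thesis
  proof (intro hecke_setup.intro hecke_setup_axioms.intro topological_group_axioms)
    show "\<exists>N. subgroup N G \<and> openin T N \<and> N \<subseteq> W" if "openin T W" "\<one>\<^bsub>G\<^esub> \<in> W" for W
      using van_dantzig[OF haus td sU cU oU that] by blast
    fix N assume N: "subgroup N G" "openin T N" "N \<subseteq> U"
    obtain M where M: "subgroup M G" "openin T M" "M \<subseteq> N" "\<And>x m. x \<in> U \<Longrightarrow> m \<in> M \<Longrightarrow> x \<otimes>\<^bsub>G\<^esub> m \<otimes>\<^bsub>G\<^esub> inv\<^bsub>G\<^esub> x \<in> M"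
      using open_core[OF sU N finite_lcosets_compact[OF cU N(1,2)]] by blast
    have MU: "M \<subseteq> U" using M(3) N(3) by blast
    have subM: "subgroup M (G\<lparr>carrier := U\<rparr>)" using subgroup_incl[OF M(1) sU MU] .
    have "M \<lhd> (G\<lparr>carrier := U\<rparr>)"
    proof (rule group.normal_invI[OF gU subM])
      fix x h assume "x \<in> carrier (G\<lparr>carrier := U\<rparr>)" "h \<in> M"
      then show "x \<otimes>\<^bsub>G\<lparr>carrier := U\<rparr>\<^esub> h \<otimes>\<^bsub>G\<lparr>carrier := U\<rparr>\<^esub> inv\<^bsub>G\<lparr>carrier := U\<rparr>\<^esub> x \<in> M"
        using M(4) m_inv_consistent[OF sU] by simp
    qed
    moreover have "openin (subtopology T U) M" using M(2) MU oU by (simp add: openin_open_subtopology)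
    ultimately obtain n where n: "Coset.order (G\<lparr>carrier := U\<rparr> Mod M) = p ^ n"
      using pro unfolding pro_p_group_def by blast
    \<comment> \<open>\<open>Mod\<close> is formed from right cosets; normality identifies them with
      the left cosets used here.\<close>
    have "rcosets\<^bsub>G\<lparr>carrier := U\<rparr>\<^esub> M = lcosets_in G U M"
    proof -
      have "M #>\<^bsub>G\<lparr>carrier := U\<rparr>\<^esub> x = x <#\<^bsub>G\<^esub> M" if "x \<in> U" for x
        using normal.coset_eq[OF \<open>M \<lhd> G\<lparr>carrier := U\<rparr>\<close>] that by (simp add: l_coset_def r_coset_def)
      then show ?thesis by (auto simp: RCOSETS_def lcosets_in_def)
    qed
    then have "card (lcosets_in G U M) = p ^ n" using n by (simp add: order_def FactGroup_def)
    moreover have "card (lcosets_in G U M) = card (lcosets_in G U N) * card (lcosets_in G N M)"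
    proof (rule card_lcosets_in_refine[OF N(1) M(1,3) UG])
      show "x \<otimes>\<^bsub>G\<^esub> m \<in> U" if "x \<in> U" "m \<in> N" for x m using that N(3) sU by (auto simp: subgroup.m_closed)
    qed
    ultimately have "of_nat (card (lcosets_in G U N)) * of_nat (card (lcosets_in G N M)) = (of_nat p :: 'k) ^ n"
      by (metis of_nat_mult of_nat_power)
    then show "of_nat (card (lcosets_in G U N)) \<noteq> (0::'k)" using pk by auto
  qed (fact haus sU cU oU)+
qed

theorem theorem2p3:
  fixes p :: nat
    and G :: "('g, 'm) monoid_scheme"
    and T :: "'g topology"
    and U :: "'g set"
    and scl :: "'k::alg_closed_field \<Rightarrow> 'v \<Rightarrow> 'v::ab_group_add"
    and scl' :: "'k \<Rightarrow> 'w \<Rightarrow> 'w::ab_group_add"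
    and \<iota> :: "('g, 'k) distribution \<Rightarrow> 'v"
    and R_heart R_spade :: "('g, 'v) group_rep set"
  assumes "prime p"
    and "CHAR('k) \<noteq> p"
    and "tdlc_group G T"
    and "\<exists>K. compact_open_pro_p_subgroup p G T K"
    and "vector_space scl"
    and "vector_space scl'"
    and "hecke_embedding G T scl \<iota>"
    and "compact_open_pro_p_subgroup p G T U"
    and "category_decomposition G T scl R_heart R_spade"
    and "\<forall>\<pi>\<in>R_heart. generated_by_fixed_vectors G scl U \<pi>"
  shows "\<forall>z\<in>center_vanishing_on G T scl R_spade.
           admissible_distribution G T scl' U (center_distribution G T \<iota> z)"
proof
  fix z assume z: "z \<in> center_vanishing_on G T scl R_spade"
  interpret hecke_setup G T U "TYPE('k)" by (rule hecke_setup_pro_p[OF assms(1-3,8)])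
  interpret vector_space scl by (rule assms(5))
  interpret hecke_model G T U "TYPE('k)" scl \<iota> by unfold_locales (rule assms(7))
  have "z \<in> bernstein_center G T scl" using z by (simp add: center_vanishing_on_def)
  then show "admissible_distribution G T scl' U (center_distribution G T \<iota> z)"
    using center_distribution(1) admissible_at_irreducible[OF assms(6,9,10) z]
    by (auto simp: admissible_distribution_def compact_open_subgroup_def small_def irreducible_reps_def)
qed

end
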